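(* Let $q$ be a prime power, let $n>1$ be an integer and let $\mathcal A\subseteq \mathbb{F}_{q^n}$ be an $\mathbb{F}_q$-affine space of dimension $t\ge 1$. For each positive divisor $d$ of $n$, let $n_{\mathcal A, d}$ be the number of elements of $\mathcal A$ whose degree over $\mathbb{F}_q$ equals $d$. If $\chi$ is a nontrivial multiplicative character of $\mathbb{F}_{q^n}$, then $$\left|\sum_{b\in \mathbb{F}_q}\sum_{a\in \mathcal A}\chi(a+b)\right|\le \sum_{d\mid n}n_{\mathcal A, d}\cdot \delta_{\chi, d},$$ where $\delta_{\chi, d}=q$ if the restriction $\chi|_{\mathbb{F}_{q^d}}$ is trivial and $\delta_{\chi, d}=\min\{q, (d-1)\sqrt{q}\}$ otherwise. In particular, if $n_{\mathcal A, n}>0$, then $$\left|\sum_{b\in \mathbb{F}_q}\sum_{a\in \mathcal A}\chi(a+b)\right|< n\cdot q^{t+1/2}.$$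
   Context: An $\mathbb{F}_q$-affine space in $\mathbb{F}_{q^n}$ is a set $u+\mathcal V$ with $u\in\mathbb{F}_{q^n}$ and $\mathcal V$ an $\mathbb{F}_q$-vector subspace of $\mathbb{F}_{q^n}$; its dimension is $\dim_{\mathbb{F}_q}\mathcal V$. An element $\alpha$ of the algebraic closure $\overline{\mathbb{F}}_q$ has degree $k$ over $\mathbb{F}_q$ if $\mathbb{F}_q(\alpha)=\mathbb{F}_{q^k}$, i.e. its minimal polynomial over $\mathbb{F}_q$ has degree $k$. A multiplicative character $\chi$ of $\mathbb{F}_{q^n}$ is a group homomorphism from $\mathbb{F}_{q^n}^*$ to the complex unit circle, extended to $0$ by $\chi(0)=0$ (for every $\chi$, including the trivial one). It is trivial if $\chi(a)=1$ for all $a\neq 0$; $\chi|_{\mathbb{F}_{q^d}}$ is trivial if $\chi(a)=1$ for all $a\in\mathbb{F}_{q^d}^*$, where $\mathbb{F}_{q^d}\subseteq\mathbb{F}_{q^n}$ is the subfield with $q^d$ elements. *)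

theory Defs
  imports
    "HOL-Algebra.Finite_Extensions"
    "HOL-Algebra.Multiplicative_Group"
    "HOL-Number_Theory.Prime_Powers"
begin

text \<open>
  The field with \<open>q ^ n\<close> elements is rendered as a field \<open>R\<close> of order \<open>q ^ n\<close>, and its subfield
  with \<open>q\<close> elements as a subfield \<open>K\<close> of \<open>R\<close> with \<open>card K = q\<close>.
\<close>

text \<open>
  The library's \<^const>\<open>subalgebra\<close> only asks for closure under addition, negation and
  multiplication by scalars from \<open>K\<close>, so it is the notion of a \<open>K\<close>-vector subspace of \<open>R\<close>.
\<close>

definition affine_space_of_dim ::
    "('a, 'b) ring_scheme \<Rightarrow> 'a set \<Rightarrow> nat \<Rightarrow> 'a set \<Rightarrow> bool" where
  "affine_space_of_dim R K t A \<longleftrightarrow>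
    (\<exists>u V. u \<in> carrier R \<and> subalgebra K V R \<and> ring.dimension R t K V \<and> A = u <+\<^bsub>R\<^esub> V)"

definition degree_over :: "('a, 'b) ring_scheme \<Rightarrow> 'a set \<Rightarrow> 'a \<Rightarrow> nat" where
  "degree_over R K a = Polynomials.degree (ring.Irr R K a)"

definition num_of_degree :: "('a, 'b) ring_scheme \<Rightarrow> 'a set \<Rightarrow> 'a set \<Rightarrow> nat \<Rightarrow> nat" where
  "num_of_degree R K A d = card {a \<in> A. degree_over R K a = d}"

text \<open>
  A finite field of order \<open>q ^ n\<close> has exactly one subfield with \<open>q ^ d\<close> elements for each
  divisor \<open>d\<close> of \<open>n\<close>; only such orders \<open>m = q ^ d\<close> are used below.
\<close>

definition subfield_of_order :: "('a, 'b) ring_scheme \<Rightarrow> nat \<Rightarrow> 'a set" where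
  "subfield_of_order R m = (THE L. subfield L R \<and> card L = m)"

definition unit_circle :: "complex monoid" where
  "unit_circle = \<lparr>carrier = {z. cmod z = 1}, mult = (*), one = 1\<rparr>"

definition multiplicative_character :: "('a, 'b) ring_scheme \<Rightarrow> ('a \<Rightarrow> complex) \<Rightarrow> bool" where
  "multiplicative_character R \<chi> \<longleftrightarrow> \<chi> \<in> hom (mult_of R) unit_circle \<and> \<chi> \<zero>\<^bsub>R\<^esub> = 0"

definition trivial_on :: "('a, 'b) ring_scheme \<Rightarrow> ('a \<Rightarrow> complex) \<Rightarrow> 'a set \<Rightarrow> bool" where
  "trivial_on R \<chi> L \<longleftrightarrow> (\<forall>a \<in> L - {\<zero>\<^bsub>R\<^esub>}. \<chi> a = 1)"

definition delta :: "('a, 'b) ring_scheme \<Rightarrow> nat \<Rightarrow> ('a \<Rightarrow> complex) \<Rightarrow> nat \<Rightarrow> real" where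
  "delta R q \<chi> d =
    (if trivial_on R \<chi> (subfield_of_order R (q ^ d)) then real q
     else min (real q) ((real d - 1) * sqrt (real q)))"

end

theory Submission
  imports
    "HOL-Computational_Algebra.Polynomial_FPS"
    "HOL-Computational_Algebra.Fundamental_Theorem_Algebra"
    "HOL-Algebra.Algebraic_Closure"
    Defs
begin

text \<open>
  Grouping the elements of the affine space by degree reduces the first claim to Katz's bound
  \<open>(d - 1) * sqrt q\<close> for the sum of \<open>\<chi> (a + b)\<close> over \<open>b\<close> in \<open>K\<close>, where \<open>a\<close> has degree \<open>d\<close>. For a
  monic polynomial \<open>g\<close> over \<open>K\<close> put \<open>X g = \<chi> (g(a))\<close>. The \<open>L\<close>-series of \<open>X\<close> is a polynomial of degree
  at most \<open>d - 1\<close>, since the values \<open>g(a)\<close> are equidistributed as soon as \<open>g\<close> has degree at least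
  \<open>d\<close>; its linear coefficient is the sum in question. By Newton's identities the \<open>m\<close>-th power sum of
  its inverse roots is, up to sign, the sum of \<open>\<chi>\<close> over the products of all \<open>a - y ^ (q ^ i)\<close>, \<open>i < m\<close>,
  with \<open>y\<close> in the field of \<open>q ^ m\<close> elements. For \<open>m\<close> a multiple of \<open>2 * d\<close> this sum is
  \<open>O(q ^ (m / 2))\<close> by Bombieri's form of Stepanov's method, which forces every inverse root to have
  absolute value at most \<open>sqrt q\<close>.

  For the strict inequality, an element of degree \<open>n\<close> in the affine space confines its elements of
  degree \<open>d < n\<close> to an affine subspace of smaller dimension.
\<close>

section \<open>The Frobenius map in prime characteristic\<close>

text \<open>The method bounds fibres only from above, and this is enough. The products occurring in
  the power sums are norms into \<open>E\<close>, so a power sum is the sum of \<chi> over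
  \<open>E\<close> weighted by the fibre sizes of a norm. As \<chi> has sum 0 over \<open>E\<close>,
  a common upper bound may be subtracted from every size; over nonzero values the differences then
  have one sign, and their total is known up to a bounded error because the fibres partition a field
  of known order. The restriction on \<open>m\<close> has two reasons: a multiple of
  \<open>d\<close> puts \<open>E\<close> inside the field of \<open>q ^ m\<close> elements, and an
  even multiple makes \<open>q ^ m\<close> the square of \<open>l = q ^ (m / 2)\<close> with
  \<open>q ^ d - 1\<close> dividing \<open>l - 1\<close>, the shape on which Bombieri's construction
  rests. Nothing is lost by it, nor by the implied constant, since the size of a root can be read
  off from its high powers. All these fields have to lie in a single one, so Katz's bound is proved
  inside an algebraic closure, to which the character is carried over.\<close>

lemma (in cring) binomial:
  assumes x: "x \<in> carrier R" and y: "y \<in> carrier R"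
  shows "(x \<oplus> y) [^] (n::nat) = (\<Oplus>i\<in>{..n}. [(n choose i)] \<cdot> (x [^] i \<otimes> y [^] (n - i)))"
proof (induction n)
  case 0
  show ?case using x y by simp
next
  case (Suc n)
  let ?t = "\<lambda>m i. x [^] i \<otimes> y [^] (m - i)"
  have tc [simp]: "?t m i \<in> carrier R" for m i :: nat
    using x y by simp
  have A: "(\<Oplus>i\<in>{..n}. [(n choose i)] \<cdot> ?t n i) \<otimes> x = (\<Oplus>i\<in>{..n}. [(n choose i)] \<cdot> ?t (Suc n) (Suc i))"
    using x y by (subst finsum_ldistr) (auto intro!: finsum_cong' simp: add_pow_ldistr add_pow_rdistr m_ac)
  have "(\<Oplus>i\<in>{..n}. [(n choose i)] \<cdot> ?t n i) \<otimes> y = (\<Oplus>i\<in>{..n}. [(n choose i)] \<cdot> ?t (Suc n) i)"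
    using x y by (subst finsum_ldistr)
      (auto intro!: finsum_cong' simp: add_pow_ldistr m_assoc Suc_diff_le)
  also have "\<dots> = (\<Oplus>i\<in>{..Suc n}. [(n choose i)] \<cdot> ?t (Suc n) i)"
    using x y by (subst finsum_Suc) (auto simp: binomial_eq_0)
  also have "\<dots> = (\<Oplus>i\<in>{..n}. [(n choose Suc i)] \<cdot> ?t (Suc n) (Suc i)) \<oplus> ?t (Suc n) 0"
    using x y by (subst finsum_Suc2) auto
  finally have B: "(\<Oplus>i\<in>{..n}. [(n choose i)] \<cdot> ?t n i) \<otimes> y
      = (\<Oplus>i\<in>{..n}. [(n choose Suc i)] \<cdot> ?t (Suc n) (Suc i)) \<oplus> ?t (Suc n) 0" .
  have "(x \<oplus> y) [^] Suc n = (\<Oplus>i\<in>{..n}. [(n choose i)] \<cdot> ?t n i) \<otimes> x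
      \<oplus> (\<Oplus>i\<in>{..n}. [(n choose i)] \<cdot> ?t n i) \<otimes> y"
    using x y by (simp add: Suc r_distr)
  also have "\<dots> = ((\<Oplus>i\<in>{..n}. [(n choose i)] \<cdot> ?t (Suc n) (Suc i))
      \<oplus> (\<Oplus>i\<in>{..n}. [(n choose Suc i)] \<cdot> ?t (Suc n) (Suc i))) \<oplus> ?t (Suc n) 0"
    unfolding A B using x y by (subst a_assoc) (auto intro!: finsum_closed)
  also have "(\<Oplus>i\<in>{..n}. [(n choose i)] \<cdot> ?t (Suc n) (Suc i))
      \<oplus> (\<Oplus>i\<in>{..n}. [(n choose Suc i)] \<cdot> ?t (Suc n) (Suc i))
      = (\<Oplus>i\<in>{..n}. [(Suc n choose Suc i)] \<cdot> ?t (Suc n) (Suc i))"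
    using x y by (subst finsum_addf[symmetric])
      (auto intro!: finsum_cong' simp: add.nat_pow_mult)
  also have "\<dots> \<oplus> ?t (Suc n) 0 = (\<Oplus>i\<in>{..Suc n}. [(Suc n choose i)] \<cdot> ?t (Suc n) i)"
    using x y by (subst finsum_Suc2) auto
  finally show ?case .
qed

lemma (in cring) add_pow_char_dvd:
  assumes "[(p::nat)] \<cdot> \<one> = \<zero>" "p dvd k" "x \<in> carrier R"
  shows "[k] \<cdot> x = \<zero>"
proof -
  obtain j where "k = p * j" using assms(2) by auto
  then have "[k] \<cdot> \<one> = \<zero>"
    using assms(1) add.nat_pow_pow[of \<one> j p] by (simp add: mult.commute)
  then show ?thesis
    using add_pow_ldistr[of \<one> x k] assms(3) by simp
qed

lemma (in cring) frobenius_add: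
  assumes p: "Factorial_Ring.prime p" "[(p::nat)] \<cdot> \<one> = \<zero>" and x: "x \<in> carrier R" and y: "y \<in> carrier R"
  shows "(x \<oplus> y) [^] p = x [^] p \<oplus> y [^] p"
proof -
  let ?f = "\<lambda>i. [(p choose i)] \<cdot> (x [^] i \<otimes> y [^] (p - i))"
  obtain m where m: "p = Suc m" using prime_gt_0_nat[OF p(1)] gr0_implies_Suc by blast
  have z: "?f i = \<zero>" if "0 < i" "i < p" for i
    using that x y p by (intro add_pow_char_dvd[OF p(2)] dvd_choose_prime) auto
  have "(x \<oplus> y) [^] p = (\<Oplus>i\<in>{..p}. ?f i)" by (rule binomial[OF x y])
  also have "\<dots> = (\<Oplus>i\<in>{0, p}. ?f i)"
    by (rule add.finprod_mono_neutral_cong_right) (use x y z in auto)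
  also have "\<dots> = x [^] p \<oplus> y [^] p"
    using x y m by (simp add: a_comm)
  finally show ?thesis .
qed

lemma (in cring) frobenius_pow_add:
  assumes p: "Factorial_Ring.prime p" "[(p::nat)] \<cdot> \<one> = \<zero>" and "x \<in> carrier R" "y \<in> carrier R"
  shows "(x \<oplus> y) [^] (p ^ k) = x [^] (p ^ k) \<oplus> y [^] (p ^ k)"
proof (induction k)
  case (Suc k)
  have *: "z [^] (p ^ Suc k) = (z [^] (p ^ k)) [^] p" if "z \<in> carrier R" for z
    using that by (simp add: nat_pow_pow mult.commute)
  show ?case
    using Suc assms by (simp only: * a_closed nat_pow_closed frobenius_add[OF p])
qed (use assms in simp)

lemma (in cring) frobenius_pow_minus:
  assumes p: "Factorial_Ring.prime p" "[(p::nat)] \<cdot> \<one> = \<zero>" and x: "x \<in> carrier R" and y: "y \<in> carrier R"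
  shows "(x \<ominus> y) [^] (p ^ k) = x [^] (p ^ k) \<ominus> y [^] (p ^ k)"
proof -
  have "x [^] (p ^ k) = ((x \<ominus> y) \<oplus> y) [^] (p ^ k)"
    using x y by (simp add: a_minus_def a_assoc l_neg)
  also have "\<dots> = (x \<ominus> y) [^] (p ^ k) \<oplus> y [^] (p ^ k)"
    using x y by (intro frobenius_pow_add[OF p]) auto
  finally show ?thesis
    using x y by (simp add: a_minus_def a_assoc r_neg)
qed

lemma (in cring) frobenius_pow_finsum:
  assumes p: "Factorial_Ring.prime p" "[(p::nat)] \<cdot> \<one> = \<zero>" and "f \<in> A \<rightarrow> carrier R"
  shows "(\<Oplus>i\<in>A. f i) [^] (p ^ k) = (\<Oplus>i\<in>A. f i [^] (p ^ k))"
  using assms(3)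
proof (induction A rule: infinite_finite_induct)
  case (insert a A)
  then have c: "f a \<in> carrier R" "f \<in> A \<rightarrow> carrier R" by auto
  have "(\<Oplus>i\<in>insert a A. f i) [^] (p ^ k) = (f a \<oplus> (\<Oplus>i\<in>A. f i)) [^] (p ^ k)"
    using c insert by simp
  also have "\<dots> = f a [^] (p ^ k) \<oplus> (\<Oplus>i\<in>A. f i) [^] (p ^ k)"
    using c by (intro frobenius_pow_add[OF p]) auto
  also have "\<dots> = f a [^] (p ^ k) \<oplus> (\<Oplus>i\<in>A. f i [^] (p ^ k))"
    using insert c by simp
  also have "\<dots> = (\<Oplus>i\<in>insert a A. f i [^] (p ^ k))"
    using insert(1,2) c by (subst finsum_insert) (auto simp: Pi_iff)
  finally show ?case .
qed (use prime_gt_0_nat[OF p(1)] in \<open>auto simp: nat_pow_zero\<close>)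

section \<open>Polynomials over finite fields\<close>

lemma (in ring) card_dimension:
  assumes K: "subfield K R" "finite K" and dim: "dimension n K E"
  shows "finite E" "card E = card K ^ n"
proof -
  obtain Us where Us: "set Us \<subseteq> carrier R" "independent K Us" "length Us = n" "Span K Us = E"
    using exists_base[OF K(1) dim] by blast
  let ?A = "{Ks. set Ks \<subseteq> K \<and> length Ks = n}"
  have "bij_betw (\<lambda>Ks. combine Ks Us) ?A E"
    unfolding bij_betw_def
  proof
    show "inj_on (\<lambda>Ks. combine Ks Us) ?A"
    proof (rule inj_onI)
      fix Ks Ks' assume A: "Ks \<in> ?A" "Ks' \<in> ?A" "combine Ks Us = combine Ks' Us"
      then have "combine Ks Us \<in> Span K Us"
        unfolding Span_eq_combine_set_length_version[OF K(1) Us(1)] using Us(3) by auto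
      then have "\<exists>!L. set L \<subseteq> K \<and> length L = length Us \<and> combine Ks Us = combine L Us"
        using unique_decomposition[OF K(1) Us(2)] by blast
      moreover have "set Ks \<subseteq> K \<and> length Ks = length Us \<and> combine Ks Us = combine Ks Us"
        "set Ks' \<subseteq> K \<and> length Ks' = length Us \<and> combine Ks Us = combine Ks' Us"
        using A Us(3) by simp_all
      ultimately show "Ks = Ks'" by blast
    qed
    show "(\<lambda>Ks. combine Ks Us) ` ?A = E"
      using Span_eq_combine_set_length_version[OF K(1) Us(1)] Us(3,4) by auto
  qed
  then show "finite E" "card E = card K ^ n"
    using finite_lists_length_eq[OF K(2), of n] card_lists_length_eq[OF K(2), of n]
    by (auto simp: bij_betw_finite bij_betw_same_card[symmetric])
qed

text \<open>Length at most \<open>n\<close> means degree below \<open>n\<close>, with the zero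
  polynomial \<open>[]\<close> included; these form a space of dimension \<open>n\<close> over the
  constants, which are a copy of \<open>K\<close>.\<close>

lemma (in domain) card_polys_length_le:
  assumes K: "subfield K R" "finite K"
  shows "finite {p \<in> carrier (K[X]). length p \<le> n}" "card {p \<in> carrier (K[X]). length p \<le> n} = card K ^ n"
proof -
  interpret P: domain "K[X]"
    using univ_poly_is_domain[OF subfieldE(1)[OF K(1)]] .
  have inj: "inj_on poly_of_const K"
    by (auto simp: poly_of_const_def inj_on_def split: if_splits)
  note P.card_dimension[OF univ_poly_subfield_of_consts[OF K(1)] _ bounded_degree_dimension[OF K(1), of n]]
  then show "finite {p \<in> carrier (K[X]). length p \<le> n}" "card {p \<in> carrier (K[X]). length p \<le> n} = card K ^ n"
    using K(2) card_image[OF inj] by auto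
qed

lemma (in field) subfield_pow_card:
  assumes K: "subfield K R" "finite K" and x: "x \<in> K"
  shows "x [^] card K = x"
proof (cases "x = \<zero>")
  case True
  have "card K \<noteq> 0" using K x by auto
  then show ?thesis using True nat_pow_zero by simp
next
  case False
  interpret S: field "R \<lparr> carrier := K \<rparr>" using subfield_iff(2)[OF K(1)] .
  interpret G: group "Multiplicative_Group.mult_of (R \<lparr> carrier := K \<rparr>)" by (rule S.field_mult_group)
  have K0: "card K > 0" using K x card_gt_0_iff by blast
  have o: "order (Multiplicative_Group.mult_of (R \<lparr> carrier := K \<rparr>)) = card K - 1"
    using S.order_mult_of K(2) by (simp add: order_def)
  have "x [^]\<^bsub>Multiplicative_Group.mult_of (R \<lparr> carrier := K \<rparr>)\<^esub> order (Multiplicative_Group.mult_of (R \<lparr> carrier := K \<rparr>)) = \<one>\<^bsub>Multiplicative_Group.mult_of (R \<lparr> carrier := K \<rparr>)\<^esub>"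
    using G.pow_order_eq_1[of x] x False K(2) by simp
  then have "x [^]\<^bsub>R \<lparr> carrier := K \<rparr>\<^esub> (card K - 1) = \<one>"
    unfolding o by (simp add: Multiplicative_Group.nat_pow_mult_of)
  then have "x [^] (card K - 1) = \<one>"
    unfolding nat_pow_consistent[of x "card K - 1" K, symmetric] .
  moreover have "x \<in> carrier R" using x subfieldE(3)[OF K(1)] by auto
  moreover have "x [^] card K = x [^] Suc (card K - 1)" using K0 by simp
  ultimately show ?thesis by simp
qed

section \<open>Degrees, zeros and orders at 0\<close>

lemma (in domain) nat_pow_nonzero:
  assumes "x \<in> carrier R" "x \<noteq> \<zero>"
  shows "x [^] (n::nat) \<noteq> \<zero>"
  using assms by (induction n) (auto simp: integral_iff)

lemma (in domain) degree_add_le: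
  assumes "subring K R" "p \<in> carrier (K[X])" "q \<in> carrier (K[X])" "degree p \<le> n" "degree q \<le> n"
  shows "degree (p \<oplus>\<^bsub>K[X]\<^esub> q) \<le> n"
  using poly_add_degree[of p q] assms unfolding univ_poly_add by linarith

lemma (in domain) degree_mult_le:
  assumes "subring K R" "p \<in> carrier (K[X])" "q \<in> carrier (K[X])" "degree p \<le> m" "degree q \<le> n"
  shows "degree (p \<otimes>\<^bsub>K[X]\<^esub> q) \<le> m + n"
  using poly_mult_degree_eq[OF assms(1), of p q] assms unfolding univ_poly_mult univ_poly_carrier
  by (auto split: if_splits)

lemma (in domain) degree_finsum_le:
  assumes K: "subring K R" and "f \<in> A \<rightarrow> carrier (K[X])" "\<And>i. i \<in> A \<Longrightarrow> degree (f i) \<le> n"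
  shows "degree (\<Oplus>\<^bsub>K[X]\<^esub>i\<in>A. f i) \<le> n"
proof -
  interpret P: domain "K[X]" using univ_poly_is_domain[OF K] .
  show ?thesis
    using assms(2,3)
  proof (induction A rule: infinite_finite_induct)
    case (insert a A)
    then have "(\<Oplus>\<^bsub>K[X]\<^esub>i\<in>insert a A. f i) = f a \<oplus>\<^bsub>K[X]\<^esub> (\<Oplus>\<^bsub>K[X]\<^esub>i\<in>A. f i)"
      by (subst P.finsum_insert) auto
    moreover have "degree (f a \<oplus>\<^bsub>K[X]\<^esub> (\<Oplus>\<^bsub>K[X]\<^esub>i\<in>A. f i)) \<le> n"
      using insert by (intro degree_add_le[OF K]) (auto intro!: P.finsum_closed)
    ultimately show ?case by simp
  qed (simp_all add: univ_poly_zero)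
qed

lemma (in field) card_zeros_le_degree:
  assumes p: "p \<in> carrier (poly_ring R)" "p \<noteq> []"
    and S: "S \<subseteq> carrier R" "\<And>x. x \<in> S \<Longrightarrow> eval p x = \<zero>"
  shows "finite S" "card S \<le> degree p"
proof -
  have sub: "S \<subseteq> set_mset (roots p)"
    using S p roots_mem_iff_is_root[OF p(1)] by (auto simp: is_root_def)
  then show "finite S" using finite_set_mset finite_subset by blast
  have "card S \<le> card (set_mset (roots p))" using sub by (simp add: card_mono)
  also have "\<dots> \<le> size (roots p)"
    unfolding card_eq_sum size_multiset_overloaded_eq by (intro sum_mono) simp
  also have "\<dots> \<le> degree p" using size_roots_le_degree[OF p(1)] .
  finally show "card S \<le> degree p" .
qed

text \<open>A nonzero \<open>k w\<close> has order below \<open>h\<close> at 0, and \<open>V\<close>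
  does not vanish there, so the summand at \<open>w\<close> has its order in the window from
  \<open>os w\<close> to \<open>os w + h - 1\<close>. The windows are disjoint, hence the nonzero
  summand of least index cannot be cancelled by the others.\<close>

lemma (in field) X_adic_independent:
  fixes n w :: nat
  assumes K: "subfield K R" and V: "V \<in> carrier (K[X])" "eval V \<zero> \<noteq> \<zero>"
    and k: "\<And>w. w < n \<Longrightarrow> k w \<in> carrier (K[X])" "\<And>w. w < n \<Longrightarrow> degree (k w) < h"
    and os: "\<And>w w'. w < w' \<Longrightarrow> w' < n \<Longrightarrow> os w + h \<le> os w'"
    and zero: "(\<Oplus>\<^bsub>K[X]\<^esub>w\<in>{..<n}. k w \<otimes>\<^bsub>K[X]\<^esub> X [^]\<^bsub>K[X]\<^esub> (os w :: nat) \<otimes>\<^bsub>K[X]\<^esub> V [^]\<^bsub>K[X]\<^esub> (vs w :: nat)) = []"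
    and w: "w < n"
  shows "k w = []"
proof (rule ccontr)
  assume "k w \<noteq> []"
  define w0 where "w0 = (LEAST w. w < n \<and> k w \<noteq> [])"
  have w0: "w0 < n" "k w0 \<noteq> []"
    using LeastI[of "\<lambda>w. w < n \<and> k w \<noteq> []"] w \<open>k w \<noteq> []\<close> unfolding w0_def by auto
  have small: "k w = []" if "w < w0" for w
    using not_less_Least[of w "\<lambda>w. w < n \<and> k w \<noteq> []"] that w0 unfolding w0_def by auto
  have K_subring: "subring K R" using subfieldE(1)[OF K] .
  interpret P: domain "K[X]" using univ_poly_is_domain[OF K_subring] .
  let ?P = "K[X]"
  note var = var_closed(1)[OF K_subring]
  let ?t = "\<lambda>w. k w \<otimes>\<^bsub>?P\<^esub> X [^]\<^bsub>?P\<^esub> os w \<otimes>\<^bsub>?P\<^esub> V [^]\<^bsub>?P\<^esub> vs w"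
  let ?g = "\<lambda>w. k w \<otimes>\<^bsub>?P\<^esub> X [^]\<^bsub>?P\<^esub> (os w - (os w0 + h)) \<otimes>\<^bsub>?P\<^esub> V [^]\<^bsub>?P\<^esub> vs w"
  have tc: "?t w \<in> carrier ?P" "?g w \<in> carrier ?P" if "w < n" for w
    using that k V var by auto
  have Xo: "X [^]\<^bsub>?P\<^esub> (os w0 + h) = X [^]\<^bsub>?P\<^esub> os w0 \<otimes>\<^bsub>?P\<^esub> X [^]\<^bsub>?P\<^esub> h"
    using P.nat_pow_mult[OF var] by simp
  \<comment> \<open>Later summands are divisible by \<open>X ^ (os w0 + h)\<close>. Only
    \<open>X ^ os w0\<close> is cancelled afterwards, which leaves a factor \<open>X ^ h\<close>
    against \<open>k w0\<close>.\<close>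
  have fac: "?t w = X [^]\<^bsub>?P\<^esub> (os w0 + h) \<otimes>\<^bsub>?P\<^esub> ?g w" if "w0 < w" "w < n" for w
  proof -
    have "os w = (os w0 + h) + (os w - (os w0 + h))" using os[OF that] by simp
    then have "X [^]\<^bsub>?P\<^esub> os w = X [^]\<^bsub>?P\<^esub> (os w0 + h) \<otimes>\<^bsub>?P\<^esub> X [^]\<^bsub>?P\<^esub> (os w - (os w0 + h))"
      using P.nat_pow_mult[OF var, of "os w0 + h" "os w - (os w0 + h)"] by simp
    then show ?thesis using var V k(1)[OF that(2)]
      by (simp add: P.m_ac del: P.nat_pow_Suc)
  qed
  define G where "G = (\<Oplus>\<^bsub>?P\<^esub>w\<in>{w0<..<n}. ?g w)"
  have Gc: "G \<in> carrier ?P" unfolding G_def using tc by (intro P.finsum_closed) auto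
  have "[] = (\<Oplus>\<^bsub>?P\<^esub>w\<in>{w0..<n}. ?t w)"
    unfolding zero[symmetric]
    by (rule P.add.finprod_mono_neutral_cong_right)
      (use tc small var V in \<open>auto simp: univ_poly_zero[symmetric, of R K]\<close>)
  also have "{w0..<n} = insert w0 {w0<..<n}" using w0 by auto
  also have "(\<Oplus>\<^bsub>?P\<^esub>w\<in>insert w0 {w0<..<n}. ?t w) = ?t w0 \<oplus>\<^bsub>?P\<^esub> (\<Oplus>\<^bsub>?P\<^esub>w\<in>{w0<..<n}. ?t w)"
    using tc w0 by (subst P.finsum_insert) auto
  also have "(\<Oplus>\<^bsub>?P\<^esub>w\<in>{w0<..<n}. ?t w) = (\<Oplus>\<^bsub>?P\<^esub>w\<in>{w0<..<n}. X [^]\<^bsub>?P\<^esub> (os w0 + h) \<otimes>\<^bsub>?P\<^esub> ?g w)"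
    using fac tc var by (intro P.finsum_cong') auto
  also have "\<dots> = X [^]\<^bsub>?P\<^esub> (os w0 + h) \<otimes>\<^bsub>?P\<^esub> G"
    unfolding G_def using tc var by (intro P.finsum_rdistr[symmetric]) auto
  finally have "\<zero>\<^bsub>?P\<^esub> = ?t w0 \<oplus>\<^bsub>?P\<^esub> X [^]\<^bsub>?P\<^esub> (os w0 + h) \<otimes>\<^bsub>?P\<^esub> G"
    by (simp add: univ_poly_zero)
  also have "\<dots> = X [^]\<^bsub>?P\<^esub> os w0 \<otimes>\<^bsub>?P\<^esub> (V [^]\<^bsub>?P\<^esub> vs w0 \<otimes>\<^bsub>?P\<^esub> k w0 \<oplus>\<^bsub>?P\<^esub> X [^]\<^bsub>?P\<^esub> h \<otimes>\<^bsub>?P\<^esub> G)"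
    using var V k(1)[OF w0(1)] Gc unfolding Xo by (simp add: P.m_ac P.r_distr)
  finally have e: "X [^]\<^bsub>?P\<^esub> os w0 \<otimes>\<^bsub>?P\<^esub> (V [^]\<^bsub>?P\<^esub> vs w0 \<otimes>\<^bsub>?P\<^esub> k w0 \<oplus>\<^bsub>?P\<^esub> X [^]\<^bsub>?P\<^esub> h \<otimes>\<^bsub>?P\<^esub> G) = \<zero>\<^bsub>?P\<^esub>"
    by simp
  have Xne: "X [^]\<^bsub>?P\<^esub> os w0 \<noteq> \<zero>\<^bsub>?P\<^esub>"
    using subring_polynomial_pow_not_zero[OF K_subring var] by (simp add: univ_poly_zero var_def)
  then have "V [^]\<^bsub>?P\<^esub> vs w0 \<otimes>\<^bsub>?P\<^esub> k w0 \<oplus>\<^bsub>?P\<^esub> X [^]\<^bsub>?P\<^esub> h \<otimes>\<^bsub>?P\<^esub> G = \<zero>\<^bsub>?P\<^esub>"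
    using e P.integral_iff var V k(1)[OF w0(1)] Gc by auto
  then have "V [^]\<^bsub>?P\<^esub> vs w0 \<otimes>\<^bsub>?P\<^esub> k w0 = X [^]\<^bsub>?P\<^esub> h \<otimes>\<^bsub>?P\<^esub> (\<ominus>\<^bsub>?P\<^esub> G)"
    using P.sum_zero_eq_neg var V k(1)[OF w0(1)] Gc by (simp add: P.r_minus)
  then have "X [^]\<^bsub>?P\<^esub> h divides\<^bsub>?P\<^esub> (V [^]\<^bsub>?P\<^esub> vs w0 \<otimes>\<^bsub>?P\<^esub> k w0)"
    using Gc by (intro dividesI[of "\<ominus>\<^bsub>?P\<^esub> G"]) auto
  then have d: "X [^]\<^bsub>?P\<^esub> h pdivides (V [^]\<^bsub>?P\<^esub> vs w0 \<otimes>\<^bsub>?P\<^esub> k w0)"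
    using pdivides_iff_shell[OF K] var V k(1)[OF w0(1)] by auto
  \<comment> \<open>\<open>X\<close> is irreducible and does not divide a power of \<open>V\<close>,
    so all of \<open>X ^ h\<close> must divide \<open>k w0\<close>, whose degree is too
    small.\<close>
  have irr: "pirreducible K X"
    using degree_one_imp_pirreducible[OF K var] by (simp add: var_def)
  interpret ev: ring_hom_ring ?P R "\<lambda>p. eval p \<zero>" using eval_ring_hom[OF K_subring] by simp
  have "eval (V [^]\<^bsub>?P\<^esub> vs w0) \<zero> = eval V \<zero> [^] vs w0"
    using ev.hom_nat_pow V by simp
  also have "\<dots> \<noteq> \<zero>"
    using V by (intro nat_pow_nonzero) auto
  finally have "\<not> X pdivides (V [^]\<^bsub>?P\<^esub> vs w0)"
    using pdivides_imp_root_sharing[of X "V [^]\<^bsub>?P\<^esub> vs w0" \<zero>] carrier_polynomial_shell[OF K_subring var]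
    by (auto simp: eval_var)
  then have "X [^]\<^bsub>?P\<^esub> h pdivides k w0"
    using pirreducible_pow_pdivides_iff[OF K var _ k(1)[OF w0(1)] irr] d V by auto
  then have "degree (X [^]\<^bsub>?P\<^esub> h) \<le> degree (k w0)"
    using pdivides_imp_degree_le[OF K_subring _ k(1)[OF w0(1)] w0(2)] var by auto
  moreover have "degree (X [^]\<^bsub>?P\<^esub> h) = h"
    using subring_polynomial_pow_degree[OF K_subring var] by (simp add: var_def)
  ultimately show False using k(2)[OF w0(1)] by simp
qed

section \<open>Bombieri's form of Stepanov's method\<close>

lemma (in ring_hom_ring) hom_add_pow:
  assumes "x \<in> carrier R"
  shows "h ([(n::nat)] \<cdot> x) = [n] \<cdot>\<^bsub>S\<^esub> h x"
  using assms by (induction n) auto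

text \<open>Makes the Frobenius lemmas available in the polynomial ring itself.\<close>

lemma (in domain) univ_poly_char:
  assumes K: "subring K R" and p: "[(p::nat)] \<cdot> \<one> = \<zero>"
  shows "[p] \<cdot>\<^bsub>K[X]\<^esub> \<one>\<^bsub>K[X]\<^esub> = \<zero>\<^bsub>K[X]\<^esub>"
proof -
  interpret h: ring_hom_ring "R \<lparr> carrier := K \<rparr>" "K[X]" poly_of_const
    using canonical_embedding_ring_hom[OF K] .
  have "[p] \<cdot>\<^bsub>R \<lparr> carrier := K \<rparr>\<^esub> \<one> = [p] \<cdot> \<one>"
    by (simp add: add_pow_def nat_pow_def)
  then show ?thesis
    using h.hom_add_pow[of "\<one>" p] h.hom_one h.hom_zero p subringE(3)[OF K] by simp
qed

text \<open>Takes the place of a kernel dimension: the map to which it is applied raises its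
  arguments to \<open>l\<close>-th powers, so it is additive but not linear over \<open>K\<close>.
  Two arguments with the same image differ by a nontrivial element of the kernel.\<close>

lemma pow_inj_pigeonhole:
  fixes q :: nat
  assumes "finite A" "finite B" "card A = q ^ a" "card B = q ^ b" "b < a" "q \<ge> 2" "T ` A \<subseteq> B"
  obtains x y where "x \<in> A" "y \<in> A" "x \<noteq> y" "T x = T y"
proof -
  have "card B < card A" using assms by simp
  then have "\<not> inj_on T A"
    using card_inj_on_le[OF _ assms(7,2)] by auto
  then show ?thesis using that unfolding inj_on_def by blast
qed

text \<open>
  Put \<open>H = X V\<close>. Counting coefficients gives polynomials \<open>k w\<close> of degree below \<open>h\<close>, not all zero,
  such that \<open>F\<close>, the sum of the \<open>k w * H ^ (h * i) * X ^ (l * j)\<close> with \<open>i = w mod r\<close> and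
  \<open>j = w div r\<close>, satisfies \<open>H x ^ (r * h) * F x ^ l = 0\<close> at every point \<open>x\<close> to be counted: there
  \<open>x ^ (l * l) = x\<close> and \<open>H x ^ (h * (l + 1)) = z\<close> turn the left-hand side into a polynomial of low
  degree in \<open>x\<close>. Taking an \<open>l\<close>-th power plays the role of the high order of vanishing in
  Stepanov's argument. That \<open>F\<close> is not zero is read off from the orders at \<open>0\<close> of its summands,
  where \<open>H\<close> has a simple zero.
\<close>

lemma (in field) bombieri_stepanov:
  fixes l r h D e p :: nat
  assumes K: "subfield K R" "card K = l ^ 2"
    and p: "Factorial_Ring.prime p" "[p] \<cdot> \<one> = \<zero>" and l: "l = p ^ e" "l = r * h + 1"
    and r: "r \<ge> 1"
    and V: "V \<in> carrier (K[X])" "eval V \<zero> \<noteq> \<zero>"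
    and D: "D = Suc (degree V)" and h: "h > D + 3"
    and z: "z \<in> K" "z \<noteq> \<zero>"
  shows "card {x \<in> K. eval (X \<otimes>\<^bsub>K[X]\<^esub> V) x [^] (h * (l + 1)) = z} \<le> l * (h + 2 * D + 3)"
proof -
  let ?P = "K[X]"
  have K_subring: "subring K R" using subfieldE(1)[OF K(1)] .
  interpret P: domain "K[X]" using univ_poly_is_domain[OF K_subring] .
  note var = var_closed(1)[OF K_subring]
  have degX: "degree X = 1" by (simp add: var_def)
  have lge: "l \<ge> 2" using l(2) r h by (simp add: Suc_leI)
  have Q: "card K \<ge> 2" using K(2) mult_le_mono[OF lge lge] by (simp add: power2_eq_square)
  have fin: "finite K" using Q card.infinite by fastforce
  have K_carrier: "x \<in> carrier R" if "x \<in> K" for x using that subfieldE(3)[OF K(1)] by auto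
  have charP: "[p] \<cdot>\<^bsub>?P\<^esub> \<one>\<^bsub>?P\<^esub> = \<zero>\<^bsub>?P\<^esub>" using univ_poly_char[OF K_subring p(2)] .
  define H where "H = X \<otimes>\<^bsub>?P\<^esub> V"
  have Hc: "H \<in> carrier ?P" unfolding H_def using var V by simp
  have degH: "degree H \<le> D"
    using degree_mult_le[OF K_subring var V(1), of 1 "degree V"] degX D unfolding H_def by simp
  \<comment> \<open>There will be \<open>h * n\<close> unknown coefficients against the
    \<open>N + 1\<close> coefficients of \<open>T k\<close>. In \<open>J\<close> the term
    \<open>h\<close> pays for \<open>l * (h - 1)\<close>, the term \<open>D\<close> for the powers
    of \<open>H\<close>, and 3 for what is left, in view of \<open>h > D + 3\<close>.\<close>
  define J where "J = h + D + 3"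
  define n where "n = r * J"
  \<comment> \<open>What becomes of \<open>H ^ (h * i) * X ^ (l * j)\<close> at a counted point
    after raising to the power \<open>l\<close> and multiplying by \<open>H ^ (r * h)\<close>: there
    \<open>H ^ (h * i * l + r * h)\<close> equals \<open>z ^ i * H ^ ((r - i) * h)\<close> and
    \<open>X ^ (l * l * j)\<close> equals \<open>X ^ j\<close>. The factor
    \<open>H ^ (r * h)\<close> keeps the remaining exponent of \<open>H\<close> from being
    negative.\<close>
  define c where "c w = [z [^] (w mod r)] \<otimes>\<^bsub>?P\<^esub> H [^]\<^bsub>?P\<^esub> ((r - w mod r) * h) \<otimes>\<^bsub>?P\<^esub> X [^]\<^bsub>?P\<^esub> (w div r)" for w :: nat
  define T where "T k = (\<Oplus>\<^bsub>?P\<^esub>w\<in>{..<n}. k w [^]\<^bsub>?P\<^esub> l \<otimes>\<^bsub>?P\<^esub> c w)" for k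
  define N where "N = l * (h - 1) + r * h * D + J"
  have zc: "[z [^] i] \<in> carrier ?P" for i :: nat
  proof -
    interpret S: field "R \<lparr> carrier := K \<rparr>" using subfield_iff(2)[OF K(1)] .
    have "z [^] i \<in> K" using S.nat_pow_closed[of z i] z(1) unfolding nat_pow_consistent[of z i K, symmetric] by simp
    moreover have "z [^] i \<noteq> \<zero>" using nat_pow_nonzero[of z i] z K_carrier by simp
    ultimately show ?thesis using const_is_polynomial[of "z [^] i" K] univ_poly_carrier by blast
  qed
  have cc: "c w \<in> carrier ?P" for w unfolding c_def using zc Hc var by simp
  have deg_pow: "degree (f [^]\<^bsub>?P\<^esub> m) \<le> m * d" if "f \<in> carrier ?P" "degree f \<le> d" for f and m d :: nat
    using subring_polynomial_pow_degree[OF K_subring that(1), of m] that(2) by simp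
  have degc: "degree (c w) \<le> r * h * D + J" if w: "w < n" for w
  proof -
    have "w div r < J" using w unfolding n_def by (simp add: less_mult_imp_div_less mult.commute)
    moreover have "(r - w mod r) * h * D \<le> r * h * D" by (intro mult_le_mono) auto
    moreover have "degree (c w) \<le> (0 + (r - w mod r) * h * D) + (w div r) * 1"
      unfolding c_def using zc Hc var degH degX
      by (intro degree_mult_le[OF K_subring] deg_pow) auto
    ultimately show ?thesis by linarith
  qed
  define A where "A = {q \<in> carrier ?P. length q \<le> h}"
  define B where "B = {q \<in> carrier ?P. length q \<le> N + 1}"
  have Ad: "degree q < h" if "q \<in> A" for q using that h unfolding A_def by auto
  have Ac: "q \<in> carrier ?P" if "q \<in> A" for q using that unfolding A_def by auto
  have finA: "finite A" and cardA: "card A = card K ^ h"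
    unfolding A_def using card_polys_length_le[OF K(1) fin] by auto
  have finB: "finite B" and cardB: "card B = card K ^ (N + 1)"
    unfolding B_def using card_polys_length_le[OF K(1) fin] by auto
  have TB: "T k \<in> B" if k: "k \<in> {..<n} \<rightarrow>\<^sub>E A" for k
  proof -
    have kw: "k w \<in> A" if "w < n" for w using k that by (auto simp: PiE_iff)
    have "degree (T k) \<le> N" unfolding T_def
    proof (rule degree_finsum_le[OF K_subring])
      show "(\<lambda>w. k w [^]\<^bsub>?P\<^esub> l \<otimes>\<^bsub>?P\<^esub> c w) \<in> {..<n} \<rightarrow> carrier ?P"
        using Ac kw cc by auto
      fix w assume "w \<in> {..<n}"
      then have w: "w < n" by simp
      have "degree (k w [^]\<^bsub>?P\<^esub> l \<otimes>\<^bsub>?P\<^esub> c w) \<le> l * (h - 1) + (r * h * D + J)"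
        using Ac[OF kw[OF w]] Ad[OF kw[OF w]] cc degc[OF w]
        by (intro degree_mult_le[OF K_subring] deg_pow) auto
      then show "degree (k w [^]\<^bsub>?P\<^esub> l \<otimes>\<^bsub>?P\<^esub> c w) \<le> N" unfolding N_def by simp
    qed
    moreover have "T k \<in> carrier ?P" unfolding T_def using Ac kw cc by (intro P.finsum_closed) auto
    ultimately show ?thesis unfolding B_def by auto
  qed
  have ineq: "N + 1 < h * n"
  proof -
    obtain h' where h': "h = Suc h'" using h by (cases h) auto
    have "r * h \<ge> h" using r by simp
    moreover have "h * n = r * h * h + r * h * D + 3 * (r * h)"
      unfolding n_def J_def by (simp add: algebra_simps)
    moreover have "N + 1 + r * h = r * h * h + 2 * h + r * h * D + D + 3"
      unfolding N_def J_def l(2) h' by (simp add: algebra_simps)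
    ultimately show ?thesis using h by linarith
  qed
  obtain k k' where kk: "k \<in> {..<n} \<rightarrow>\<^sub>E A" "k' \<in> {..<n} \<rightarrow>\<^sub>E A" "k \<noteq> k'" "T k = T k'"
  proof (rule pow_inj_pigeonhole[of "{..<n} \<rightarrow>\<^sub>E A" B "card K" "h * n" "N + 1" T])
    show "card ({..<n} \<rightarrow>\<^sub>E A) = card K ^ (h * n)"
      using finA cardA by (simp add: card_PiE power_mult)
  qed (use finA finB cardB ineq Q TB in \<open>auto intro: finite_PiE\<close>)
  have kA: "k w \<in> A" "k' w \<in> A" if "w < n" for w using kk(1,2) that by (auto simp: PiE_iff)
  define d where "d w = k w \<ominus>\<^bsub>?P\<^esub> k' w" for w
  have dc: "d w \<in> carrier ?P" if "w < n" for w unfolding d_def using Ac kA[OF that] by auto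
  have dd: "degree (d w) < h" if "w < n" for w
  proof -
    have "degree (d w) \<le> h - 1" unfolding d_def a_minus_def
      using Ac[OF kA(1)[OF that]] Ac[OF kA(2)[OF that]] Ad[OF kA(1)[OF that]] Ad[OF kA(2)[OF that]]
        univ_poly_a_inv_degree[OF K_subring, of "k' w"]
      by (intro degree_add_le[OF K_subring]) auto
    then show ?thesis using h by simp
  qed
  have dk: "d w \<oplus>\<^bsub>?P\<^esub> k' w = k w" if "w < n" for w
    unfolding d_def using Ac[OF kA(1)[OF that]] Ac[OF kA(2)[OF that]]
    by (simp add: a_minus_def P.a_assoc P.l_neg)
  obtain w0 where w0: "w0 < n" "d w0 \<noteq> []"
  proof -
    obtain w0 where w0: "w0 < n" "k w0 \<noteq> k' w0"
      using kk(1,2,3) by (metis PiE_ext lessThan_iff)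
    have "d w0 \<noteq> \<zero>\<^bsub>?P\<^esub>" using dk[OF w0(1)] w0 Ac kA by auto
    then show ?thesis using that w0 by (simp add: univ_poly_zero)
  qed
  \<comment> \<open>Additivity of \<open>T\<close>: as \<open>l\<close> is a power of
    \<open>p\<close>, taking \<open>l\<close>-th powers is additive on polynomials.\<close>
  have "T d \<oplus>\<^bsub>?P\<^esub> T k' = (\<Oplus>\<^bsub>?P\<^esub>w\<in>{..<n}. d w [^]\<^bsub>?P\<^esub> l \<otimes>\<^bsub>?P\<^esub> c w \<oplus>\<^bsub>?P\<^esub> k' w [^]\<^bsub>?P\<^esub> l \<otimes>\<^bsub>?P\<^esub> c w)"
    unfolding T_def using dc Ac kA cc by (intro P.finsum_addf[symmetric]) auto
  also have "\<dots> = T k" unfolding T_def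
  proof (rule P.finsum_cong')
    fix w assume "w \<in> {..<n}"
    then have w: "w < n" by simp
    have "d w [^]\<^bsub>?P\<^esub> l \<oplus>\<^bsub>?P\<^esub> k' w [^]\<^bsub>?P\<^esub> l = k w [^]\<^bsub>?P\<^esub> l"
      using P.frobenius_pow_add[OF p(1) charP dc[OF w] Ac[OF kA(2)[OF w]], of e] dk[OF w]
      unfolding l(1) by simp
    then show "d w [^]\<^bsub>?P\<^esub> l \<otimes>\<^bsub>?P\<^esub> c w \<oplus>\<^bsub>?P\<^esub> k' w [^]\<^bsub>?P\<^esub> l \<otimes>\<^bsub>?P\<^esub> c w = k w [^]\<^bsub>?P\<^esub> l \<otimes>\<^bsub>?P\<^esub> c w"
      using dc[OF w] Ac[OF kA(2)[OF w]] cc by (metis P.l_distr P.nat_pow_closed)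
  qed (use Ac kA cc in auto)
  finally have "T d \<oplus>\<^bsub>?P\<^esub> T k' = T k'" using kk(4) by simp
  moreover have "T d \<in> carrier ?P" "T k' \<in> carrier ?P"
    unfolding T_def using dc Ac kA cc by (auto intro!: P.finsum_closed)
  ultimately have Td: "T d = \<zero>\<^bsub>?P\<^esub>" by simp
  \<comment> \<open>Since \<open>l = r * h + 1\<close>, the exponent \<open>h * i + l * j\<close> of
    \<open>X\<close> in \<open>H ^ (h * i) * X ^ (l * j)\<close> equals \<open>h * w + j\<close>. It
    grows by at least \<open>h\<close> from each \<open>w\<close> to the next, as the comparison of
    orders requires.\<close>
  define os where "os w = h * w + w div r" for w
  define vs where "vs w = h * (w mod r)" for w
  let ?t = "\<lambda>w. d w \<otimes>\<^bsub>?P\<^esub> X [^]\<^bsub>?P\<^esub> os w \<otimes>\<^bsub>?P\<^esub> V [^]\<^bsub>?P\<^esub> vs w"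
  define F where "F = (\<Oplus>\<^bsub>?P\<^esub>w\<in>{..<n}. ?t w)"
  have tc: "?t w \<in> carrier ?P" if "w < n" for w using dc[OF that] var V by simp
  have Fc: "F \<in> carrier ?P" unfolding F_def using tc by (intro P.finsum_closed) auto
  have os_eq: "os w = h * (w mod r) + l * (w div r)" for w
  proof -
    have "h * w = h * (r * (w div r)) + h * (w mod r)"
      by (metis distrib_left mult_div_mod_eq)
    then show ?thesis unfolding os_def l(2) by (simp add: distrib_right mult_ac)
  qed
  have Fne: "F \<noteq> []"
  proof
    assume "F = []"
    have "d w0 = []"
    proof (rule X_adic_independent[OF K(1) V dc dd _ _ w0(1)])
      fix w w' :: nat assume "w < w'"
      then have "h * (w + 1) \<le> h * w'" "w div r \<le> w' div r"
        by (simp_all add: div_le_mono del: mult_Suc_right)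
      then show "os w + h \<le> os w'" unfolding os_def by simp
    qed (use \<open>F = []\<close> in \<open>simp_all add: F_def\<close>)
    then show False using w0 by simp
  qed
  \<comment> \<open>The nonzero values of \<open>H ^ (h * (l + 1))\<close> on \<open>K\<close> are
    \<open>r\<close>-th roots of unity, so an average fibre would have about
    \<open>l ^ 2 / r\<close>, that is about \<open>l * h\<close>, points. The bound exceeds this
    only by a multiple of \<open>l\<close> that depends on \<open>D\<close>.\<close>
  have degF: "degree F \<le> l * (h + 2 * D + 3)"
    unfolding F_def
  proof (rule degree_finsum_le[OF K_subring])
    fix w assume "w \<in> {..<n}"
    then have w: "w < n" by simp
    have "degree (?t w) \<le> h + os w * 1 + vs w * (D - 1)"
      using dc[OF w] dd[OF w] var V degX D by (intro degree_mult_le[OF K_subring] deg_pow) auto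
    also have "\<dots> = h + l * (w div r) + vs w * D"
      unfolding os_eq vs_def D by (simp add: algebra_simps)
    also have "\<dots> \<le> l + l * (h + D + 2) + l * D"
    proof -
      have "w div r < J" using w unfolding n_def by (simp add: less_mult_imp_div_less mult.commute)
      then have "l * (w div r) \<le> l * (h + D + 2)" unfolding J_def by (intro mult_le_mono2) simp
      moreover have "vs w \<le> l"
      proof -
        have "h * (w mod r) \<le> h * r" using r by (intro mult_le_mono2) simp
        then show ?thesis unfolding vs_def l(2) mult.commute[of r h] by linarith
      qed
      moreover have "h \<le> l" unfolding l(2) using r by (simp add: le_SucI)
      ultimately show ?thesis by (intro add_mono mult_le_mono1) auto
    qed
    also have "\<dots> = l * (h + 2 * D + 3)" by (simp add: algebra_simps)
    finally show "degree (?t w) \<le> l * (h + 2 * D + 3)" .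
  qed (use tc in auto)
  have zero: "eval F x = \<zero>" if x: "x \<in> K" "eval H x [^] (h * (l + 1)) = z" for x
  proof -
    have xc: "x \<in> carrier R" using x K_carrier by auto
    interpret ev: ring_hom_ring ?P R "\<lambda>f. eval f x" using eval_ring_hom[OF K_subring xc] .
    interpret ev': ring_hom_cring ?P R "\<lambda>f. eval f x" using eval_cring_hom[OF K_subring xc] .
    define y where "y = eval H x"
    define v where "v = eval V x"
    have yc: "y \<in> carrier R" "v \<in> carrier R" unfolding y_def v_def using Hc V by auto
    have y: "y = x \<otimes> v" unfolding y_def v_def H_def using var V by (simp add: eval_var[OF xc])
    have y0: "y \<noteq> \<zero>" using x(2) z(2) h nat_pow_zero unfolding y_def by auto
    have evt: "eval (?t w) x = eval (d w) x \<otimes> x [^] os w \<otimes> v [^] vs w" if "w < n" for w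
      unfolding v_def using dc[OF that] var V by (simp add: ev.hom_nat_pow eval_var[OF xc])
    have tm: "y [^] (r * h) \<otimes> (eval (?t w) x) [^] l = eval (d w [^]\<^bsub>?P\<^esub> l \<otimes>\<^bsub>?P\<^esub> c w) x"
      if w: "w < n" for w
    proof -
      define i where "i = w mod r"
      define j where "j = w div r"
      have ir: "i < r" unfolding i_def using r by simp
      have a: "eval (d w) x \<in> carrier R" using dc[OF w] by simp
      have e1: "eval (?t w) x = eval (d w) x \<otimes> y [^] (h * i) \<otimes> x [^] (l * j)"
        unfolding evt[OF w] unfolding os_eq vs_def y i_def[symmetric] j_def[symmetric]
        using xc yc a by (simp add: nat_pow_mult[symmetric] nat_pow_distrib m_ac)
      have xl: "(x [^] (l * j)) [^] l = x [^] j"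
      proof -
        have "(x [^] (l * j)) [^] l = (x [^] card K) [^] j"
          unfolding K(2) using xc by (simp add: nat_pow_pow power2_eq_square mult_ac)
        then show ?thesis using subfield_pow_card[OF K(1) fin x(1)] by simp
      qed
      have "(eval (?t w) x) [^] l = eval (d w) x [^] l \<otimes> y [^] (h * i * l) \<otimes> x [^] j"
        unfolding e1 using xc yc a xl by (simp add: nat_pow_distrib nat_pow_pow)
      then have "y [^] (r * h) \<otimes> (eval (?t w) x) [^] l = eval (d w) x [^] l \<otimes> (y [^] (h * i * l) \<otimes> y [^] (r * h)) \<otimes> x [^] j"
        using xc yc a by (simp add: m_ac)
      also have "y [^] (h * i * l) \<otimes> y [^] (r * h) = y [^] (h * (l + 1) * i + (r - i) * h)"
      proof -
        obtain m where "r = i + m" using ir le_Suc_ex[of i r] by auto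
        then have "h * i * l + r * h = h * (l + 1) * i + (r - i) * h" by (simp add: algebra_simps)
        then show ?thesis using yc by (simp only: nat_pow_mult)
      qed
      also have "\<dots> = (y [^] (h * (l + 1))) [^] i \<otimes> y [^] ((r - i) * h)"
        using yc by (simp only: nat_pow_mult[symmetric] nat_pow_pow nat_pow_closed)
      also have "y [^] (h * (l + 1)) = z" using x(2) unfolding y_def .
      also have "eval (d w) x [^] l \<otimes> (z [^] i \<otimes> y [^] ((r - i) * h)) \<otimes> x [^] j
          = eval (d w [^]\<^bsub>?P\<^esub> l \<otimes>\<^bsub>?P\<^esub> c w) x"
        unfolding c_def i_def[symmetric] j_def[symmetric] y_def
        using dc[OF w] zc[of i] Hc var xc yc K_carrier[OF z(1)] unfolding y_def
        by (simp add: ev.hom_nat_pow eval_var[OF xc] m_assoc)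
      finally show ?thesis .
    qed
    have "y [^] (r * h) \<otimes> (eval F x) [^] l = y [^] (r * h) \<otimes> (\<Oplus>w\<in>{..<n}. (eval (?t w) x) [^] l)"
    proof -
      have "eval F x = (\<Oplus>w\<in>{..<n}. eval (?t w) x)"
        unfolding F_def using tc by (subst ev'.hom_finsum) (auto simp: o_def)
      then show ?thesis unfolding l(1)
        using frobenius_pow_finsum[OF p, of "\<lambda>w. eval (?t w) x" "{..<n}" e] tc by auto
    qed
    also have "\<dots> = (\<Oplus>w\<in>{..<n}. y [^] (r * h) \<otimes> (eval (?t w) x) [^] l)"
      using tc yc by (intro finsum_rdistr) auto
    also have "\<dots> = (\<Oplus>w\<in>{..<n}. eval (d w [^]\<^bsub>?P\<^esub> l \<otimes>\<^bsub>?P\<^esub> c w) x)"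
      using tm dc cc by (intro finsum_cong') auto
    also have "\<dots> = eval (T d) x"
      unfolding T_def using dc cc by (subst ev'.hom_finsum) (auto simp: o_def)
    finally have "y [^] (r * h) \<otimes> (eval F x) [^] l = \<zero>" using Td by simp
    then have "(eval F x) [^] l = \<zero>"
      using nat_pow_nonzero[OF yc(1) y0, of "r * h"] integral_iff yc Fc by auto
    then show ?thesis using nat_pow_nonzero[of "eval F x" l] Fc by auto
  qed
  have "card {x \<in> K. eval H x [^] (h * (l + 1)) = z} \<le> degree F"
    using zero K_carrier by (intro card_zeros_le_degree(2)[OF carrier_polynomial_shell[OF K_subring Fc] Fne]) auto
  then show ?thesis using degF unfolding H_def by linarith
qed

section \<open>Conjugates over a finite field\<close>

text \<open>\<open>card K\<close> annihilates 1 by Lagrange's theorem in the additive group, and in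
  a domain a power of \<open>p\<close> can do so only if \<open>p\<close> does.\<close>

lemma (in domain) subfield_char:
  assumes K: "subfield K R" "card K = p ^ k" and p: "Factorial_Ring.prime p"
  shows "[p] \<cdot> \<one> = \<zero>"
proof (rule ccontr)
  assume nz: "[p] \<cdot> \<one> \<noteq> \<zero>"
  have "[(p ^ j)] \<cdot> \<one> \<noteq> \<zero>" for j
  proof (induction j)
    case (Suc j)
    have "[(p ^ Suc j)] \<cdot> \<one> = [p] \<cdot> ([(p ^ j)] \<cdot> \<one>)"
      using add.nat_pow_pow[of \<one> p "p ^ j"] by (simp add: mult.commute)
    also have "\<dots> = ([p] \<cdot> \<one>) \<otimes> ([(p ^ j)] \<cdot> \<one>)"
      by (simp add: add_pow_ldistr)
    finally show ?case using Suc nz integral by fastforce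
  qed simp
  moreover have "[(card K)] \<cdot> \<one> = \<zero>"
  proof -
    interpret S: domain "R \<lparr> carrier := K \<rparr>" using subring_is_domain[OF subfieldE(1)[OF K(1)]] .
    have "finite K" using K(2) p by (metis card.infinite power_not_zero not_prime_0)
    moreover have "\<one> \<in> K" using subringE(3)[OF subfieldE(1)[OF K(1)]] .
    ultimately have "[(order (add_monoid (R \<lparr> carrier := K \<rparr>)))] \<cdot>\<^bsub>R \<lparr> carrier := K \<rparr>\<^esub> \<one> = \<zero>"
      using S.add.pow_order_eq_1[of \<one>] by simp
    then show ?thesis by (simp add: order_def add_pow_def nat_pow_def)
  qed
  ultimately show False unfolding K(2) by blast
qed

lemma (in field) frobenius_fixed_subfield:
  assumes p: "Factorial_Ring.prime p" "[(p::nat)] \<cdot> \<one> = \<zero>"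
  shows "subfield {x \<in> carrier R. x [^] (p ^ m) = x} R"
proof (rule subfieldI')
  have pm: "p ^ m > 0" using prime_gt_0_nat[OF p(1)] by simp
  show "subring {x \<in> carrier R. x [^] (p ^ m) = x} R"
  proof (rule subringI)
    fix h assume h: "h \<in> {x \<in> carrier R. x [^] (p ^ m) = x}"
    then have "\<zero> \<ominus> h = \<ominus> h" by (simp add: a_minus_def)
    then show "\<ominus> h \<in> {x \<in> carrier R. x [^] (p ^ m) = x}"
      using frobenius_pow_minus[OF p, of \<zero> h m] h pm by (simp add: nat_pow_zero)
  qed (use frobenius_pow_add[OF p] in \<open>auto simp: nat_pow_distrib\<close>)
  fix k assume k: "k \<in> {x \<in> carrier R. x [^] (p ^ m) = x} - {\<zero>}"
  then have kU: "k \<in> Units R" "k \<in> carrier R" "k [^] (p ^ m) = k" using field_Units by auto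
  have "(inv k) [^] (p ^ m) \<otimes> k = (inv k \<otimes> k) [^] (p ^ m)"
    using kU by (simp only: nat_pow_distrib Units_inv_closed)
  also have "\<dots> = \<one>" using kU by simp
  finally have "(inv k) [^] (p ^ m) = inv k"
    using kU by (metis Units_inv_closed comm_inv_char m_comm nat_pow_closed)
  then show "inv k \<in> {x \<in> carrier R. x [^] (p ^ m) = x}" using kU by simp
qed

lemma (in domain) eval_frobenius:
  assumes p: "Factorial_Ring.prime p" "[(p::nat)] \<cdot> \<one> = \<zero>"
    and f: "set f \<subseteq> carrier R" "\<And>c. c \<in> set f \<Longrightarrow> c [^] (p ^ k) = c" and x: "x \<in> carrier R"
  shows "eval f (x [^] (p ^ k)) = (eval f x) [^] (p ^ k)"
  using f
proof (induction f)
  case Nil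
  then show ?case using prime_gt_0_nat[OF p(1)] by (simp add: nat_pow_zero)
next
  case (Cons c f)
  have c: "c \<in> carrier R" "c [^] (p ^ k) = c" "eval f x \<in> carrier R"
    using Cons eval_in_carrier[of f x] x by auto
  have "(x [^] (p ^ k)) [^] length f = (x [^] length f) [^] (p ^ k)"
    using x by (simp add: nat_pow_pow mult.commute)
  then have "eval (c # f) (x [^] (p ^ k)) = (c \<otimes> x [^] length f) [^] (p ^ k) \<oplus> (eval f x) [^] (p ^ k)"
    using Cons c x by (simp add: nat_pow_distrib)
  also have "\<dots> = (c \<otimes> x [^] length f \<oplus> eval f x) [^] (p ^ k)"
    using c x by (intro frobenius_pow_add[OF p, symmetric]) auto
  finally show ?case by simp
qed

lemma (in field) eval_monic_distinct_roots:
  assumes "P \<in> carrier (poly_ring R)" "P \<noteq> []" "lead_coeff P = \<one>" "finite S" "card S = degree P"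
    and "S \<subseteq> carrier R" "\<And>s. s \<in> S \<Longrightarrow> eval P s = \<zero>" and a: "a \<in> carrier R"
  shows "eval P a = (\<Otimes>s\<in>S. a \<ominus> s)"
  using assms(4,1,2,3,5,6,7)
proof (induction S arbitrary: P rule: finite_induct)
  case empty
  then have "P = [\<one>]" by (cases P) auto
  then show ?case by simp
next
  case (insert s S)
  interpret UP: domain "poly_ring R" using univ_poly_is_domain[OF carrier_is_subring] .
  have s: "s \<in> carrier R" using insert by auto
  have lin: "[\<one>, \<ominus> s] \<in> carrier (poly_ring R)"
    using s by (simp add: univ_poly_carrier[symmetric] polynomial_def)
  have "is_root P s" using insert s by (simp add: is_root_def)
  then obtain Q where Q: "Q \<in> carrier (poly_ring R)" "P = [\<one>, \<ominus> s] \<otimes>\<^bsub>poly_ring R\<^esub> Q"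
    using is_root_imp_pdivides[OF insert.prems(1)] unfolding pdivides_def by blast
  have Qne: "Q \<noteq> []" using Q insert.prems(2) lin UP.r_null by (auto simp: univ_poly_zero)
  have deg: "degree P = Suc (degree Q)"
    using poly_mult_degree_eq[OF carrier_is_subring, of "[\<one>, \<ominus> s]" Q] lin Q Qne
    unfolding univ_poly_carrier by (simp add: univ_poly_mult)
  have lc: "lead_coeff Q = \<one>"
  proof -
    have "lead_coeff P = lead_coeff [\<one>, \<ominus> s] \<otimes> lead_coeff Q"
      unfolding Q(2) univ_poly_mult
      using poly_mult_lead_coeff[OF carrier_is_subring, of "[\<one>, \<ominus> s]" Q] lin Q(1) Qne
      unfolding univ_poly_carrier by simp
    moreover have "lead_coeff Q \<in> carrier R"
      using Q(1) Qne by (cases Q) (auto simp: univ_poly_carrier[symmetric] polynomial_def)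
    ultimately show ?thesis using insert.prems(3) by simp
  qed
  have evP: "eval P x = (x \<ominus> s) \<otimes> eval Q x" if "x \<in> carrier R" for x
  proof -
    have "eval [\<one>, \<ominus> s] x = x \<ominus> s" using that s by (simp add: a_minus_def)
    then show ?thesis unfolding Q(2) univ_poly_mult
      using eval_poly_mult[OF polynomial_in_carrier polynomial_in_carrier that] lin Q(1) carrier_is_subring
      unfolding univ_poly_carrier[symmetric] by metis
  qed
  have roots: "eval Q x = \<zero>" if "x \<in> S" for x
  proof -
    have x: "x \<in> carrier R" "x \<noteq> s" "eval P x = \<zero>" using insert that by auto
    then show ?thesis using evP[OF x(1)] s eval_poly_in_carrier[OF carrier_is_subring _ x(1), of Q] Q(1) univ_poly_carrier
      by (metis integral minus_closed r_right_minus_eq)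
  qed
  have "eval Q a = (\<Otimes>s\<in>S. a \<ominus> s)"
    using insert Q Qne lc deg roots by (intro insert.IH) auto
  then show ?case
    using evP[OF a] a s insert.prems(5) insert.hyps by (subst finprod_insert) auto
qed

lemma (in domain) pow_minus_var:
  assumes K: "subring K R" and n: "(n::nat) \<ge> 2"
  defines "f \<equiv> X [^]\<^bsub>K[X]\<^esub> n \<ominus>\<^bsub>K[X]\<^esub> X"
  shows "f \<in> carrier (K[X])" "degree f = n" "f \<noteq> []"
    "x \<in> carrier R \<Longrightarrow> eval f x = x [^] n \<ominus> x"
proof -
  interpret UP: domain "K[X]" using univ_poly_is_domain[OF K] .
  note var = var_closed(1)[OF K]
  have dX: "degree X = 1" by (simp add: var_def)
  let ?a = "X [^]\<^bsub>K[X]\<^esub> n" and ?b = "\<ominus>\<^bsub>K[X]\<^esub> X"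
  have da: "degree ?a = n"
    using subring_polynomial_pow_degree[OF K var] dX by simp
  have db: "degree ?b = 1"
    using univ_poly_a_inv_degree[OF K var] dX by simp
  have c: "polynomial K ?a" "polynomial K ?b"
    using var unfolding univ_poly_carrier by auto
  have "degree (poly_add ?a ?b) = max n 1"
    unfolding poly_add_degree_eq[OF K c, unfolded da db, OF less_imp_neq[symmetric], OF n[unfolded numeral_2_eq_2 Suc_le_eq, folded One_nat_def]] ..
  then show deg: "degree f = n"
    unfolding f_def a_minus_def univ_poly_add using n by simp
  show "f \<in> carrier (K[X])" using var unfolding f_def by simp
  show "f \<noteq> []" using deg n by auto
  assume x: "x \<in> carrier R"
  interpret ev: ring_hom_ring "K[X]" R "\<lambda>p. eval p x" using eval_ring_hom[OF K x] .
  interpret ev': ring_hom_cring "K[X]" R "\<lambda>p. eval p x" using eval_cring_hom[OF K x] .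
  show "eval f x = x [^] n \<ominus> x"
    unfolding f_def using var x by (simp add: a_minus_def ev.hom_nat_pow eval_var)
qed

lemma (in domain) Irr_unique:
  assumes "subfield K R" "x \<in> carrier R"
    and "P \<in> carrier (K[X])" "pirreducible K P" "eval P x = \<zero>" "lead_coeff P = \<one>"
  shows "Irr K x = P"
proof -
  have "(algebraic over K) x"
    using algebraicI[OF assms(3) _ assms(5)] pirreducibleE(1)[OF subfieldE(1)[OF assms(1)] assms(3,4)] by simp
  then show ?thesis
    using minimal_polynomial_is_unique[OF assms(1,2)] IrrE[OF assms(1,2)] assms by blast
qed

lemma (in domain) finprod_nonzero:
  "finite I \<Longrightarrow> (\<And>i. i \<in> I \<Longrightarrow> f i \<in> carrier R \<and> f i \<noteq> \<zero>) \<Longrightarrow> (\<Otimes>i\<in>I. f i) \<noteq> \<zero>"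
proof (induction I rule: finite_induct)
  case (insert i I)
  then have "(\<Otimes>i\<in>I. f i) \<in> carrier R" "(\<Otimes>i\<in>I. f i) \<noteq> \<zero>" by (auto intro!: finprod_closed)
  then show ?case using insert by (subst finprod_insert) (auto simp: integral_iff)
qed simp

text \<open>The ambient field may be infinite: the locale serves both the given finite field and an
  algebraic closure of it. The prime \<open>p\<close> is a parameter because additivity of the
  \<open>q\<close>-power map rests on it.\<close>

locale finite_base = field R for R (structure) +
  fixes K :: "'a set" and p k q :: nat
  assumes K: "subfield K R" and p: "Factorial_Ring.prime p" and kpos: "k > 0" and q: "q = p ^ k"
    and card_K: "card K = q"
begin

lemma K_subring: "subring K R" using subfieldE(1)[OF K] .

lemma K_carrier: "x \<in> K \<Longrightarrow> x \<in> carrier R" using subfieldE(3)[OF K] by auto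

lemma add_pow_p_one: "[p] \<cdot> \<one> = \<zero>"
  using subfield_char[OF K _ p] card_K q by simp

lemma q_ge2: "q \<ge> 2"
  unfolding q using prime_ge_2_nat[OF p] kpos
  by (metis One_nat_def Suc_leI le_trans self_le_power less_eq_nat.simps(1) numeral_2_eq_2 zero_less_Suc prime_gt_0_nat[OF p])

lemma finite_K: "finite K" using q_ge2 card_K card.infinite by fastforce

lemma q_pow_eq: "q ^ i = p ^ (k * i)" unfolding q by (simp add: power_mult)

lemma frob_add: "x \<in> carrier R \<Longrightarrow> y \<in> carrier R \<Longrightarrow> (x \<oplus> y) [^] (q ^ i) = x [^] (q ^ i) \<oplus> y [^] (q ^ i)"
  unfolding q_pow_eq by (rule frobenius_pow_add[OF p add_pow_p_one])

lemma frob_minus: "x \<in> carrier R \<Longrightarrow> y \<in> carrier R \<Longrightarrow> (x \<ominus> y) [^] (q ^ i) = x [^] (q ^ i) \<ominus> y [^] (q ^ i)"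
  unfolding q_pow_eq by (rule frobenius_pow_minus[OF p add_pow_p_one])

lemma frob_frob: "x \<in> carrier R \<Longrightarrow> (x [^] (q ^ i)) [^] (q ^ j) = x [^] (q ^ (i + j))"
  by (simp add: nat_pow_pow power_add)

lemma fixed_subfield: "subfield {x \<in> carrier R. x [^] (q ^ m) = x} R"
  unfolding q_pow_eq by (rule frobenius_fixed_subfield[OF p add_pow_p_one])

lemma frob_K: "x \<in> K \<Longrightarrow> x [^] (q ^ i) = x"
proof (induction i)
  case (Suc i)
  have "x [^] (q ^ Suc i) = (x [^] (q ^ i)) [^] q"
    using K_carrier[OF Suc.prems] by (simp add: nat_pow_pow mult.commute)
  then show ?case using Suc subfield_pow_card[OF K finite_K Suc.prems] card_K by metis
qed (use K_carrier in simp)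

lemma eval_frob:
  assumes "f \<in> carrier (K[X])" "x \<in> carrier R"
  shows "eval f (x [^] (q ^ i)) = (eval f x) [^] (q ^ i)"
proof -
  have "set f \<subseteq> K" using assms(1) polynomial_incl univ_poly_carrier by blast
  then show ?thesis
    using eval_frobenius[OF p add_pow_p_one, of f "k * i" x] frob_K[of _ i] K_carrier assms(2) unfolding q_pow_eq by blast
qed

section \<open>The Frobenius orbit of a single algebraic element\<close>

context
  fixes y e
  assumes y: "y \<in> carrier R" "(algebraic over K) y" and e: "e = degree (Irr K y)"
begin

lemma card_simple_extension: "card (simple_extension K y) = q ^ e" "finite (simple_extension K y)"
  using card_dimension[OF K finite_K dimension_simple_extension[OF K y]] card_K unfolding e by auto

lemma degree_Irr_pos: "e > 0"
  unfolding e using pirreducible_degree[OF K IrrE(1,2)[OF K y]] by simp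

lemma frob_degree: "y [^] (q ^ e) = y"
proof -
  have "subfield (simple_extension K y) R"
    using simple_extension_is_subfield[OF K y(1)] y(2) by simp
  then show ?thesis
    using subfield_pow_card card_simple_extension simple_extension_mem[OF K_subring y(1)] by metis
qed

text \<open>\<open>K(y)\<close> has \<open>q ^ e\<close> elements and lies in the fixed field of the
  \<open>m\<close>-th Frobenius power, whose elements are roots of a polynomial of degree
  \<open>q ^ m\<close>.\<close>

lemma frob_fixed_degree_le:
  assumes "m > 0" "y [^] (q ^ m) = y"
  shows "e \<le> m"
proof -
  let ?F = "{x \<in> carrier R. x [^] (q ^ m) = x}"
  have sub: "simple_extension K y \<subseteq> ?F"
    using simple_extension_subring_incl[OF subfieldE(1)[OF fixed_subfield], of K m y] frob_K K_carrier y assms by auto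
  have qm: "q ^ m \<ge> 2" using q_ge2 self_le_power[of q m] assms(1) by linarith
  have "finite ?F" "card ?F \<le> q ^ m"
    using card_zeros_le_degree[OF pow_minus_var(1,3)[OF carrier_is_subring qm], of ?F] pow_minus_var(2,4)[OF carrier_is_subring qm] by auto
  then have "q ^ e \<le> q ^ m"
    using card_mono[OF _ sub] card_simple_extension by simp
  then show ?thesis using q_ge2 by simp
qed

lemma frob_fixed_iff: "y [^] (q ^ m) = y \<longleftrightarrow> e dvd m"
proof
  have *: "y [^] (q ^ (e * a)) = y" for a
  proof (induction a)
    case (Suc a)
    then show ?case using frob_frob[OF y(1), of e "e * a"] frob_degree by simp
  qed (use y in simp)
  show "y [^] (q ^ m) = y" if "e dvd m" using * that by auto
  assume m: "y [^] (q ^ m) = y"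
  have "y [^] (q ^ (m mod e)) = y"
    using frob_frob[OF y(1), of "e * (m div e)" "m mod e"] * m by simp
  then have "m mod e = 0"
    using frob_fixed_degree_le[of "m mod e"] degree_Irr_pos by (metis mod_less_divisor not_le gr0I)
  then show "e dvd m" by auto
qed

text \<open>Two equal conjugates, carried on to the exponent \<open>e\<close>, would give
  \<open>y\<close> a period below \<open>e\<close>.\<close>

lemma conjugates_inj: "inj_on (\<lambda>i. y [^] (q ^ i)) {..<e}"
proof -
  have "False" if "i < j" "j < e" "y [^] (q ^ i) = y [^] (q ^ j)" for i j
  proof -
    have "y [^] (q ^ (i + (e - j))) = y"
      using that frob_frob[OF y(1), of i "e - j"] frob_frob[OF y(1), of j "e - j"] frob_degree by simp
    then show False using frob_fixed_degree_le[of "i + (e - j)"] that by simp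
  qed
  then show ?thesis unfolding inj_on_def by (metis lessThan_iff linorder_neqE_nat)
qed

text \<open>The conjugates are \<open>e\<close> distinct roots of a monic polynomial of degree
  \<open>e\<close>, so they exhaust its linear factors.\<close>

lemma eval_Irr:
  assumes a: "a \<in> carrier R"
  shows "eval (Irr K y) a = (\<Otimes>i\<in>{..<e}. a \<ominus> y [^] (q ^ i))"
proof -
  note I = IrrE[OF K y]
  have ne: "Irr K y \<noteq> []" using pirreducibleE(1)[OF K_subring I(1,2)] .
  have "eval (Irr K y) a = (\<Otimes>s\<in>(\<lambda>i. y [^] (q ^ i)) ` {..<e}. a \<ominus> s)"
  proof (rule eval_monic_distinct_roots[OF carrier_polynomial_shell[OF K_subring I(1)] ne I(3)])
    show "card ((\<lambda>i. y [^] (q ^ i)) ` {..<e}) = degree (Irr K y)"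
      using card_image[OF conjugates_inj] e by simp
    show "eval (Irr K y) s = \<zero>" if "s \<in> (\<lambda>i. y [^] (q ^ i)) ` {..<e}" for s
      using that eval_frob[OF I(1) y(1)] I(4) q_ge2 by (auto simp: nat_pow_zero)
  qed (use y a in auto)
  also have "\<dots> = (\<Otimes>i\<in>{..<e}. a \<ominus> y [^] (q ^ i))"
    using a y by (subst finprod_reindex[OF _ conjugates_inj]) auto
  finally show ?thesis .
qed

lemma Irr_roots: "{x \<in> carrier R. eval (Irr K y) x = \<zero>} = (\<lambda>i. y [^] (q ^ i)) ` {..<e}"
proof (intro subset_antisym subsetI)
  note I = IrrE[OF K y]
  fix x assume "x \<in> (\<lambda>i. y [^] (q ^ i)) ` {..<e}"
  then show "x \<in> {x \<in> carrier R. eval (Irr K y) x = \<zero>}"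
    using eval_frob[OF I(1) y(1)] I(4) q_ge2 y by (auto simp: nat_pow_zero)
next
  fix x assume "x \<in> {x \<in> carrier R. eval (Irr K y) x = \<zero>}"
  then have x: "x \<in> carrier R" "(\<Otimes>i\<in>{..<e}. x \<ominus> y [^] (q ^ i)) = \<zero>"
    using eval_Irr by auto
  show "x \<in> (\<lambda>i. y [^] (q ^ i)) ` {..<e}"
  proof (rule ccontr)
    assume n: "x \<notin> (\<lambda>i. y [^] (q ^ i)) ` {..<e}"
    have "(\<Otimes>i\<in>I. x \<ominus> y [^] (q ^ i)) \<noteq> \<zero>" if "finite I" "I \<subseteq> {..<e}" for I
      using that
    proof (induction I rule: finite_induct)
      case (insert i I)
      have "x \<ominus> y [^] (q ^ i) \<noteq> \<zero>" using n insert x y by auto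
      then show ?case using insert x y
        by (subst finprod_insert) (auto simp: integral_iff)
    qed simp
    then show False using x by blast
  qed
qed

end

end

section \<open>Prime powers dividing a monic polynomial\<close>

text \<open>For \<open>N = 1\<close> this is a periodic product; for the Frobenius power \<open>N = q ^ d\<close> it is a norm.\<close>

lemma (in comm_monoid) finprod_twisted_blocks:
  fixes N d b :: nat
  assumes u: "\<And>i. u i \<in> carrier G" "\<And>i. u (i + d) = u i [^] N"
  shows "(\<Otimes>i\<in>{..<d * b}. u i) = (\<Otimes>i\<in>{..<d}. u i) [^] (\<Sum>t<b. N ^ t)"
proof -
  let ?U = "\<Otimes>i\<in>{..<d}. u i"
  have U: "?U \<in> carrier G" using u(1) by (intro finprod_closed) auto
  have it: "u (i + d * t) = u i [^] (N ^ t)" for i t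
  proof (induction t)
    case (Suc t)
    have "u (i + d * Suc t) = u ((i + d * t) + d)" by (simp add: ac_simps)
    also have "\<dots> = (u i [^] (N ^ t)) [^] N" using u(2) Suc by simp
    finally show ?case using u(1) by (simp add: nat_pow_pow mult.commute)
  qed (use u(1) in simp)
  have pw: "(\<Otimes>i\<in>A. u i [^] m) = (\<Otimes>i\<in>A. u i) [^] m" for A and m :: nat
  proof (induction A rule: infinite_finite_induct)
    case (insert x F)
    then show ?case using u(1)
      by (simp add: nat_pow_distrib)
  qed simp_all
  show ?thesis
  proof (induction b)
    case (Suc b)
    have "{..<d * Suc b} = {..<d * b} \<union> (\<lambda>i. i + d * b) ` {..<d}"
    proof (intro subset_antisym subsetI)
      fix x assume x: "x \<in> {..<d * Suc b}"
      show "x \<in> {..<d * b} \<union> (\<lambda>i. i + d * b) ` {..<d}"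
      proof (cases "x < d * b")
        case False
        then have "x = (x - d * b) + d * b" "x - d * b < d" using x by auto
        then show ?thesis by blast
      qed simp
    qed auto
    then have "(\<Otimes>i\<in>{..<d * Suc b}. u i) = (\<Otimes>i\<in>{..<d * b} \<union> (\<lambda>i. i + d * b) ` {..<d}. u i)"
      by simp
    also have "\<dots> = (\<Otimes>i\<in>{..<d * b}. u i) \<otimes> (\<Otimes>i\<in>(\<lambda>i. i + d * b) ` {..<d}. u i)"
      using u(1) by (intro finprod_Un_disjoint) auto
    also have "(\<Otimes>i\<in>(\<lambda>i. i + d * b) ` {..<d}. u i) = (\<Otimes>i\<in>{..<d}. u (i + d * b))"
      using u(1) by (intro finprod_reindex) (auto simp: inj_on_def)
    also have "\<dots> = ?U [^] (N ^ b)" unfolding it pw ..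
    finally show ?case using Suc U by (simp add: nat_pow_mult)
  qed simp
qed

lemma (in cring) minus_minus_cancel:
  "a \<in> carrier R \<Longrightarrow> b \<in> carrier R \<Longrightarrow> c \<in> carrier R \<Longrightarrow> (a \<ominus> c) \<ominus> (b \<ominus> c) = a \<ominus> b"
  by algebra

locale closed_finite_base = finite_base + algebraically_closed R
begin

lemma root_exists:
  assumes "f \<in> carrier (poly_ring R)" "degree f > 0"
  shows "\<exists>x\<in>carrier R. eval f x = \<zero>"
proof -
  have "size (roots f) > 0" using roots_over_carrier[OF assms(1)] assms(2) by (simp add: splitted_def)
  then obtain x where "x \<in># roots f" by (metis multiset_nonemptyE nonempty_has_size)
  then show ?thesis using roots_mem_iff_is_root[OF assms(1)] by (auto simp: is_root_def)
qed

text \<open>All roots of \<open>X ^ N - X\<close> are simple. With \<open>L = X - x\<close> for a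
  root \<open>x\<close>, Frobenius turns the polynomial into \<open>L ^ N - L\<close>, and the
  cofactor \<open>L ^ (N - 1) - 1\<close> has the value -1 at \<open>x\<close>.\<close>

lemma card_fixed:
  assumes m: "m > 0"
  shows "finite {x \<in> carrier R. x [^] (q ^ m) = x}" "card {x \<in> carrier R. x [^] (q ^ m) = x} = q ^ m"
proof -
  let ?P = "poly_ring R"
  interpret UP: domain ?P using univ_poly_is_domain[OF carrier_is_subring] .
  define N where "N = q ^ m"
  have N: "N \<ge> 2" using q_ge2 self_le_power[of q m] m unfolding N_def by linarith
  note var = var_closed(1)[OF carrier_is_subring]
  define f where "f = X [^]\<^bsub>?P\<^esub> N \<ominus>\<^bsub>?P\<^esub> X"
  note f = pow_minus_var[OF carrier_is_subring N, folded f_def]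
  have "alg_mult f x \<le> 1" if x: "x \<in> carrier R" "x [^] N = x" for x
  proof (rule ccontr)
    assume "\<not> alg_mult f x \<le> 1"
    then have "([\<one>, \<ominus> x] [^]\<^bsub>?P\<^esub> (2::nat)) pdivides f"
      using le_alg_mult_imp_pdivides[OF x(1) f(1), of 2] by simp
    then obtain g where g: "g \<in> carrier ?P" "f = [\<one>, \<ominus> x] [^]\<^bsub>?P\<^esub> (2::nat) \<otimes>\<^bsub>?P\<^esub> g"
      unfolding pdivides_def by auto
    interpret C: ring_hom_ring R ?P poly_of_const
      using canonical_embedding_ring_hom[OF carrier_is_subring] by simp
    interpret ev: ring_hom_ring ?P R "\<lambda>p. eval p x" using eval_ring_hom[OF carrier_is_subring x(1)] .
    interpret ev': ring_hom_cring ?P R "\<lambda>p. eval p x" using eval_cring_hom[OF carrier_is_subring x(1)] .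
    define C where "C = poly_of_const x"
    have Cc: "C \<in> carrier ?P" unfolding C_def using x by simp
    define L where "L = X \<ominus>\<^bsub>?P\<^esub> C"
    have Lc: "L \<in> carrier ?P" unfolding L_def using var Cc by simp
    have "L = poly_add X (poly_of_const (\<ominus> x))"
      unfolding L_def C_def a_minus_def univ_poly_add[symmetric, of R "carrier R"] using C.hom_a_inv x by simp
    also have "\<dots> = poly_add X [\<ominus> x]"
      unfolding poly_of_const_def
      by (rule poly_add_normalize(2)[symmetric]) (use x in \<open>auto simp: var_def\<close>)
    also have "\<dots> = [\<one>, \<ominus> x]" using x by (simp add: var_def)
    finally have L: "[\<one>, \<ominus> x] = L" ..
    have "C [^]\<^bsub>?P\<^esub> N = C"
      unfolding C_def using C.hom_nat_pow[OF x(1), of N] x(2) by simp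
    then have LN: "L [^]\<^bsub>?P\<^esub> N = X [^]\<^bsub>?P\<^esub> N \<ominus>\<^bsub>?P\<^esub> C"
      using UP.frobenius_pow_minus[OF p univ_poly_char[OF carrier_is_subring add_pow_p_one] var Cc, of "k * m"]
      unfolding L_def N_def q_pow_eq by simp
    have "f = L [^]\<^bsub>?P\<^esub> N \<ominus>\<^bsub>?P\<^esub> L"
      unfolding LN unfolding L_def f_def
      by (rule UP.minus_minus_cancel[OF UP.nat_pow_closed[OF var, of N] var Cc, symmetric])
    also have "\<dots> = L \<otimes>\<^bsub>?P\<^esub> (L [^]\<^bsub>?P\<^esub> (N - 1) \<ominus>\<^bsub>?P\<^esub> \<one>\<^bsub>?P\<^esub>)"
    proof -
      have "L [^]\<^bsub>?P\<^esub> N = L \<otimes>\<^bsub>?P\<^esub> L [^]\<^bsub>?P\<^esub> (N - 1)"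
        using UP.nat_pow_Suc2[OF Lc, of "N - 1"] N by simp
      then show ?thesis using Lc UP.nat_pow_closed[OF Lc, of "N - 1"]
        by (simp add: a_minus_def UP.r_distr UP.r_minus)
    qed
    finally have "L \<otimes>\<^bsub>?P\<^esub> (L [^]\<^bsub>?P\<^esub> (N - 1) \<ominus>\<^bsub>?P\<^esub> \<one>\<^bsub>?P\<^esub>) = L \<otimes>\<^bsub>?P\<^esub> (L \<otimes>\<^bsub>?P\<^esub> g)"
      using g Lc unfolding L by (simp add: numeral_2_eq_2 UP.m_assoc)
    moreover have "L \<noteq> \<zero>\<^bsub>?P\<^esub>" unfolding L[symmetric] univ_poly_zero by simp
    ultimately have "L [^]\<^bsub>?P\<^esub> (N - 1) \<ominus>\<^bsub>?P\<^esub> \<one>\<^bsub>?P\<^esub> = L \<otimes>\<^bsub>?P\<^esub> g"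
      using UP.m_lcancel Lc g(1) by auto
    then have "eval (L [^]\<^bsub>?P\<^esub> (N - 1) \<ominus>\<^bsub>?P\<^esub> \<one>\<^bsub>?P\<^esub>) x = eval (L \<otimes>\<^bsub>?P\<^esub> g) x" by simp
    moreover have "eval L x = \<zero>" unfolding L[symmetric] using x by (simp add: r_neg)
    ultimately have "\<zero> [^] (N - 1) \<ominus> \<one> = \<zero>"
      using Lc g(1) by (simp add: a_minus_def ev.hom_nat_pow)
    then show False using N by (simp add: nat_pow_zero)
  qed
  then have am: "alg_mult f x \<le> 1" if "x \<in> carrier R" "x [^] N = x" for x using that by blast
  have cnt: "count (roots f) x = 1" if x: "x \<in># roots f" for x
  proof -
    have xr: "x \<in> carrier R" "eval f x = \<zero>"
      using x roots_mem_iff_is_root[OF f(1)] by (auto simp: is_root_def)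
    then have "x [^] N = x" using f(4)[OF xr(1)] by simp
    then have "count (roots f) x \<le> 1"
      using am[OF xr(1)] unfolding alg_mult_eq_count_roots[OF f(1), symmetric] by simp
    moreover have "count (roots f) x > 0" using x by simp
    ultimately show ?thesis by linarith
  qed
  have set: "set_mset (roots f) = {x \<in> carrier R. x [^] (q ^ m) = x}"
    using roots_mem_iff_is_root[OF f(1)] f(3,4) unfolding N_def by (auto simp: is_root_def)
  have "card (set_mset (roots f)) = size (roots f)"
    unfolding size_multiset_overloaded_eq using cnt by simp
  also have "\<dots> = q ^ m" using roots_over_carrier[OF f(1)] f(2) unfolding splitted_def N_def by simp
  finally show "finite {x \<in> carrier R. x [^] (q ^ m) = x}" "card {x \<in> carrier R. x [^] (q ^ m) = x} = q ^ m"
    unfolding set[symmetric] by auto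
qed

text \<open>
  Bounding the length rather than the degree excludes \<open>[]\<close>, which has degree \<open>0\<close> and an unspecified
  leading coefficient.
\<close>

definition Mon :: "nat \<Rightarrow> 'a list set" where
  "Mon n = {g \<in> carrier (K[X]). length g = Suc n \<and> lead_coeff g = \<one>}"

definition MonIrr :: "'a list set" where
  "MonIrr = {P \<in> carrier (K[X]). pirreducible K P \<and> lead_coeff P = \<one>}"

sublocale UP: domain "K[X]" using univ_poly_is_domain[OF K_subring] .

section \<open>Arithmetic of monic and monic irreducible polynomials\<close>

lemma MonD: "g \<in> Mon n \<Longrightarrow> g \<in> carrier (K[X])" "g \<in> Mon n \<Longrightarrow> g \<noteq> []" "g \<in> Mon n \<Longrightarrow> degree g = n"
  "g \<in> Mon n \<Longrightarrow> lead_coeff g = \<one>"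
  unfolding Mon_def by auto

lemma MonI: "g \<in> carrier (K[X]) \<Longrightarrow> g \<noteq> [] \<Longrightarrow> degree g = n \<Longrightarrow> lead_coeff g = \<one> \<Longrightarrow> g \<in> Mon n"
  unfolding Mon_def by (cases g) auto

lemma finite_Mon: "finite (Mon n)"
  by (rule finite_subset[OF _ card_polys_length_le(1)[OF K finite_K, of "Suc n"]]) (auto simp: Mon_def)

lemma Mon_0: "Mon 0 = {[\<one>]}"
proof -
  have "[\<one>] \<in> carrier (K[X])" using UP.one_closed by (simp add: univ_poly_one)
  then show ?thesis unfolding Mon_def by (auto simp: length_Suc_conv)
qed

lemma Mon_mult:
  assumes "f \<in> Mon i" "g \<in> Mon j"
  shows "f \<otimes>\<^bsub>K[X]\<^esub> g \<in> Mon (i + j)"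
proof (rule MonI)
  note f = MonD[OF assms(1)] and g = MonD[OF assms(2)]
  show "f \<otimes>\<^bsub>K[X]\<^esub> g \<noteq> []" using UP.integral_iff[OF f(1) g(1)] f g by (simp add: univ_poly_zero)
  show "degree (f \<otimes>\<^bsub>K[X]\<^esub> g) = i + j"
    using poly_mult_degree_eq[OF K_subring, of f g] f g unfolding univ_poly_carrier univ_poly_mult by simp
  show "lead_coeff (f \<otimes>\<^bsub>K[X]\<^esub> g) = \<one>"
    using poly_mult_lead_coeff[OF K_subring, of f g] f g unfolding univ_poly_carrier univ_poly_mult by simp
qed (use assms MonD in auto)

lemma Mon_pow: "f \<in> Mon i \<Longrightarrow> f [^]\<^bsub>K[X]\<^esub> j \<in> Mon (j * i)"
proof (induction j)
  case 0
  then show ?case by (simp add: Mon_0 univ_poly_one)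
next
  case (Suc j)
  then show ?case using Mon_mult[of "f [^]\<^bsub>K[X]\<^esub> j" "j * i" f i] by (simp add: add.commute)
qed

lemma Mon_quotient:
  assumes "f \<in> Mon i" "h \<in> carrier (K[X])" "f \<otimes>\<^bsub>K[X]\<^esub> h \<in> Mon n"
  shows "i \<le> n" "h \<in> Mon (n - i)"
proof -
  note f = MonD[OF assms(1)] and fh = MonD[OF assms(3)]
  have h0: "h \<noteq> []" using UP.r_null[OF f(1)] fh(2) by (auto simp: univ_poly_zero)
  have n: "n = i + degree h"
    using poly_mult_degree_eq[OF K_subring, of f h] f assms(2) fh h0 unfolding univ_poly_carrier univ_poly_mult by simp
  have "lead_coeff h \<in> carrier R"
    using assms(2) h0 K_carrier by (cases h) (auto simp: univ_poly_carrier[symmetric] polynomial_def)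
  then have "lead_coeff h = \<one>"
    using poly_mult_lead_coeff[OF K_subring, of f h] f assms(2) fh h0 unfolding univ_poly_carrier univ_poly_mult by simp
  then show "i \<le> n" "h \<in> Mon (n - i)" using n h0 assms(2) by (auto intro!: MonI)
qed

lemma MonIrrD:
  assumes "P \<in> MonIrr"
  shows "P \<in> carrier (K[X])" "pirreducible K P" "P \<in> Mon (degree P)" "degree P \<ge> 1" "P \<noteq> []"
  using assms pirreducible_degree[OF K, of P] pirreducibleE(1)[OF K_subring, of P]
  unfolding MonIrr_def by (auto intro!: MonI)

lemma Irr_MonIrr:
  assumes "y \<in> carrier R" "(algebraic over K) y"
  shows "Irr K y \<in> MonIrr"
  using IrrE[OF K assms] unfolding MonIrr_def by simp

lemma MonIrr_root:
  assumes "P \<in> MonIrr"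
  obtains y where "y \<in> carrier R" "(algebraic over K) y" "Irr K y = P"
proof -
  note P = MonIrrD[OF assms]
  obtain y where y: "y \<in> carrier R" "eval P y = \<zero>"
    using root_exists[OF carrier_polynomial_shell[OF K_subring P(1)] less_le_trans[OF zero_less_one P(4)]] by blast
  have "(algebraic over K) y" using algebraicI[OF P(1,5) y(2)] .
  moreover have "Irr K y = P" using Irr_unique[OF K y(1) P(1,2) y(2)] assms by (simp add: MonIrr_def)
  ultimately show ?thesis using that y by blast
qed

text \<open>A root of \<open>P\<close> is also a root of \<open>Q\<close>, and both polynomials are
  its minimal polynomial.\<close>

lemma MonIrr_pdivides_MonIrr:
  assumes "P \<in> MonIrr" "Q \<in> MonIrr" "P pdivides Q"
  shows "P = Q"
proof -
  note P = MonIrrD[OF assms(1)] and Q = MonIrrD[OF assms(2)]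
  obtain y where y: "y \<in> carrier R" "(algebraic over K) y" "Irr K y = P" using MonIrr_root[OF assms(1)] .
  have "eval P y = \<zero>" using IrrE(4)[OF K y(1,2)] y(3) by simp
  then have "eval Q y = \<zero>"
    using pdivides_imp_root_sharing[OF carrier_polynomial_shell[OF K_subring P(1)] assms(3) y(1)] by simp
  then show ?thesis using Irr_unique[OF K y(1) Q(1,2)] assms(2) y(3) by (simp add: MonIrr_def)
qed

text \<open>Records multiplicities without a factorization: \<open>P\<close> occurs with the
  exponents from 1 up to its multiplicity in \<open>g\<close>. Summing \<open>degree P\<close> over
  the pairs is the analogue of summing von Mangoldt's function over the divisors of an
  integer.\<close>

definition primary_divisors :: "'a list \<Rightarrow> ('a list \<times> nat) set" where
  "primary_divisors g = {(P, j). P \<in> MonIrr \<and> j \<ge> 1 \<and> P [^]\<^bsub>K[X]\<^esub> j divides\<^bsub>K[X]\<^esub> g}"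

lemma primary_divisors_degree:
  assumes "g \<in> Mon n" "(P, j) \<in> primary_divisors g"
  shows "j * degree P \<le> n"
proof -
  obtain h where h: "h \<in> carrier (K[X])" "g = P [^]\<^bsub>K[X]\<^esub> j \<otimes>\<^bsub>K[X]\<^esub> h"
    using assms(2) unfolding primary_divisors_def factor_def by auto
  have "P \<in> MonIrr" using assms(2) by (simp add: primary_divisors_def)
  then show ?thesis
    using Mon_quotient(1)[OF Mon_pow[OF MonIrrD(3)] h(1)] assms(1) h(2) by simp
qed

lemma finite_MonIrr_le: "finite {P \<in> MonIrr. degree P \<le> n}"
  by (rule finite_subset[of _ "\<Union>i\<le>n. Mon i"]) (use MonIrrD(3) finite_Mon in auto)

lemma finite_primary_divisors:
  assumes "g \<in> Mon n"
  shows "finite (primary_divisors g)"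
proof (rule finite_subset)
  show "primary_divisors g \<subseteq> {P \<in> MonIrr. degree P \<le> n} \<times> {..n}"
  proof
    fix w assume w: "w \<in> primary_divisors g"
    obtain P j where Pj: "w = (P, j)" by (cases w)
    then have "P \<in> MonIrr" "j \<ge> 1" using w unfolding primary_divisors_def by auto
    moreover from this have "degree P \<ge> 1" using MonIrrD(4) by blast
    moreover have "j * degree P \<le> n" using primary_divisors_degree[OF assms] w Pj by simp
    moreover have "j * 1 \<le> j * degree P" by (intro mult_le_mono2 \<open>degree P \<ge> 1\<close>)
    moreover have "1 * degree P \<le> j * degree P" by (intro mult_le_mono1 \<open>j \<ge> 1\<close>)
    ultimately have "P \<in> MonIrr" "degree P \<le> n" "j \<le> n" by linarith+
    then show "w \<in> {P \<in> MonIrr. degree P \<le> n} \<times> {..n}" unfolding Pj by auto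
  qed
qed (use finite_MonIrr_le in simp)

text \<open>The exponents of \<open>P0\<close> move up by one by cancellation, which frees the
  exponent 1; powers of any other monic irreducible are coprime to \<open>P0\<close> and are not
  affected.\<close>

lemma primary_divisors_mult:
  assumes P0: "P0 \<in> MonIrr" and h: "h \<in> carrier (K[X])"
  shows "primary_divisors (P0 \<otimes>\<^bsub>K[X]\<^esub> h)
    = insert (P0, 1) ((\<lambda>(P, j). if P = P0 then (P, Suc j) else (P, j)) ` primary_divisors h)"
    (is "_ = insert _ (?s ` _)")
proof -
  note P0D = MonIrrD[OF P0]
  have other: "P [^]\<^bsub>K[X]\<^esub> j divides\<^bsub>K[X]\<^esub> (P0 \<otimes>\<^bsub>K[X]\<^esub> h) \<longleftrightarrow> P [^]\<^bsub>K[X]\<^esub> j divides\<^bsub>K[X]\<^esub> h"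
    if P: "P \<in> MonIrr" "P \<noteq> P0" for P and j :: nat
  proof -
    have "\<not> P pdivides P0" using MonIrr_pdivides_MonIrr[OF P(1) P0] P(2) by blast
    then show ?thesis
      using pirreducible_pow_pdivides_iff[OF K MonIrrD(1)[OF P(1)] P0D(1) h MonIrrD(2)[OF P(1)]]
        pdivides_iff_shell[OF K] MonIrrD(1)[OF P(1)] P0D(1) h by simp
  qed
  have same: "P0 [^]\<^bsub>K[X]\<^esub> Suc j divides\<^bsub>K[X]\<^esub> (P0 \<otimes>\<^bsub>K[X]\<^esub> h) \<longleftrightarrow> P0 [^]\<^bsub>K[X]\<^esub> j divides\<^bsub>K[X]\<^esub> h" for j :: nat
  proof -
    have nz: "P0 \<noteq> \<zero>\<^bsub>K[X]\<^esub>" using P0D(5) by (simp add: univ_poly_zero)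
    have "P0 \<otimes>\<^bsub>K[X]\<^esub> h = P0 [^]\<^bsub>K[X]\<^esub> Suc j \<otimes>\<^bsub>K[X]\<^esub> c \<longleftrightarrow> h = P0 [^]\<^bsub>K[X]\<^esub> j \<otimes>\<^bsub>K[X]\<^esub> c"
      if c: "c \<in> carrier (K[X])" for c
    proof -
      have e: "P0 [^]\<^bsub>K[X]\<^esub> Suc j \<otimes>\<^bsub>K[X]\<^esub> c = P0 \<otimes>\<^bsub>K[X]\<^esub> (P0 [^]\<^bsub>K[X]\<^esub> j \<otimes>\<^bsub>K[X]\<^esub> c)"
        using c P0D(1) by (simp only: UP.nat_pow_Suc2 UP.m_assoc UP.nat_pow_closed)
      show ?thesis unfolding e by (rule UP.m_lcancel) (use nz c P0D(1) h in auto)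
    qed
    then show ?thesis unfolding factor_def by blast
  qed
  show ?thesis
  proof (intro subset_antisym subsetI)
    fix w assume "w \<in> primary_divisors (P0 \<otimes>\<^bsub>K[X]\<^esub> h)"
    then obtain P j where w: "w = (P, j)" "P \<in> MonIrr" "j \<ge> 1" "P [^]\<^bsub>K[X]\<^esub> j divides\<^bsub>K[X]\<^esub> (P0 \<otimes>\<^bsub>K[X]\<^esub> h)"
      unfolding primary_divisors_def by auto
    consider "P \<noteq> P0" | "P = P0" "j = 1" | "P = P0" "j \<ge> 2" using w(3) by linarith
    then show "w \<in> insert (P0, 1) (?s ` primary_divisors h)"
    proof cases
      case 1
      then have "(P, j) \<in> primary_divisors h" using w other unfolding primary_divisors_def by auto
      then have "?s (P, j) \<in> ?s ` primary_divisors h" by blast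
      then show ?thesis using 1 w(1) by simp
    next
      case 3
      then obtain j' where j': "j = Suc j'" "j' \<ge> 1" by (cases j) auto
      then have "(P0, j') \<in> primary_divisors h" using w same 3 unfolding primary_divisors_def by auto
      then have "?s (P0, j') \<in> ?s ` primary_divisors h" by blast
      then show ?thesis using 3 w(1) j' by simp
    qed (use w in simp)
  next
    fix w assume "w \<in> insert (P0, 1) (?s ` primary_divisors h)"
    then consider "w = (P0, 1)" | P j where "(P, j) \<in> primary_divisors h" "w = ?s (P, j)" by auto
    then show "w \<in> primary_divisors (P0 \<otimes>\<^bsub>K[X]\<^esub> h)"
    proof cases
      case 1
      have "P0 divides\<^bsub>K[X]\<^esub> (P0 \<otimes>\<^bsub>K[X]\<^esub> h)" using h by (intro dividesI[of h]) auto
      then show ?thesis using 1 P0 P0D(1) unfolding primary_divisors_def by simp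
    next
      case 2
      then show ?thesis using same other P0 unfolding primary_divisors_def
        by (cases "P = P0") (auto simp del: UP.nat_pow_Suc)
    qed
  qed
qed

text \<open>Stands in for unique factorization. Dividing \<open>g\<close> by the minimal polynomial
  \<open>P0\<close> of one of its roots removes a single pair up to the shift of exponents, and
  lowers both sides by \<open>degree P0\<close>.\<close>

lemma sum_degree_primary_divisors:
  "g \<in> Mon n \<Longrightarrow> (\<Sum>(P, j)\<in>primary_divisors g. degree P) = n"
proof (induction n arbitrary: g rule: less_induct)
  case (less n)
  note g = MonD[OF less.prems]
  show ?case
  proof (cases "n = 0")
    case True
    have "w \<notin> primary_divisors g" for w
    proof
      assume w: "w \<in> primary_divisors g"
      obtain P j where Pj: "w = (P, j)" by (cases w)
      have "j \<ge> 1" "degree P \<ge> 1" using w MonIrrD(4) unfolding Pj primary_divisors_def by auto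
      moreover have "j * degree P = 0" using primary_divisors_degree[OF less.prems] w True Pj by simp
      ultimately show False by simp
    qed
    then have "primary_divisors g = {}" by blast
    then show ?thesis using True by simp
  next
    case False
    obtain y where y: "y \<in> carrier R" "eval g y = \<zero>"
      using root_exists[OF carrier_polynomial_shell[OF K_subring g(1)]] g(3) False by auto
    have alg: "(algebraic over K) y" using algebraicI[OF g(1,2) y(2)] .
    define P0 where "P0 = Irr K y"
    have P0: "P0 \<in> MonIrr" unfolding P0_def using Irr_MonIrr[OF y(1) alg] .
    note P0D = MonIrrD[OF P0]
    have "P0 pdivides g" unfolding P0_def using Irr_minimal[OF K y(1) alg g(1) y(2)] .
    then obtain h where h: "h \<in> carrier (K[X])" "g = P0 \<otimes>\<^bsub>K[X]\<^esub> h"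
      using pdivides_iff_shell[OF K P0D(1) g(1)] unfolding factor_def by auto
    have hM: "degree P0 \<le> n" "h \<in> Mon (n - degree P0)"
      using Mon_quotient[OF P0D(3) h(1)] less.prems h(2) by auto
    let ?s = "\<lambda>(P, j). if P = P0 then (P, Suc j) else (P, j)"
    have inj: "inj_on ?s (primary_divisors h)"
      by (auto simp: inj_on_def split: if_splits)
    have new: "(P0, 1) \<notin> ?s ` primary_divisors h"
      by (auto simp: primary_divisors_def split: if_splits)
    have "(\<Sum>(P, j)\<in>primary_divisors g. degree P) = degree P0 + (\<Sum>(P, j)\<in>?s ` primary_divisors h. degree P)"
      unfolding h(2) primary_divisors_mult[OF P0 h(1)]
      using new finite_primary_divisors[OF hM(2)] by simp
    also have "(\<Sum>(P, j)\<in>?s ` primary_divisors h. degree P) = (\<Sum>(P, j)\<in>primary_divisors h. degree P)"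
      unfolding sum.reindex[OF inj] by (intro sum.cong) auto
    also have "\<dots> = n - degree P0"
      using less.IH[OF _ hM(2)] P0D(4) False by simp
    finally show ?thesis using hM(1) by simp
  qed
qed

end

section \<open>The $L$-function of a character\<close>

text \<open>
  The conjugates of \<open>a\<close> under the Frobenius map are exactly \<open>d\<close> in number, so \<open>E\<close> below is the
  field \<open>K(a)\<close>; only the values of \<open>\<chi>\<close> on \<open>E\<close> matter.
\<close>

locale katz_setup = closed_finite_base +
  fixes a :: 'a and d :: nat and \<chi> :: "'a \<Rightarrow> complex"
  assumes a: "a \<in> carrier R" and dpos: "d > 0" and a_period: "a [^] (q ^ d) = a"
    and a_primitive: "\<And>i. 0 < i \<Longrightarrow> i < d \<Longrightarrow> a [^] (q ^ i) \<noteq> a"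
    and chi0: "\<chi> \<zero> = 0" and chi1: "\<chi> \<one> = 1"
    and chi_mult: "\<And>x y. x \<in> carrier R \<Longrightarrow> x [^] (q ^ d) = x \<Longrightarrow> y \<in> carrier R \<Longrightarrow> y [^] (q ^ d) = y
      \<Longrightarrow> \<chi> (x \<otimes> y) = \<chi> x * \<chi> y"
    and chi_norm: "\<And>x. x \<in> carrier R \<Longrightarrow> x [^] (q ^ d) = x \<Longrightarrow> cmod (\<chi> x) \<le> 1"
    and chi_nontriv: "\<exists>x\<in>carrier R. x [^] (q ^ d) = x \<and> x \<noteq> \<zero> \<and> \<chi> x \<noteq> 1"
begin

definition E :: "'a set" where "E = {x \<in> carrier R. x [^] (q ^ d) = x}"

lemma E_subfield: "subfield E R" unfolding E_def by (rule fixed_subfield)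

lemma card_E: "finite E" "card E = q ^ d" using card_fixed[OF dpos] unfolding E_def by auto

lemma E_carrier: "x \<in> E \<Longrightarrow> x \<in> carrier R" unfolding E_def by simp

lemma E_props: "\<zero> \<in> E" "\<one> \<in> E" "x \<in> E \<Longrightarrow> y \<in> E \<Longrightarrow> x \<otimes> y \<in> E" "x \<in> E \<Longrightarrow> y \<in> E \<Longrightarrow> x \<oplus> y \<in> E"
  using subringE[OF subfieldE(1)[OF E_subfield]] by auto

lemma E_pow: "x \<in> E \<Longrightarrow> x [^] (n::nat) \<in> E"
  by (induction n) (use E_props in auto)

lemma chi_mult_E: "x \<in> E \<Longrightarrow> y \<in> E \<Longrightarrow> \<chi> (x \<otimes> y) = \<chi> x * \<chi> y"
  unfolding E_def using chi_mult by auto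

lemma chi_pow_E: "x \<in> E \<Longrightarrow> \<chi> (x [^] (n::nat)) = \<chi> x ^ n"
  by (induction n) (use chi1 chi_mult_E E_pow in auto)

lemma sum_chi: "(\<Sum>x\<in>E. \<chi> x) = 0"
proof -
  obtain u where u: "u \<in> E" "u \<noteq> \<zero>" "\<chi> u \<noteq> 1" using chi_nontriv unfolding E_def by auto
  have inj: "inj_on (\<lambda>x. u \<otimes> x) E"
    using u E_carrier by (intro inj_onI) (metis m_lcancel)
  have "(\<lambda>x. u \<otimes> x) ` E = E"
    using u E_props inj card_E(1) by (intro endo_inj_surj) auto
  then have "(\<Sum>x\<in>E. \<chi> x) = (\<Sum>x\<in>E. \<chi> (u \<otimes> x))"
    using sum.reindex[OF inj, of \<chi>] by (simp add: o_def)
  also have "\<dots> = \<chi> u * (\<Sum>x\<in>E. \<chi> x)"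
    using u chi_mult_E by (simp add: sum_distrib_left)
  finally show ?thesis using u(3) by simp
qed

lemma sum_chi_translate:
  assumes "y \<in> E"
  shows "(\<Sum>x\<in>E. \<chi> (y \<oplus> x)) = 0"
proof -
  have inj: "inj_on (\<lambda>x. y \<oplus> x) E" using assms E_carrier by (auto simp: inj_on_def)
  have "(\<lambda>x. y \<oplus> x) ` E = E"
    using assms E_props inj card_E(1) by (intro endo_inj_surj) auto
  then show ?thesis using sum.reindex[OF inj, of \<chi>] sum_chi by (simp add: o_def)
qed

lemma a_in_E: "a \<in> E" unfolding E_def using a a_period by simp

lemma eval_E: "g \<in> carrier (K[X]) \<Longrightarrow> eval g a \<in> E"
  using eval_frob[of g a d] a a_period eval_poly_in_carrier[OF K_subring _ a, of g]
  unfolding E_def univ_poly_carrier by simp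

lemma conj_a_inj: "inj_on (\<lambda>i. a [^] (q ^ i)) {..<d}"
proof -
  have *: "False" if "i < j" "j < d" "a [^] (q ^ i) = a [^] (q ^ j)" for i j
  proof -
    have 1: "a [^] (q ^ (i + (d - j))) = a"
      using that frob_frob[OF a, of i "d - j"] frob_frob[OF a, of j "d - j"] a_period by simp
    have 2: "0 < i + (d - j)" "i + (d - j) < d" using that by linarith+
    from a_primitive[OF 2] 1 show False ..
  qed
  show ?thesis
  proof (rule inj_onI)
    fix i j assume ij: "i \<in> {..<d}" "j \<in> {..<d}" "a [^] (q ^ i) = a [^] (q ^ j)"
    show "i = j"
    proof (cases i j rule: linorder_cases)
      case less
      then show ?thesis using *[OF less _ ij(3)] ij(2) by blast
    next
      case greater
      then show ?thesis using *[OF greater _ ij(3)[symmetric]] ij(1) by blast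
    qed
  qed
qed

text \<open>A polynomial over \<open>K\<close> that vanishes at \<open>a\<close> vanishes at its
  \<open>d\<close> conjugates, so evaluation is injective in degree below \<open>d\<close>; both
  sets have \<open>q ^ d\<close> elements.\<close>

lemma eval_a_bij: "bij_betw (\<lambda>r. eval r a) {r \<in> carrier (K[X]). length r \<le> d} E"
proof -
  let ?B = "{r \<in> carrier (K[X]). length r \<le> d}"
  interpret ev: ring_hom_ring "K[X]" R "\<lambda>p. eval p a" using eval_ring_hom[OF K_subring a] .
  interpret ev': ring_hom_cring "K[X]" R "\<lambda>p. eval p a" using eval_cring_hom[OF K_subring a] .
  have zero: "r = []" if r: "r \<in> carrier (K[X])" "length r \<le> d" "eval r a = \<zero>" for r
  proof (rule ccontr)
    assume ne: "r \<noteq> []"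
    have "card ((\<lambda>i. a [^] (q ^ i)) ` {..<d}) \<le> degree r"
    proof (rule card_zeros_le_degree(2)[OF carrier_polynomial_shell[OF K_subring r(1)] ne])
      show "eval r x = \<zero>" if "x \<in> (\<lambda>i. a [^] (q ^ i)) ` {..<d}" for x
        using that eval_frob[OF r(1) a] r(3) q_ge2 by (auto simp: nat_pow_zero)
    qed (use a in auto)
    then have "d \<le> degree r" using card_image[OF conj_a_inj] by simp
    then show False using r(2) ne dpos by (cases r) auto
  qed
  have inj: "inj_on (\<lambda>r. eval r a) ?B"
  proof (rule inj_onI)
    fix r r' assume r: "r \<in> ?B" "r' \<in> ?B" "eval r a = eval r' a"
    have "length (r \<oplus>\<^bsub>K[X]\<^esub> (\<ominus>\<^bsub>K[X]\<^esub> r')) \<le> d"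
      using poly_add_length_le[of r "\<ominus>\<^bsub>K[X]\<^esub> r'"] univ_poly_a_inv_length[OF K_subring, of r'] r(1,2)
      unfolding univ_poly_add by auto
    moreover have "eval (r \<oplus>\<^bsub>K[X]\<^esub> (\<ominus>\<^bsub>K[X]\<^esub> r')) a = \<zero>"
      using r by (simp add: r_neg)
    ultimately have "r \<oplus>\<^bsub>K[X]\<^esub> (\<ominus>\<^bsub>K[X]\<^esub> r') = \<zero>\<^bsub>K[X]\<^esub>"
      using zero r by (simp add: univ_poly_zero)
    then show "r = r'" using r
      by (metis (no_types, lifting) UP.minus_minus UP.a_inv_closed UP.sum_zero_eq_neg mem_Collect_eq)
  qed
  moreover have "(\<lambda>r. eval r a) ` ?B \<subseteq> E" using eval_E by auto
  moreover have "card ((\<lambda>r. eval r a) ` ?B) = card E"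
    using card_image[OF inj] card_polys_length_le(2)[OF K finite_K, of d] card_K card_E(2) by simp
  ultimately show ?thesis using card_subset_eq[OF card_E(1)] unfolding bij_betw_def by blast
qed

text \<open>A Dirichlet character of the polynomial ring modulo the minimal polynomial of
  \<open>a\<close>.\<close>

definition X\<chi> :: "'a list \<Rightarrow> complex" where "X\<chi> g = \<chi> (eval g a)"

text \<open>The coefficients of the L-series of \<open>X\<chi>\<close>.\<close>

definition c :: "nat \<Rightarrow> complex" where "c n = (\<Sum>g\<in>Mon n. X\<chi> g)"

lemma X\<chi>_mult:
  assumes "f \<in> carrier (K[X])" "g \<in> carrier (K[X])"
  shows "X\<chi> (f \<otimes>\<^bsub>K[X]\<^esub> g) = X\<chi> f * X\<chi> g"
proof -
  interpret ev: ring_hom_ring "K[X]" R "\<lambda>p. eval p a" using eval_ring_hom[OF K_subring a] .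
  show ?thesis unfolding X\<chi>_def using assms chi_mult_E[OF eval_E eval_E] by simp
qed

lemma X\<chi>_pow: "f \<in> carrier (K[X]) \<Longrightarrow> X\<chi> (f [^]\<^bsub>K[X]\<^esub> (j::nat)) = X\<chi> f ^ j"
proof (induction j)
  case 0
  have "eval \<one>\<^bsub>K[X]\<^esub> a = \<one>" using a by (simp add: univ_poly_one)
  then show ?case by (simp add: X\<chi>_def chi1)
qed (simp add: X\<chi>_mult)

lemma c_0: "c 0 = 1" unfolding c_def Mon_0 X\<chi>_def using a chi1 by simp

lemma c_1: "c 1 = (\<Sum>b\<in>K. \<chi> (a \<oplus> b))"
proof -
  have "bij_betw (\<lambda>b. [\<one>, b]) K (Mon 1)"
    unfolding bij_betw_def
  proof
    show "(\<lambda>b. [\<one>, b]) ` K = Mon 1"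
      unfolding Mon_def using subringE(3)[OF K_subring]
      by (auto simp: length_Suc_conv image_iff univ_poly_carrier[symmetric] polynomial_def)
  qed (auto simp: inj_on_def)
  then have "c 1 = (\<Sum>b\<in>K. X\<chi> [\<one>, b])" unfolding c_def by (rule sum.reindex_bij_betw[symmetric])
  also have "\<dots> = (\<Sum>b\<in>K. \<chi> (a \<oplus> b))"
    unfolding X\<chi>_def using a K_carrier by (intro sum.cong) auto
  finally show ?thesis .
qed

text \<open>Adding a polynomial of degree below \<open>d\<close> permutes the monic polynomials of
  degree \<open>n\<close>. Averaging over all such shifts replaces each value \<open>g(a)\<close> by
  the whole of \<open>E\<close>, over which \<chi> sums to 0.\<close>

lemma c_eq_0:
  assumes n: "n \<ge> d"
  shows "c n = 0"
proof -
  let ?B = "{r \<in> carrier (K[X]). length r \<le> d}"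
  have shift: "c n = (\<Sum>g\<in>Mon n. \<chi> (eval g a \<oplus> eval r a))" if r: "r \<in> ?B" for r
  proof -
    have rc: "r \<in> carrier (K[X])" "length r \<le> d" using r by auto
    interpret ev: ring_hom_ring "K[X]" R "\<lambda>p. eval p a" using eval_ring_hom[OF K_subring a] .
    have mem: "g \<oplus>\<^bsub>K[X]\<^esub> r \<in> Mon n" if g: "g \<in> Mon n" for g
    proof -
      note gD = MonD[OF g]
      have l: "length g = Suc n" using g unfolding Mon_def by simp
      have pol: "polynomial K g" "polynomial K r" using gD rc unfolding univ_poly_carrier by auto
      have len: "length (g \<oplus>\<^bsub>K[X]\<^esub> r) = Suc n"
        unfolding univ_poly_add
        using poly_add_length_eq[OF K_subring pol] l rc n by auto
      have "coeff (g \<oplus>\<^bsub>K[X]\<^esub> r) n = coeff g n \<oplus> coeff r n"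
        unfolding univ_poly_add using poly_add_coeff polynomial_in_carrier[OF K_subring] pol by simp
      also have "coeff r n = \<zero>" using coeff_length[of r n] rc n by simp
      also have "coeff g n = \<one>" using lead_coeff_simp[OF gD(2)] gD by simp
      finally have "lead_coeff (g \<oplus>\<^bsub>K[X]\<^esub> r) = \<one>"
        using lead_coeff_simp[of "g \<oplus>\<^bsub>K[X]\<^esub> r"] len by fastforce
      then show ?thesis unfolding Mon_def using len gD rc by simp
    qed
    have inj: "inj_on (\<lambda>g. g \<oplus>\<^bsub>K[X]\<^esub> r) (Mon n)"
      using rc MonD(1) by (auto simp: inj_on_def)
    have "(\<lambda>g. g \<oplus>\<^bsub>K[X]\<^esub> r) ` Mon n = Mon n"
      using mem inj finite_Mon by (intro endo_inj_surj) auto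
    then have "c n = (\<Sum>g\<in>Mon n. X\<chi> (g \<oplus>\<^bsub>K[X]\<^esub> r))"
      unfolding c_def using sum.reindex[OF inj, of X\<chi>] by (simp add: o_def)
    also have "\<dots> = (\<Sum>g\<in>Mon n. \<chi> (eval g a \<oplus> eval r a))"
      unfolding X\<chi>_def using MonD(1) rc by (intro sum.cong) auto
    finally show ?thesis .
  qed
  have "of_nat (card ?B) * c n = (\<Sum>r\<in>?B. \<Sum>g\<in>Mon n. \<chi> (eval g a \<oplus> eval r a))"
  proof -
    have "of_nat (card ?B) * c n = (\<Sum>r\<in>?B. c n)" by simp
    also have "\<dots> = (\<Sum>r\<in>?B. \<Sum>g\<in>Mon n. \<chi> (eval g a \<oplus> eval r a))"
      by (rule sum.cong[OF refl shift])
    finally show ?thesis .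
  qed
  also have "\<dots> = (\<Sum>g\<in>Mon n. \<Sum>r\<in>?B. \<chi> (eval g a \<oplus> eval r a))"
    by (rule sum.swap)
  also have "\<dots> = (\<Sum>g\<in>Mon n. \<Sum>x\<in>E. \<chi> (eval g a \<oplus> x))"
    by (intro sum.cong refl sum.reindex_bij_betw[OF eval_a_bij])
  also have "\<dots> = 0" using sum_chi_translate[OF eval_E] MonD(1) by simp
  finally show ?thesis
    using card_polys_length_le(2)[OF K finite_K, of d] card_K q_ge2 by simp
qed

definition T :: "nat \<Rightarrow> ('a list \<times> nat) set" where
  "T m = {(P, j). P \<in> MonIrr \<and> j \<ge> 1 \<and> j * degree P = m}"

text \<open>The coefficient of \<open>u ^ m\<close> in \<open>u * L'(u) / L(u)\<close>, where
  \<open>L\<close> is the L-series, as read off from the Euler product: a power of \<open>P\<close>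
  carries the weight \<open>degree P\<close> whatever its exponent.\<close>

definition S :: "nat \<Rightarrow> complex" where
  "S m = (\<Sum>(P, j)\<in>T m. of_nat (degree P) * X\<chi> P ^ j)"

lemma finite_T: "finite (T m)"
proof (rule finite_subset)
  show "T m \<subseteq> {P \<in> MonIrr. degree P \<le> m} \<times> {..m}"
  proof
    fix w assume w: "w \<in> T m"
    obtain P j where Pj: "w = (P, j)" by (cases w)
    then have "P \<in> MonIrr" "j \<ge> 1" "j * degree P = m" using w unfolding T_def by auto
    moreover from this have "degree P \<ge> 1" using MonIrrD(4) by blast
    moreover have "j * 1 \<le> j * degree P" by (intro mult_le_mono2 \<open>degree P \<ge> 1\<close>)
    moreover have "1 * degree P \<le> j * degree P" by (intro mult_le_mono1 \<open>j \<ge> 1\<close>)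
    ultimately have "P \<in> MonIrr" "degree P \<le> m" "j \<le> m" by linarith+
    then show "w \<in> {P \<in> MonIrr. degree P \<le> m} \<times> {..m}" unfolding Pj by auto
  qed
qed (use finite_MonIrr_le in simp)

lemma sum_Mon_multiples:
  assumes f: "f \<in> Mon m" and m: "m \<le> n"
  shows "(\<Sum>g\<in>{g \<in> Mon n. f divides\<^bsub>K[X]\<^esub> g}. X\<chi> g) = X\<chi> f * c (n - m)"
proof -
  note fD = MonD[OF f]
  have inj: "inj_on (\<lambda>h. f \<otimes>\<^bsub>K[X]\<^esub> h) (Mon (n - m))"
    using fD MonD(1) by (intro inj_onI) (metis UP.m_lcancel univ_poly_zero)
  have "{g \<in> Mon n. f divides\<^bsub>K[X]\<^esub> g} = (\<lambda>h. f \<otimes>\<^bsub>K[X]\<^esub> h) ` Mon (n - m)"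
  proof (intro subset_antisym subsetI)
    fix g assume "g \<in> {g \<in> Mon n. f divides\<^bsub>K[X]\<^esub> g}"
    then obtain h where "g \<in> Mon n" "h \<in> carrier (K[X])" "g = f \<otimes>\<^bsub>K[X]\<^esub> h"
      unfolding factor_def by auto
    then show "g \<in> (\<lambda>h. f \<otimes>\<^bsub>K[X]\<^esub> h) ` Mon (n - m)" using Mon_quotient(2)[OF f] by blast
  next
    fix g assume "g \<in> (\<lambda>h. f \<otimes>\<^bsub>K[X]\<^esub> h) ` Mon (n - m)"
    then obtain h where h: "h \<in> Mon (n - m)" "g = f \<otimes>\<^bsub>K[X]\<^esub> h" by blast
    then show "g \<in> {g \<in> Mon n. f divides\<^bsub>K[X]\<^esub> g}"
      using Mon_mult[OF f h(1)] m MonD(1)[OF h(1)] by (auto intro!: dividesI[of h])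
  qed
  then have "(\<Sum>g\<in>{g \<in> Mon n. f divides\<^bsub>K[X]\<^esub> g}. X\<chi> g) = (\<Sum>h\<in>Mon (n - m). X\<chi> (f \<otimes>\<^bsub>K[X]\<^esub> h))"
    using sum.reindex[OF inj, of X\<chi>] by (simp add: o_def)
  also have "\<dots> = X\<chi> f * c (n - m)"
    unfolding c_def using X\<chi>_mult[OF fD(1)] MonD(1) by (simp add: sum_distrib_left)
  finally show ?thesis .
qed

text \<open>Compares coefficients in the logarithmic derivative of the Euler product of the $L$-function.\<close>

lemma newton_identity: "of_nat n * c n = (\<Sum>m\<in>{1..n}. S m * c (n - m))"
proof -
  let ?TT = "\<Union>m\<in>{1..n}. T m"
  have finTT: "finite ?TT" using finite_T by simp
  have sub: "primary_divisors g = {w \<in> ?TT. fst w [^]\<^bsub>K[X]\<^esub> snd w divides\<^bsub>K[X]\<^esub> g}" if g: "g \<in> Mon n" for g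
  proof (intro subset_antisym subsetI)
    fix w assume w: "w \<in> primary_divisors g"
    obtain P j where Pj: "w = (P, j)" by (cases w)
    have "P \<in> MonIrr" "j \<ge> 1" using w Pj unfolding primary_divisors_def by auto
    moreover have "j * degree P \<le> n" using primary_divisors_degree[OF g] w Pj by simp
    moreover have "1 * 1 \<le> j * degree P" using calculation MonIrrD(4)[of P] by (intro mult_le_mono) auto
    ultimately have "(P, j) \<in> T (j * degree P)" "j * degree P \<in> {1..n}" unfolding T_def by auto
    then show "w \<in> {w \<in> ?TT. fst w [^]\<^bsub>K[X]\<^esub> snd w divides\<^bsub>K[X]\<^esub> g}"
      using w unfolding Pj primary_divisors_def by auto
  qed (auto simp: primary_divisors_def T_def)
  \<comment> \<open>The factor \<open>n\<close> is written as the total degree of the primary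
    divisors of \<open>g\<close>. Once the sums are exchanged, the \<open>g\<close> divisible by a
    fixed \<open>P ^ j\<close> of degree \<open>m\<close> are its multiples by the monic polynomials
    of degree \<open>n - m\<close>.\<close>
  have "of_nat n * c n = (\<Sum>g\<in>Mon n. (\<Sum>w\<in>primary_divisors g. of_nat (degree (fst w))) * X\<chi> g)"
  proof -
    have "(\<Sum>w\<in>primary_divisors g. of_nat (degree (fst w))) = (of_nat n :: complex)" if "g \<in> Mon n" for g
      using arg_cong[OF sum_degree_primary_divisors[OF that], of "of_nat :: nat \<Rightarrow> complex"]
      by (simp add: case_prod_beta)
    then show ?thesis unfolding c_def by (simp add: sum_distrib_left)
  qed
  also have "\<dots> = (\<Sum>g\<in>Mon n. \<Sum>w\<in>?TT. if fst w [^]\<^bsub>K[X]\<^esub> snd w divides\<^bsub>K[X]\<^esub> g then of_nat (degree (fst w)) * X\<chi> g else 0)"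
    by (intro sum.cong refl, simp only: sub sum_distrib_right sum.inter_filter[OF finTT], intro sum.cong refl, simp)
  also have "\<dots> = (\<Sum>w\<in>?TT. \<Sum>g\<in>Mon n. if fst w [^]\<^bsub>K[X]\<^esub> snd w divides\<^bsub>K[X]\<^esub> g then of_nat (degree (fst w)) * X\<chi> g else 0)"
    by (rule sum.swap)
  also have "\<dots> = (\<Sum>w\<in>?TT. of_nat (degree (fst w)) * (\<Sum>g\<in>{g \<in> Mon n. fst w [^]\<^bsub>K[X]\<^esub> snd w divides\<^bsub>K[X]\<^esub> g}. X\<chi> g))"
    by (intro sum.cong refl, simp only: sum_distrib_left sum.inter_filter[OF finite_Mon], intro sum.cong refl, simp)
  also have "\<dots> = (\<Sum>m\<in>{1..n}. \<Sum>w\<in>T m. of_nat (degree (fst w)) * (\<Sum>g\<in>{g \<in> Mon n. fst w [^]\<^bsub>K[X]\<^esub> snd w divides\<^bsub>K[X]\<^esub> g}. X\<chi> g))"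
    by (rule sum.UNION_disjoint) (use finite_T in \<open>auto simp: T_def\<close>)
  also have "\<dots> = (\<Sum>m\<in>{1..n}. S m * c (n - m))"
  proof (intro sum.cong refl)
    fix m assume m: "m \<in> {1..n}"
    have "(\<Sum>g\<in>{g \<in> Mon n. fst w [^]\<^bsub>K[X]\<^esub> snd w divides\<^bsub>K[X]\<^esub> g}. X\<chi> g) = X\<chi> (fst w) ^ snd w * c (n - m)"
      if w: "w \<in> T m" for w
    proof -
      have P: "fst w \<in> MonIrr" "snd w * degree (fst w) = m" using w unfolding T_def by auto
      have "fst w [^]\<^bsub>K[X]\<^esub> snd w \<in> Mon m" using Mon_pow[OF MonIrrD(3)[OF P(1)], of "snd w"] P(2) by simp
      then show ?thesis using sum_Mon_multiples m X\<chi>_pow[OF MonIrrD(1)[OF P(1)]] by simp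
    qed
    then show "(\<Sum>w\<in>T m. of_nat (degree (fst w)) * (\<Sum>g\<in>{g \<in> Mon n. fst w [^]\<^bsub>K[X]\<^esub> snd w divides\<^bsub>K[X]\<^esub> g}. X\<chi> g))
      = S m * c (n - m)"
      unfolding S_def by (simp add: sum_distrib_right case_prod_beta mult.assoc)
  qed
  finally show ?thesis .
qed

end

section \<open>Power sums of the inverse roots\<close>

text \<open>
  A polynomial \<open>Q\<close> vanishing at all other values isolates the contribution of \<open>w i0\<close> in a linear
  combination of consecutive power sums.
\<close>

lemma power_sums_bounded:
  fixes w :: "nat \<Rightarrow> complex"
  assumes bound: "\<And>s. s \<ge> s0 \<Longrightarrow> cmod (\<Sum>i<n. w i ^ s) \<le> C" and i0: "i0 < n"
  shows "cmod (w i0) \<le> 1"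
proof (rule ccontr)
  assume "\<not> cmod (w i0) \<le> 1"
  then have gt: "cmod (w i0) > 1" by simp
  define v where "v = w i0"
  define Q where "Q = (\<Prod>u\<in>w ` {..<n} - {v}. [:- u, 1:])"
  \<comment> \<open>Equal values \<open>w i\<close> add up instead of cancelling; their number
    enters only as a nonzero factor.\<close>
  define N where "N = card {i \<in> {..<n}. w i = v}"
  have Qv: "poly Q v \<noteq> 0" unfolding Q_def poly_prod by (auto simp: prod_zero_iff)
  have Q0: "poly Q (w i) = 0" if "i < n" "w i \<noteq> v" for i
    unfolding Q_def poly_prod using that by (auto simp: prod_zero_iff)
  have "i0 \<in> {i \<in> {..<n}. w i = v}" using i0 unfolding v_def by simp
  then have N: "N \<noteq> 0" unfolding N_def by auto
  define M where "M = (\<Sum>k\<le>Polynomial.degree Q. cmod (Polynomial.coeff Q k) * C)"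
  have key: "cmod v ^ s \<le> M / (N * cmod (poly Q v))" if s: "s \<ge> s0" for s
  proof -
    have "(\<Sum>k\<le>Polynomial.degree Q. Polynomial.coeff Q k * (\<Sum>i<n. w i ^ (s + k)))
        = (\<Sum>i<n. \<Sum>k\<le>Polynomial.degree Q. Polynomial.coeff Q k * w i ^ (s + k))"
      unfolding sum_distrib_left by (rule sum.swap)
    also have "\<dots> = (\<Sum>i<n. w i ^ s * poly Q (w i))"
      unfolding poly_altdef sum_distrib_left by (intro sum.cong refl) (simp add: power_add mult_ac)
    also have "\<dots> = (\<Sum>i<n. if w i = v then v ^ s * poly Q v else 0)"
      using Q0 by (intro sum.cong refl) auto
    also have "\<dots> = of_nat N * (v ^ s * poly Q v)"
      unfolding N_def by (simp add: sum.inter_filter[symmetric])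
    finally have "N * cmod (poly Q v) * cmod v ^ s
        = cmod (\<Sum>k\<le>Polynomial.degree Q. Polynomial.coeff Q k * (\<Sum>i<n. w i ^ (s + k)))"
      by (simp add: norm_mult norm_power mult_ac)
    also have "\<dots> \<le> M"
      unfolding M_def using bound s by (intro sum_norm_le) (auto simp: norm_mult intro!: mult_left_mono)
    finally show ?thesis using N Qv by (simp add: pos_le_divide_eq mult_ac)
  qed
  obtain s where s: "M / (N * cmod (poly Q v)) < cmod v ^ s"
    using real_arch_pow[OF gt] unfolding v_def by blast
  have "cmod v ^ s \<le> cmod v ^ (s + s0)"
    using gt unfolding v_def by (intro power_increasing) auto
  then show False using s key[of "s + s0"] by simp
qed

text \<open>\<open>G u\<close> is the expansion of \<open>u X / (1 - u X)\<close>, hence its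
  constant term 0; this is minus \<open>X\<close> times the logarithmic derivative of
  \<open>1 - u X\<close>, and logarithmic derivatives add over a product.\<close>

lemma fps_log_deriv_prod_linear:
  fixes w :: "nat \<Rightarrow> complex"
  defines "G \<equiv> \<lambda>u. Abs_fps (\<lambda>m. if m = 0 then 0 else u ^ m)"
  shows "fps_X * fps_deriv (\<Prod>i<n. 1 - fps_const (w i) * fps_X)
    = - (\<Prod>i<n. 1 - fps_const (w i) * fps_X) * (\<Sum>i<n. G (w i))"
proof (induction n)
  case (Suc n)
  have G: "G u * (1 - fps_const u * fps_X) = fps_const u * fps_X" for u
  proof (rule fps_ext)
    fix m
    show "fps_nth (G u * (1 - fps_const u * fps_X)) m = fps_nth (fps_const u * fps_X) m"
      by (cases m) (auto simp: G_def ring_distribs mult.assoc[symmetric] mult.commute[of _ "fps_const _"] fps_mult_fps_X_commute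
        simp flip: power_Suc)
  qed
  let ?L = "\<Prod>i<n. 1 - fps_const (w i) * fps_X"
  let ?l = "1 - fps_const (w n) * fps_X"
  have "fps_X * fps_deriv (?L * ?l) = (fps_X * fps_deriv ?L) * ?l - (fps_const (w n) * fps_X) * ?L"
    by (simp add: algebra_simps)
  also have "\<dots> = - (?L * ?l) * ((\<Sum>i<n. G (w i)) + G (w n))"
    unfolding Suc arg_cong[OF G[of "w n"], of "\<lambda>f. f * ?L", symmetric] by (simp add: algebra_simps)
  finally show ?case by simp
qed simp

text \<open>The \<open>w i\<close> are the inverse roots of the polynomial \<open>L\<close> with
  coefficients \<open>c\<close>. The series of the \<open>S m\<close> and minus the series of the
  power sums both solve \<open>L * f = X * L'\<close>, and \<open>L\<close> can be
  cancelled.\<close>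

lemma newton_power_sums:
  fixes c S :: "nat \<Rightarrow> complex"
  assumes c0: "c 0 = 1" and cz: "\<And>n. n \<ge> d \<Longrightarrow> c n = 0"
    and newton: "\<And>n. of_nat n * c n = (\<Sum>m\<in>{1..n}. S m * c (n - m))"
  obtains w :: "nat \<Rightarrow> complex" where "\<And>m. m \<ge> 1 \<Longrightarrow> S m = - (\<Sum>i<d - 1. w i ^ m)"
proof -
  have d: "d > 0" using c0 cz[of 0] by (cases d) auto
  \<comment> \<open>Reversing the coefficients puts \<open>c 0 = 1\<close> in front, so that
    \<open>P\<close> is monic of degree exactly \<open>d - 1\<close> even if
    \<open>c (d - 1) = 0\<close>; the missing inverse roots then appear as
    \<open>w i = 0\<close>.\<close>
  define P where "P = (\<Sum>k<d. Polynomial.monom (c k) (d - 1 - k))"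
  have coeffP: "Polynomial.coeff P j = (if j < d then c (d - 1 - j) else 0)" for j
  proof -
    have "Polynomial.coeff P j = (\<Sum>k<d. if k = d - 1 - j \<and> j < d then c k else 0)"
      unfolding P_def coeff_sum by (intro sum.cong refl) auto
    also have "\<dots> = (if j < d then c (d - 1 - j) else 0)"
      by (cases "j < d") (auto simp: sum.delta)
    finally show ?thesis .
  qed
  have degP: "Polynomial.degree P = d - 1"
  proof (rule antisym)
    show "Polynomial.degree P \<le> d - 1" using d by (intro Polynomial.degree_le) (auto simp: coeffP)
    show "d - 1 \<le> Polynomial.degree P" using d c0 by (intro le_degree) (simp add: coeffP)
  qed
  have P0: "P \<noteq> 0" using d c0 coeffP[of "d - 1"] by auto
  obtain A where A: "size A = Polynomial.degree P"
    "P = Polynomial.smult (Polynomial.lead_coeff P) (\<Prod>x\<in>#A. [:- x, 1:])"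
    using alg_closed_imp_factorization[OF P0] by blast
  obtain xs where xs: "mset xs = A" using ex_mset by blast
  have len: "length xs = d - 1" using xs A(1) degP by (metis size_mset)
  define w where "w i = xs ! i" for i
  have "Polynomial.lead_coeff P = 1" using degP d c0 by (simp add: coeffP)
  then have "P = (\<Prod>x\<in>#mset xs. [:- x, 1:])" using A(2) xs by simp
  also have "\<dots> = prod_list (map (\<lambda>x. [:- x, 1:]) xs)" by (metis mset_map prod_mset_prod_list)
  also have "\<dots> = (\<Prod>i<d - 1. [:- w i, 1:])"
    unfolding prod.list_conv_set_nth w_def using len by (simp add: atLeast0LessThan)
  finally have P: "P = (\<Prod>i<d - 1. [:- w i, 1:])" .
  define L where "L = (\<Prod>i<d - 1. 1 - fps_const (w i) * fps_X)"
  have "fps_of_poly (reflect_poly P) = L"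
  proof -
    have "reflect_poly [:- u, 1:] = [:1, - u:]" for u :: complex
      by (cases "u = 0") (simp_all add: reflect_poly_def)
    then show ?thesis unfolding P L_def reflect_poly_prod fps_of_poly_prod
      by (simp add: fps_of_poly_pCons mult.commute flip: fps_const_neg)
  qed
  then have FL: "fps_of_poly (reflect_poly P) = L" .
  have nthL: "fps_nth L k = c k" for k
  proof -
    have "fps_nth L k = Polynomial.coeff (reflect_poly P) k"
      by (simp flip: FL)
    then show ?thesis
      using cz[of k] d by (auto simp: coeff_reflect_poly degP coeffP)
  qed
  define G where "G = (\<lambda>u::complex. Abs_fps (\<lambda>m. if m = 0 then 0 else u ^ m))"
  define F where "F = Abs_fps (\<lambda>m. if m = 0 then 0 else S m)"
  have 1: "fps_X * fps_deriv L = L * F"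
  proof (rule fps_ext)
    fix n
    have "fps_nth (fps_X * fps_deriv L) n = of_nat n * c n"
      by (cases n) (auto simp: nthL)
    also have "\<dots> = (\<Sum>m\<in>{1..n}. S m * c (n - m))" by (rule newton)
    also have "\<dots> = (\<Sum>m\<in>{0..n}. fps_nth F m * fps_nth L (n - m))"
      by (rule sum.mono_neutral_cong_left) (auto simp: F_def nthL)
    also have "\<dots> = fps_nth (F * L) n" by (simp add: fps_mult_nth)
    finally show "fps_nth (fps_X * fps_deriv L) n = fps_nth (L * F) n" by (simp add: mult.commute)
  qed
  have 2: "fps_X * fps_deriv L = L * (- (\<Sum>i<d - 1. G (w i)))"
    unfolding L_def G_def by (simp add: fps_log_deriv_prod_linear)
  have "L \<noteq> 0" using nthL[of 0] c0 by auto
  then have F: "F = - (\<Sum>i<d - 1. G (w i))"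
    using trans[OF 1[symmetric] 2] mult_left_cancel by blast
  have "S m = - (\<Sum>i<d - 1. w i ^ m)" if "m \<ge> 1" for m
    using arg_cong[OF F, of "\<lambda>f. fps_nth f m"] that by (simp add: F_def G_def fps_sum_nth)
  then show ?thesis using that by blast
qed

text \<open>The growth of \<open>S\<close> is controlled only along multiples of \<open>e\<close>,
  so the power sums are taken of the \<open>e\<close>-th powers of the inverse roots scaled by
  \<open>B\<close>. As \<open>C\<close> is independent of \<open>s\<close>, none of these powers can
  leave the unit disc. The bound follows because \<open>c 1 = S 1\<close> is minus the sum of the
  \<open>d - 1\<close> inverse roots.\<close>

lemma newton_first_coeff_bound:
  fixes c S :: "nat \<Rightarrow> complex" and B C :: real
  assumes c0: "c 0 = 1" and cz: "\<And>n. n \<ge> d \<Longrightarrow> c n = 0"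
    and newton: "\<And>n. of_nat n * c n = (\<Sum>m\<in>{1..n}. S m * c (n - m))"
    and B: "B > 0" and e: "e > 0"
    and bound: "\<And>s. s \<ge> s0 \<Longrightarrow> cmod (S (e * s)) \<le> C * B ^ (e * s)"
  shows "cmod (c 1) \<le> (real d - 1) * B"
proof -
  obtain w where w: "\<And>m. m \<ge> 1 \<Longrightarrow> S m = - (\<Sum>i<d - 1. w i ^ m)"
    using newton_power_sums[OF c0 cz newton] by blast
  have d: "d > 0" using c0 cz[of 0] by (cases d) auto
  have wB: "cmod (w i) \<le> B" if i: "i < d - 1" for i
  proof -
    have "cmod ((w i / of_real B) ^ e) \<le> 1"
    proof (rule power_sums_bounded[of "max s0 1" "\<lambda>i. (w i / of_real B) ^ e" "d - 1" C i, OF _ i])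
      fix s assume s: "s \<ge> max s0 1"
      \<comment> \<open>The maximum with 1 excludes the exponent 0, at which \<open>S\<close> need
        not be a power sum.\<close>
      then have es: "e * s \<ge> 1" using e by simp
      have "(\<Sum>i<d - 1. ((w i / of_real B) ^ e) ^ s) = (\<Sum>i<d - 1. w i ^ (e * s)) / of_real B ^ (e * s)"
        by (simp add: power_mult[symmetric] power_divide sum_divide_distrib)
      then have "cmod (\<Sum>i<d - 1. ((w i / of_real B) ^ e) ^ s) = cmod (S (e * s)) / B ^ (e * s)"
        using w[OF es] B by (simp add: norm_divide norm_power)
      also have "\<dots> \<le> C" using bound[of s] s B by (simp add: pos_divide_le_eq)
      finally show "cmod (\<Sum>i<d - 1. ((w i / of_real B) ^ e) ^ s) \<le> C" .
    qed
    then have "(cmod (w i) / B) ^ e \<le> 1" using B by (simp add: norm_power norm_divide)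
    then have "cmod (w i) / B \<le> 1"
      using e B power_le_one_iff[of "cmod (w i) / B" e] by simp
    then show ?thesis using B by (simp add: pos_divide_le_eq)
  qed
  have "c 1 = S 1" using newton[of 1] c0 by simp
  then have "cmod (c 1) \<le> (\<Sum>i<d - 1. cmod (w i))" using w[of 1] norm_sum[of w "{..<d - 1}"] by simp
  also have "\<dots> \<le> (\<Sum>i<d - 1. B)" using wB by (intro sum_mono) auto
  also have "\<dots> = (real d - 1) * B" using d by (simp add: of_nat_diff)
  finally show ?thesis .
qed

section \<open>Katz's bound\<close>

lemma geometric_nat: "r * (\<Sum>t<s. Suc r ^ t) + 1 = Suc r ^ s"
  by (induction s) (simp_all add: algebra_simps)

context katz_setup
begin

definition F :: "nat \<Rightarrow> 'a set" where "F m = {y \<in> carrier R. y [^] (q ^ m) = y}"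

lemma F_algebraic:
  assumes "m > 0" "y \<in> F m"
  shows "(algebraic over K) y"
proof -
  have "q ^ m \<ge> 2" using q_ge2 self_le_power[of q m] assms(1) by linarith
  note f = pow_minus_var[OF K_subring this]
  show ?thesis using algebraicI[OF f(1,3)] f(4)[of y] assms(2) unfolding F_def by (simp add: r_neg)
qed

text \<open>Sort the \<open>y\<close> by minimal polynomial. A monic irreducible \<open>P\<close> of
  degree \<open>e\<close> dividing \<open>m\<close> has exactly \<open>e\<close> roots, all in
  \<open>F m\<close>, which accounts for the weight \<open>degree P\<close>. At each of them the
  product runs \<open>m div e\<close> times through the conjugates and gives
  \<open>P(a) ^ (m div e)\<close>.\<close>

lemma S_eq_sum:
  assumes m: "m > 0"
  shows "S m = (\<Sum>y\<in>F m. \<chi> (\<Otimes>i\<in>{..<m}. a \<ominus> y [^] (q ^ i)))"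
proof -
  define \<phi> where "\<phi> y = (Irr K y, m div degree (Irr K y))" for y
  have y: "y \<in> carrier R" "(algebraic over K) y" "Irr K y \<in> MonIrr" "degree (Irr K y) dvd m" if "y \<in> F m" for y
  proof -
    show 1: "y \<in> carrier R" "(algebraic over K) y" using F_algebraic[OF m] that by (auto simp: F_def)
    show "Irr K y \<in> MonIrr" by (rule Irr_MonIrr[OF 1])
    show "degree (Irr K y) dvd m" using frob_fixed_iff[OF 1 refl, of m] that by (simp add: F_def)
  qed
  have sub: "\<phi> ` F m \<subseteq> T m"
  proof
    fix t assume "t \<in> \<phi> ` F m"
    then obtain z where z: "z \<in> F m" "t = \<phi> z" by blast
    have "(m div degree (Irr K z)) * degree (Irr K z) = m" using y(4)[OF z(1)] by simp
    moreover from this have "m div degree (Irr K z) \<ge> 1" using m by (cases "m div degree (Irr K z)") auto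
    ultimately show "t \<in> T m" using y(3)[OF z(1)] z(2) unfolding T_def \<phi>_def by auto
  qed
  have fib: "card {z \<in> F m. \<phi> z = t} = degree (fst t)" if t: "t \<in> T m" for t
  proof -
    obtain P j where Pj: "t = (P, j)" "P \<in> MonIrr" "j \<ge> 1" "j * degree P = m" using t unfolding T_def by auto
    obtain y0 where y0: "y0 \<in> carrier R" "(algebraic over K) y0" "Irr K y0 = P" using MonIrr_root[OF Pj(2)] .
    note P = MonIrrD[OF Pj(2)]
    have j: "m div degree P = j" using Pj(4) P(4) by auto
    have "{z \<in> F m. \<phi> z = t} = {x \<in> carrier R. eval P x = \<zero>}"
    proof (intro subset_antisym subsetI)
      fix z assume "z \<in> {z \<in> F m. \<phi> z = t}"
      then show "z \<in> {x \<in> carrier R. eval P x = \<zero>}"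
        using IrrE(4)[OF K y(1,2)] y(1) Pj(1) unfolding \<phi>_def by auto
    next
      fix z assume "z \<in> {x \<in> carrier R. eval P x = \<zero>}"
      then have z: "z \<in> carrier R" "eval P z = \<zero>" by auto
      have al: "(algebraic over K) z" using algebraicI[OF P(1,5) z(2)] .
      have Irr: "Irr K z = P" using Irr_unique[OF K z(1) P(1,2) z(2)] Pj(2) by (simp add: MonIrr_def)
      have "z \<in> F m" using frob_fixed_iff[OF z(1) al refl, of m] Irr Pj(4) z(1) unfolding F_def by auto
      then show "z \<in> {z \<in> F m. \<phi> z = t}" using Irr j Pj(1) unfolding \<phi>_def by simp
    qed
    also have "card \<dots> = degree P"
      using Irr_roots[OF y0(1,2) refl] card_image[OF conjugates_inj[OF y0(1,2) refl]] y0(3) by simp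
    finally show ?thesis using Pj(1) by simp
  qed
  have "S m = (\<Sum>t\<in>T m. \<Sum>z\<in>{z \<in> F m. \<phi> z = t}. X\<chi> (fst t) ^ snd t)"
    unfolding S_def using fib by (intro sum.cong) auto
  also have "\<dots> = (\<Sum>t\<in>T m. \<Sum>z\<in>{z \<in> F m. \<phi> z = t}. X\<chi> (fst (\<phi> z)) ^ snd (\<phi> z))"
    by (intro sum.cong refl) auto
  also have "\<dots> = (\<Sum>z\<in>F m. X\<chi> (fst (\<phi> z)) ^ snd (\<phi> z))"
    by (rule sum.group[OF _ finite_T sub]) (use card_fixed[OF m] in \<open>simp add: F_def\<close>)
  also have "\<dots> = (\<Sum>y\<in>F m. \<chi> (\<Otimes>i\<in>{..<m}. a \<ominus> y [^] (q ^ i)))"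
  proof (intro sum.cong refl)
    fix z assume z: "z \<in> F m"
    note zD = y[OF z]
    define e where "e = degree (Irr K z)"
    have em: "m = e * (m div e)" using zD(4) unfolding e_def by simp
    have "(\<Otimes>i\<in>{..<e * (m div e)}. a \<ominus> z [^] (q ^ i)) = (\<Otimes>i\<in>{..<e}. a \<ominus> z [^] (q ^ i)) [^] (\<Sum>t<m div e. 1 ^ t :: nat)"
    proof (rule finprod_twisted_blocks)
      fix i
      show "a \<ominus> z [^] (q ^ (i + e)) = (a \<ominus> z [^] (q ^ i)) [^] (1::nat)"
        using frob_frob[OF zD(1), of e i] frob_degree[OF zD(1,2) e_def] a zD(1) by (simp add: add.commute)
    qed (use a zD in simp)
    also have "\<dots> = eval (Irr K z) a [^] (m div e)"
      using eval_Irr[OF zD(1,2) e_def a] by simp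
    finally have "\<chi> (\<Otimes>i\<in>{..<m}. a \<ominus> z [^] (q ^ i)) = \<chi> (eval (Irr K z) a [^] (m div e))"
      using em by simp
    also have "\<dots> = X\<chi> (Irr K z) ^ (m div e)"
      unfolding X\<chi>_def using chi_pow_E[OF eval_E[OF MonIrrD(1)[OF zD(3)]]] .
    finally show "X\<chi> (fst (\<phi> z)) ^ snd (\<phi> z) = \<chi> (\<Otimes>i\<in>{..<m}. a \<ominus> z [^] (q ^ i))"
      unfolding \<phi>_def e_def by simp
  qed
  finally show ?thesis .
qed

text \<open>For \<open>y = a - z\<close> the factor \<open>a - y ^ (q ^ i)\<close> becomes
  \<open>z ^ (q ^ i) + (a - a ^ (q ^ i))\<close>. For \<open>i = 0\<close> this is \<open>z\<close>,
  so the first \<open>d\<close> factors multiply to the value of \<open>X V\<close> at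
  \<open>z\<close>. The constants in the other factors are nonzero because the conjugates of
  \<open>a\<close> are distinct, and so 0 is a simple zero.\<close>

definition V :: "'a list" where
  "V = (\<Otimes>\<^bsub>E[X]\<^esub>i\<in>{1..<d}. X [^]\<^bsub>E[X]\<^esub> (q ^ i) \<oplus>\<^bsub>E[X]\<^esub> poly_of_const (a \<ominus> a [^] (q ^ i)))"

definition D :: nat where "D = Suc (degree V)"

lemma E_subring: "subring E R" using subfieldE(1)[OF E_subfield] .

lemma poly_of_const_E:
  assumes "b \<in> E"
  shows "poly_of_const b \<in> carrier (E[X])" "x \<in> carrier R \<Longrightarrow> eval (poly_of_const b) x = b"
proof -
  interpret h: ring_hom_ring "R \<lparr> carrier := E \<rparr>" "E[X]" poly_of_const
    using canonical_embedding_ring_hom[OF E_subring] .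
  show "poly_of_const b \<in> carrier (E[X])" using h.hom_closed[of b] assms by simp
  show "eval (poly_of_const b) x = b" if "x \<in> carrier R"
    unfolding poly_of_const_def using eval_normalize[of "[b]" x] that E_carrier[OF assms] by simp
qed

lemma V_summand: "a \<ominus> a [^] (q ^ i) \<in> E"
  using subringE(5)[OF E_subring] a_in_E E_pow E_props(4) unfolding a_minus_def by blast

lemma V_closed: "V \<in> carrier (E[X])"
proof -
  interpret U: domain "E[X]" using univ_poly_is_domain[OF E_subring] .
  show ?thesis unfolding V_def
    using var_closed(1)[OF E_subring] poly_of_const_E(1)[OF V_summand] by (intro U.finprod_closed) auto
qed

lemma eval_V:
  assumes x: "x \<in> carrier R"
  shows "eval V x = (\<Otimes>i\<in>{1..<d}. x [^] (q ^ i) \<oplus> (a \<ominus> a [^] (q ^ i)))"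
proof -
  interpret U: domain "E[X]" using univ_poly_is_domain[OF E_subring] .
  interpret ev: ring_hom_ring "E[X]" R "\<lambda>p. eval p x" using eval_ring_hom[OF E_subring x] .
  interpret ev': ring_hom_cring "E[X]" R "\<lambda>p. eval p x" using eval_cring_hom[OF E_subring x] .
  note var = var_closed(1)[OF E_subring]
  have "eval V x = (\<Otimes>i\<in>{1..<d}. eval (X [^]\<^bsub>E[X]\<^esub> (q ^ i) \<oplus>\<^bsub>E[X]\<^esub> poly_of_const (a \<ominus> a [^] (q ^ i))) x)"
    unfolding V_def using var poly_of_const_E(1)[OF V_summand] by (subst ev'.hom_finprod) (auto simp: o_def)
  also have "\<dots> = (\<Otimes>i\<in>{1..<d}. x [^] (q ^ i) \<oplus> (a \<ominus> a [^] (q ^ i)))"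
    using var poly_of_const_E[OF V_summand] x a
    by (intro finprod_cong') (auto simp: ev.hom_nat_pow eval_var)
  finally show ?thesis .
qed

lemma eval_V_0: "eval V \<zero> \<noteq> \<zero>"
proof -
  have "a \<ominus> a [^] (q ^ i) \<noteq> \<zero>" if "i \<in> {1..<d}" for i
    using a_primitive[of i] that a by auto
  then show ?thesis
    unfolding eval_V[OF zero_closed] using a q_ge2
    by (intro finprod_nonzero) (auto simp: nat_pow_zero)
qed

lemma eval_XV:
  assumes z: "z \<in> carrier R"
  shows "eval (X \<otimes>\<^bsub>E[X]\<^esub> V) z = (\<Otimes>i\<in>{..<d}. z [^] (q ^ i) \<oplus> (a \<ominus> a [^] (q ^ i)))"
proof -
  interpret ev: ring_hom_ring "E[X]" R "\<lambda>p. eval p z" using eval_ring_hom[OF E_subring z] .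
  have "eval (X \<otimes>\<^bsub>E[X]\<^esub> V) z = z \<otimes> eval V z"
    using var_closed(1)[OF E_subring] V_closed by (simp add: eval_var[OF z])
  also have "\<dots> = (z [^] (q ^ 0) \<oplus> (a \<ominus> a [^] (q ^ 0))) \<otimes> eval V z"
    using a z by (simp add: r_neg a_minus_def)
  also have "\<dots> = (\<Otimes>i\<in>insert 0 {1..<d}. z [^] (q ^ i) \<oplus> (a \<ominus> a [^] (q ^ i)))"
    unfolding eval_V[OF z] using a z by (subst finprod_insert) auto
  also have "insert 0 {1..<d} = {..<d}" using dpos by auto
  finally show ?thesis .
qed

text \<open>There are \<open>r = q ^ d - 1\<close> fibres over nonzero values, each with at most
  \<open>B\<close> points and together with at least \<open>l ^ 2 - D\<close>. Since
  \<open>r * h = l - 1\<close>, the terms in \<open>l ^ 2\<close> cancel in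
  \<open>r * B - (l ^ 2 - D)\<close>, and the rest is of order \<open>l\<close>, the square root of
  the number of points.\<close>

lemma S_even_bound:
  assumes s: "s > D + 3"
  shows "cmod (S (2 * d * s)) \<le> real ((q ^ d - 1) * (2 * D + 3) + D) * real (q ^ (d * s))"
proof -
  define m where "m = d * (2 * s)"
  have m: "m > 0" unfolding m_def using dpos s by simp
  define r where "r = q ^ d - 1"
  have qd: "q ^ d \<ge> 2" using q_ge2 self_le_power[of q d] dpos by linarith
  then have r: "r \<ge> 1" "q ^ d = Suc r" unfolding r_def by auto
  \<comment> \<open>This is \<open>(l - 1) / (q ^ d - 1)\<close>. The sum with twice as many terms
    is \<open>h * (l + 1)\<close>, the exponent of the norm from the field of \<open>l ^ 2\<close>
    elements to \<open>E\<close>.\<close>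
  define h where "h = (\<Sum>t<s. (q ^ d) ^ t)"
  define l where "l = q ^ (d * s)"
  have l: "l = r * h + 1" unfolding l_def h_def power_mult r(2) geometric_nat ..
  have hs: "h \<ge> s"
  proof -
    have "(\<Sum>t<s. 1) \<le> h" unfolding h_def using qd by (intro sum_mono) simp
    then show ?thesis by simp
  qed
  have Q: "q ^ m = l ^ 2" unfolding m_def l_def by (simp add: power_mult[symmetric] mult_ac)
  have hl: "(\<Sum>t<2 * s. (q ^ d) ^ t) = h * (l + 1)"
  proof -
    have "r * (\<Sum>t<2 * s. (q ^ d) ^ t) + 1 = l ^ 2"
      unfolding r(2) geometric_nat Q[symmetric] m_def by (simp add: power_mult r(2))
    also have "\<dots> = r * (h * (l + 1)) + 1" unfolding l by (simp add: power2_eq_square algebra_simps)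
    finally show ?thesis using r(1) by simp
  qed
  define M where "M = F m"
  have M: "subfield M R" "finite M" "card M = l ^ 2"
    using fixed_subfield[of m] card_fixed[OF m] unfolding M_def F_def Q by auto
  have sM: "subring M R" using subfieldE(1)[OF M(1)] .
  have MR: "z \<in> carrier R" if "z \<in> M" for z using that unfolding M_def F_def by simp
  have Eb: "x [^] (q ^ (d * b)) = x" if "x \<in> E" for x b
  proof (induction b)
    case (Suc b)
    then show ?case using frob_frob[OF E_carrier[OF that], of "d * b" d] that by (simp add: E_def add.commute)
  qed (use E_carrier[OF that] in simp)
  have EM: "E \<subseteq> M" unfolding M_def F_def m_def using Eb E_carrier by auto
  have VM: "V \<in> carrier (M[X])"
    using V_closed EM unfolding univ_poly_carrier[symmetric] polynomial_def by auto
  define H where "H = X \<otimes>\<^bsub>E[X]\<^esub> V"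
  have HM: "H = X \<otimes>\<^bsub>M[X]\<^esub> V" unfolding H_def univ_poly_mult ..
  define Z where "Z z = eval H z [^] (h * (l + 1))" for z
  have lp: "l = p ^ (k * (d * s))" unfolding l_def q_pow_eq ..
  define B where "B = l * (h + 2 * D + 3)"
  have step: "card {z \<in> M. Z z = \<zeta>} \<le> B" if "\<zeta> \<in> E" "\<zeta> \<noteq> \<zero>" for \<zeta>
    unfolding B_def Z_def HM
    by (rule bombieri_stepanov[OF M(1,3) p add_pow_p_one lp l r(1) VM eval_V_0 D_def]) (use s hs that EM in auto)
  have HME: "H \<in> carrier (M[X])" unfolding HM
  proof -
    interpret U: domain "M[X]" using univ_poly_is_domain[OF sM] .
    show "X \<otimes>\<^bsub>M[X]\<^esub> V \<in> carrier (M[X])" using var_closed(1)[OF sM] VM by simp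
  qed
  have Vne: "V \<noteq> []" using eval_V_0 by auto
  have degH: "degree H = D"
    using poly_mult_degree_eq[OF sM, of X V] var_closed(2)[OF sM] VM Vne
    unfolding HM univ_poly_mult D_def univ_poly_carrier by (simp add: var_def)
  have Hne: "H \<noteq> []" using degH unfolding D_def by auto
  have evM: "eval H z \<in> M" if "z \<in> M" for z
  proof -
    have "set H \<subseteq> M" using HME unfolding univ_poly_carrier[symmetric] polynomial_def by auto
    then show ?thesis
      using ring.eval_in_carrier[OF subring_is_ring[OF sM], of H z] that eval_consistent[OF sM] by simp
  qed
  have ZE: "Z z \<in> E" if z: "z \<in> M" for z
  proof -
    define w where "w = eval H z"
    have w: "w \<in> carrier R" "w [^] (l ^ 2) = w"
      using evM[OF z] unfolding w_def M_def F_def Q by auto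
    have h0: "h * (l + 1) \<ge> 1" using hs s by simp
    \<comment> \<open>Raising to the power \<open>q ^ d\<close> increases the exponent by
      \<open>r * h * (l + 1) = l ^ 2 - 1\<close>, so the norm is fixed. Splitting off
      \<open>l ^ 2\<close> rather than \<open>l ^ 2 - 1\<close> also covers
      \<open>w = 0\<close>.\<close>
    have "h * (l + 1) * q ^ d = (h * (l + 1) - 1) + l ^ 2"
    proof -
      have "h * (l + 1) * q ^ d = h * (l + 1) + r * h * (l + 1)" unfolding r(2) by (simp add: algebra_simps)
      also have "r * h * (l + 1) = l ^ 2 - 1" unfolding l by (simp add: power2_eq_square algebra_simps)
      finally show ?thesis using h0 l by (simp add: power2_eq_square)
    qed
    then have "(w [^] (h * (l + 1))) [^] (q ^ d) = w [^] (h * (l + 1) - 1) \<otimes> w [^] (l ^ 2)"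
      using w(1) by (simp only: nat_pow_pow nat_pow_mult)
    also have "\<dots> = w [^] Suc (h * (l + 1) - 1)" using w by simp
    also have "Suc (h * (l + 1) - 1) = h * (l + 1)" using h0 by linarith
    finally show ?thesis unfolding Z_def E_def w_def[symmetric] using w(1) by simp
  qed
  have "S (2 * d * s) = (\<Sum>y\<in>M. \<chi> (\<Otimes>i\<in>{..<m}. a \<ominus> y [^] (q ^ i)))"
    using S_eq_sum[OF m] unfolding M_def m_def by (simp add: mult_ac)
  \<comment> \<open>The substitution \<open>y = a - z\<close> moves the zero \<open>a\<close> of the
    product to 0, where the orders of vanishing are compared.\<close>
  also have "\<dots> = (\<Sum>z\<in>M. \<chi> (\<Otimes>i\<in>{..<m}. a \<ominus> (a \<ominus> z) [^] (q ^ i)))"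
  proof -
    have aM: "a \<in> M" using a_in_E EM by auto
    have inj: "inj_on (\<lambda>z. a \<ominus> z) M"
    proof (rule inj_onI)
      fix x y assume "x \<in> M" "y \<in> M" "a \<ominus> x = a \<ominus> y"
      then show "x = y" using a MR by (metis a_minus_def a_inv_closed add.l_cancel minus_minus)
    qed
    have "a \<ominus> z \<in> M" if "z \<in> M" for z
      using aM that subringE(5,7)[OF sM] unfolding a_minus_def by auto
    then have "(\<lambda>z. a \<ominus> z) ` M = M"
      using inj M(2) by (intro endo_inj_surj) auto
    then show ?thesis
      using sum.reindex[OF inj, of "\<lambda>y. \<chi> (\<Otimes>i\<in>{..<m}. a \<ominus> y [^] (q ^ i))"] by (simp add: o_def)
  qed
  also have "\<dots> = (\<Sum>z\<in>M. \<chi> (Z z))"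
  proof (intro sum.cong refl)
    fix z assume "z \<in> M"
    then have z: "z \<in> carrier R" using MR by simp
    define u where "u i = z [^] (q ^ i) \<oplus> (a \<ominus> a [^] (q ^ i))" for i
    have uc: "u i \<in> carrier R" for i unfolding u_def using a z by simp
    have "a \<ominus> (a \<ominus> z) [^] (q ^ i) = u i" for i
    proof -
      have "A \<ominus> (B \<ominus> C) = C \<oplus> (A \<ominus> B)" if "A \<in> carrier R" "B \<in> carrier R" "C \<in> carrier R" for A B C
        using that by (simp add: a_minus_def minus_add a_ac)
      then show ?thesis unfolding u_def frob_minus[OF a z] using a z by simp
    qed
    then have "(\<Otimes>i\<in>{..<m}. a \<ominus> (a \<ominus> z) [^] (q ^ i)) = (\<Otimes>i\<in>{..<d * (2 * s)}. u i)" unfolding m_def by simp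
    also have "\<dots> = (\<Otimes>i\<in>{..<d}. u i) [^] (\<Sum>t<2 * s. (q ^ d) ^ t)"
    proof (rule finprod_twisted_blocks[OF uc])
      fix i
      have "u i [^] (q ^ d) = (z [^] (q ^ i)) [^] (q ^ d) \<oplus> (a [^] (q ^ d) \<ominus> (a [^] (q ^ i)) [^] (q ^ d))"
        unfolding u_def using a z by (simp add: frob_add frob_minus)
      also have "\<dots> = u (i + d)" unfolding u_def frob_frob[OF a] frob_frob[OF z] a_period ..
      finally show "u (i + d) = u i [^] (q ^ d)" ..
    qed
    also have "\<dots> = Z z" unfolding Z_def hl H_def eval_XV[OF z] u_def ..
    finally show "\<chi> (\<Otimes>i\<in>{..<m}. a \<ominus> (a \<ominus> z) [^] (q ^ i)) = \<chi> (Z z)" by simp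
  qed
  also have "\<dots> = (\<Sum>\<zeta>\<in>E. \<Sum>z\<in>{z \<in> M. Z z = \<zeta>}. \<chi> (Z z))"
    by (rule sum.group[symmetric, OF M(2) card_E(1)]) (use ZE in auto)
  also have "\<dots> = (\<Sum>\<zeta>\<in>E. of_nat (card {z \<in> M. Z z = \<zeta>}) * \<chi> \<zeta>)"
    by (intro sum.cong refl) simp
  also have "\<dots> = (\<Sum>\<zeta>\<in>E. (of_nat (card {z \<in> M. Z z = \<zeta>}) - of_nat B) * \<chi> \<zeta>)"
    by (simp add: left_diff_distrib sum_subtractf sum_distrib_left[symmetric] sum_chi)
  also have "\<dots> = (\<Sum>\<zeta>\<in>E - {\<zero>}. (of_nat (card {z \<in> M. Z z = \<zeta>}) - of_nat B) * \<chi> \<zeta>)"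
    by (rule sum.mono_neutral_right) (use card_E(1) chi0 in auto)
  finally have SE: "S (2 * d * s) = (\<Sum>\<zeta>\<in>E - {\<zero>}. (of_nat (card {z \<in> M. Z z = \<zeta>}) - of_nat B) * \<chi> \<zeta>)" .
  have "cmod (S (2 * d * s)) \<le> (\<Sum>\<zeta>\<in>E - {\<zero>}. real B - real (card {z \<in> M. Z z = \<zeta>}))"
    unfolding SE
  proof (rule sum_norm_le)
    fix \<zeta> assume \<zeta>: "\<zeta> \<in> E - {\<zero>}"
    have "cmod (of_nat (card {z \<in> M. Z z = \<zeta>}) - of_nat B) = \<bar>real (card {z \<in> M. Z z = \<zeta>}) - real B\<bar>"
      by (metis norm_of_real of_real_diff of_real_of_nat_eq)
    also have "\<dots> = real B - real (card {z \<in> M. Z z = \<zeta>})" using step[of \<zeta>] \<zeta> by simp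
    finally show "cmod ((of_nat (card {z \<in> M. Z z = \<zeta>}) - of_nat B) * \<chi> \<zeta>) \<le> real B - real (card {z \<in> M. Z z = \<zeta>})"
      using chi_norm[of \<zeta>] \<zeta> step[of \<zeta>] unfolding norm_mult E_def by (simp add: mult_left_le)
  qed
  also have "\<dots> = real r * real B - real (\<Sum>\<zeta>\<in>E - {\<zero>}. card {z \<in> M. Z z = \<zeta>})"
    using card_E E_props(1) r by (simp add: sum_subtractf)
  finally have upper: "cmod (S (2 * d * s)) \<le> real r * real B - real (\<Sum>\<zeta>\<in>E - {\<zero>}. card {z \<in> M. Z z = \<zeta>})" .
  have "real (\<Sum>\<zeta>\<in>E - {\<zero>}. card {z \<in> M. Z z = \<zeta>}) \<ge> real (l ^ 2) - real D"
  proof -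
    have "card M = (\<Sum>\<zeta>\<in>E. card {z \<in> M. Z z = \<zeta>})"
    proof -
      have "(\<Sum>\<zeta>\<in>E. \<Sum>z\<in>{z \<in> M. Z z = \<zeta>}. 1 :: nat) = (\<Sum>z\<in>M. 1)"
        by (rule sum.group[OF M(2) card_E(1)]) (use ZE in auto)
      then show ?thesis by simp
    qed
    also have "\<dots> = card {z \<in> M. Z z = \<zero>} + (\<Sum>\<zeta>\<in>E - {\<zero>}. card {z \<in> M. Z z = \<zeta>})"
      using E_props(1) card_E(1) by (simp add: sum.remove)
    finally have "l ^ 2 = card {z \<in> M. Z z = \<zero>} + (\<Sum>\<zeta>\<in>E - {\<zero>}. card {z \<in> M. Z z = \<zeta>})"
      using M(3) by simp
    moreover have "card {z \<in> M. Z z = \<zero>} \<le> D"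
      unfolding degH[symmetric]
    proof (rule card_zeros_le_degree(2)[OF carrier_polynomial_shell[OF sM HME] Hne])
      fix z assume z: "z \<in> {z \<in> M. Z z = \<zero>}"
      have "eval H z \<in> carrier R" using evM MR z by auto
      then show "eval H z = \<zero>" using z nat_pow_nonzero unfolding Z_def by blast
    qed (use MR in auto)
    ultimately have "l ^ 2 \<le> D + (\<Sum>\<zeta>\<in>E - {\<zero>}. card {z \<in> M. Z z = \<zeta>})" by simp
    then have "real (l ^ 2) \<le> real (D + (\<Sum>\<zeta>\<in>E - {\<zero>}. card {z \<in> M. Z z = \<zeta>}))" by (simp only: of_nat_le_iff)
    then show ?thesis by simp
  qed
  with upper have "cmod (S (2 * d * s)) \<le> real r * real B - (real (l ^ 2) - real D)" by linarith
  also have "\<dots> \<le> real (r * (2 * D + 3) + D) * real l"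
  proof -
    have l1: "real l = real r * real h + 1" using l by simp
    have "real r * real B = real l * (real r * real h) + real (r * (2 * D + 3)) * real l"
      unfolding B_def by (simp add: algebra_simps)
    also have "real r * real h = real l - 1" using l1 by simp
    finally have "real r * real B - (real (l ^ 2) - real D) = real (r * (2 * D + 3)) * real l - real l + real D"
      by (simp add: power2_eq_square algebra_simps)
    also have "\<dots> \<le> real (r * (2 * D + 3)) * real l + real D * real l"
    proof -
      have "real D * 1 \<le> real D * real l" using l by (intro mult_left_mono) auto
      then show ?thesis by simp
    qed
    finally show ?thesis by (simp add: algebra_simps)
  qed
  finally show ?thesis unfolding r_def l_def .
qed

text \<open>Taken with \<open>B = sqrt q\<close> and \<open>e = 2 * d\<close>, because
  \<open>sqrt q ^ (2 * d * s)\<close> is \<open>q ^ (d * s)\<close>. The constant in the bound for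
  the power sums does not depend on \<open>s\<close>.\<close>

lemma katz_bound: "cmod (\<Sum>b\<in>K. \<chi> (a \<oplus> b)) \<le> (real d - 1) * sqrt (real q)"
proof -
  have "cmod (c 1) \<le> (real d - 1) * sqrt (real q)"
  proof (rule newton_first_coeff_bound[OF c_0 c_eq_0 newton_identity])
    show "cmod (S (2 * d * s)) \<le> real ((q ^ d - 1) * (2 * D + 3) + D) * sqrt (real q) ^ (2 * d * s)"
      if "s \<ge> D + 4" for s
    proof -
      have "sqrt (real q) ^ (2 * d * s) = real (q ^ (d * s))"
        by (simp add: power_mult mult.assoc)
      then show ?thesis using S_even_bound[of s] that by simp
    qed
  qed (use q_ge2 dpos in auto)
  then show ?thesis using c_1 by simp
qed

end

section \<open>Affine spaces in a finite field\<close>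

lemma (in cring) add_minus_add_cancel:
  "a \<in> carrier R \<Longrightarrow> b \<in> carrier R \<Longrightarrow> c \<in> carrier R \<Longrightarrow> (a \<oplus> b) \<ominus> (a \<oplus> c) = b \<ominus> c"
  by algebra

locale finite_extension_field = finite_base +
  fixes n :: nat
  assumes order: "order R = q ^ n" and npos: "n > 0"
begin

section \<open>Degrees and fixed fields in the given finite field\<close>

lemma finite_carrier: "finite (carrier R)"
  using order q_ge2 card.infinite unfolding order_def by fastforce

lemma frob_n: "x \<in> carrier R \<Longrightarrow> x [^] (q ^ n) = x"
  using subfield_pow_card[OF carrier_is_subfield finite_carrier] order unfolding order_def by simp

lemma algebraic_K: "x \<in> carrier R \<Longrightarrow> (algebraic over K) x"
proof -
  assume x: "x \<in> carrier R"
  have "q ^ n \<ge> 2" using q_ge2 self_le_power[of q n] npos by linarith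
  note f = pow_minus_var[OF K_subring this]
  show ?thesis using algebraicI[OF f(1,3)] f(4)[OF x] frob_n[OF x] x by (simp add: r_neg)
qed

abbreviation Fix :: "nat \<Rightarrow> 'a set" where "Fix d \<equiv> {x \<in> carrier R. x [^] (q ^ d) = x}"

abbreviation dg :: "'a \<Rightarrow> nat" where "dg x \<equiv> degree_over R K x"

lemma deg_dvd_iff: "x \<in> carrier R \<Longrightarrow> x [^] (q ^ m) = x \<longleftrightarrow> dg x dvd m"
  using frob_fixed_iff[OF _ algebraic_K refl] unfolding degree_over_def by blast

lemma deg_dvd: "x \<in> carrier R \<Longrightarrow> dg x dvd n"
  using deg_dvd_iff frob_n by blast

lemma deg_pos: "x \<in> carrier R \<Longrightarrow> dg x > 0"
  using deg_dvd npos dvd_pos_nat by blast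

lemma card_Fix_le:
  assumes "m > 0"
  shows "card (Fix m) \<le> q ^ m"
proof -
  have "q ^ m \<ge> 2" using q_ge2 self_le_power[of q m] assms by linarith
  note f = pow_minus_var[OF carrier_is_subring this]
  show ?thesis using card_zeros_le_degree(2)[OF f(1,3), of "Fix m"] f(2,4) by (simp add: r_neg)
qed

text \<open>\<open>K(x)\<close> consists of fixed points and has \<open>q ^ dg x\<close> elements,
  the largest number possible.\<close>

lemma card_Fix_deg:
  assumes x: "x \<in> carrier R"
  shows "card (Fix (dg x)) = q ^ dg x"
proof (rule antisym[OF card_Fix_le[OF deg_pos[OF x]]])
  note y = x algebraic_K[OF x]
  have "x \<in> Fix (dg x)" using deg_dvd_iff[OF x, of "dg x"] x by simp
  then have "simple_extension K x \<subseteq> Fix (dg x)"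
    using simple_extension_subring_incl[OF subfieldE(1)[OF fixed_subfield], of K "dg x" x] frob_K K_carrier by auto
  then have "card (simple_extension K x) \<le> card (Fix (dg x))"
    using finite_carrier by (intro card_mono) auto
  then show "q ^ dg x \<le> card (Fix (dg x))"
    using card_simple_extension(1)[OF y refl] unfolding degree_over_def by simp
qed

text \<open>The elements of any subfield with \<open>q ^ m\<close> elements are fixed points, so
  counting leaves only \<open>Fix m\<close>. The assumption on its size provides existence, without
  which the description would be unspecified.\<close>

lemma subfield_of_order_eq:
  assumes m: "m > 0" "card (Fix m) = q ^ m"
  shows "subfield_of_order R (q ^ m) = Fix m"
  unfolding subfield_of_order_def
proof (rule the_equality)
  show "subfield (Fix m) R \<and> card (Fix m) = q ^ m" using fixed_subfield m by simp
  fix L assume L: "subfield L R \<and> card L = q ^ m"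
  have LR: "L \<subseteq> carrier R" using subfieldE(3) L by blast
  have "L \<subseteq> Fix m"
  proof
    fix x assume x: "x \<in> L"
    show "x \<in> Fix m"
      using subfield_pow_card[OF _ finite_subset[OF LR finite_carrier] x] L subsetD[OF LR x] by auto
  qed
  then show "L = Fix m" using L m finite_carrier by (intro card_subset_eq) auto
qed

text \<open>Both branches of \<open>delta\<close> rest on the trivial bound \<open>q\<close>. In the
  nontrivial one the field is embedded by \<open>\<phi>\<close> in an algebraic closure, where
  Katz's bound applies to the character composed with the inverse of \<open>\<phi>\<close>.\<close>

lemma character_sum_bound:
  assumes chi: "multiplicative_character R \<chi>" and x: "x \<in> carrier R"
  shows "cmod (\<Sum>b\<in>K. \<chi> (x \<oplus> b)) \<le> delta R q \<chi> (dg x)"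
proof -
  define d where "d = dg x"
  have d: "d > 0" unfolding d_def using deg_pos[OF x] .
  have cF: "card (Fix d) = q ^ d" unfolding d_def using card_Fix_deg[OF x] .
  have chi0: "\<chi> \<zero> = 0" using chi by (simp add: multiplicative_character_def)
  have chi_nz: "cmod (\<chi> y) = 1" if "y \<in> carrier R" "y \<noteq> \<zero>" for y
    using chi that unfolding multiplicative_character_def unit_circle_def hom_def by auto
  have norm: "cmod (\<chi> y) \<le> 1" if "y \<in> carrier R" for y
    using chi_nz[OF that] chi0 by (cases "y = \<zero>") auto
  have mult: "\<chi> (y \<otimes> z) = \<chi> y * \<chi> z" if "y \<in> carrier R" "z \<in> carrier R" for y z
  proof (cases "y = \<zero> \<or> z = \<zero>")
    case False
    then show ?thesis using chi that unfolding multiplicative_character_def unit_circle_def hom_def by auto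
  qed (use that chi0 in auto)
  have "\<chi> \<one> * \<chi> \<one> = \<chi> \<one>" "\<chi> \<one> \<noteq> 0" using mult[of \<one> \<one>] chi_nz[of \<one>] by auto
  then have chi1: "\<chi> \<one> = 1" by simp
  have triv: "cmod (\<Sum>b\<in>K. \<chi> (x \<oplus> b)) \<le> real q"
  proof -
    have "cmod (\<Sum>b\<in>K. \<chi> (x \<oplus> b)) \<le> (\<Sum>b\<in>K. 1)"
      using norm x K_carrier by (intro sum_norm_le) auto
    then show ?thesis using card_K by simp
  qed
  show ?thesis
  proof (cases "trivial_on R \<chi> (subfield_of_order R (q ^ d))")
    case True
    then show ?thesis using triv unfolding delta_def d_def[symmetric] by simp
  next
    case False
    then obtain y where y: "y \<in> Fix d" "y \<noteq> \<zero>" "\<chi> y \<noteq> 1"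
      unfolding trivial_on_def subfield_of_order_eq[OF d cF] by auto
    define L where "L = alg_closure"
    define \<phi> where "\<phi> = (indexed_const :: 'a \<Rightarrow> ('a list \<times> nat) multiset \<Rightarrow> 'a)"
    interpret L: algebraic_closure L "\<phi> ` carrier R"
      using alg_closureE(1) unfolding L_def \<phi>_def .
    have hom: "\<phi> \<in> ring_hom R L" using alg_closureE(2) unfolding L_def \<phi>_def .
    interpret h: ring_hom_ring R L \<phi>
      using ring_hom_ringI2[OF ring_axioms L.ring_axioms hom] .
    have inj: "inj_on \<phi> (carrier R)" unfolding \<phi>_def using indexed_const_inj_on .
    have img: "subfield (\<phi> ` K) L" using h.img_is_subfield(2)[OF K] L.one_not_zero by blast
    have cardim: "card (\<phi> ` K) = q"
      using card_image[OF inj_on_subset[OF inj subsetI[OF K_carrier]]] card_K by simp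
    interpret B: closed_finite_base L "\<phi> ` K" p k q
      by (intro closed_finite_base.intro finite_base.intro finite_base_axioms.intro
          L.field_axioms L.algebraically_closed_axioms img p kpos q cardim)
    \<comment> \<open>Outside the image of \<open>\<phi>\<close> the values of \<open>\<psi>\<close>
      are arbitrary; the assumptions on the character concern only the fixed field of the
      \<open>d\<close>-th Frobenius power.\<close>
    define \<psi> where "\<psi> = inv_into (carrier R) \<phi>"
    have \<psi>: "\<psi> (\<phi> z) = z" if "z \<in> carrier R" for z unfolding \<psi>_def using inv_into_f_f[OF inj that] .
    have pw: "\<phi> z [^]\<^bsub>L\<^esub> (j::nat) = \<phi> (z [^] j)" if "z \<in> carrier R" for z j
      using h.hom_nat_pow[OF that] by simp
    \<comment> \<open>The image of \<open>Fix d\<close> already has \<open>q ^ d\<close> elements,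
      so the closure contributes no further fixed points and \<open>\<psi>\<close> is a true inverse
      on all of them.\<close>
    have FixL: "{z \<in> carrier L. z [^]\<^bsub>L\<^esub> (q ^ d) = z} = \<phi> ` Fix d"
    proof -
      have "\<phi> ` Fix d \<subseteq> {z \<in> carrier L. z [^]\<^bsub>L\<^esub> (q ^ d) = z}"
        using pw by auto
      moreover have "card (\<phi> ` Fix d) = q ^ d"
        using card_image[OF inj_on_subset[OF inj]] cF by simp
      ultimately show ?thesis using B.card_fixed[OF d] by (intro card_subset_eq[symmetric]) auto
    qed
    have inL: "\<exists>w\<in>Fix d. z = \<phi> w" if "z \<in> carrier L" "z [^]\<^bsub>L\<^esub> (q ^ d) = z" for z
      using FixL that by blast
    have xd: "x [^] (q ^ d) = x" using deg_dvd_iff[OF x] unfolding d_def by simp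
    interpret S: katz_setup L "\<phi> ` K" p k q "\<phi> x" d "\<lambda>z. \<chi> (\<psi> z)"
    proof (intro katz_setup.intro katz_setup_axioms.intro)
      show "closed_finite_base L (\<phi> ` K) p k q" by (rule B.closed_finite_base_axioms)
      show "\<phi> x \<in> carrier L" using x by simp
      show "\<phi> x [^]\<^bsub>L\<^esub> (q ^ d) = \<phi> x" using pw[OF x] xd by simp
      show "\<phi> x [^]\<^bsub>L\<^esub> (q ^ i) \<noteq> \<phi> x" if i: "0 < i" "i < d" for i
      proof
        assume "\<phi> x [^]\<^bsub>L\<^esub> (q ^ i) = \<phi> x"
        then have "x [^] (q ^ i) = x" using pw[OF x] inj x by (simp add: inj_on_eq_iff)
        then have "d dvd i" using deg_dvd_iff[OF x] unfolding d_def by blast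
        then show False using i by (simp add: nat_dvd_not_less)
      qed
      show "\<chi> (\<psi> \<zero>\<^bsub>L\<^esub>) = 0" using \<psi>[OF zero_closed] chi0 by simp
      show "\<chi> (\<psi> \<one>\<^bsub>L\<^esub>) = 1" using \<psi>[OF one_closed] chi1 by simp
      show "\<chi> (\<psi> (z \<otimes>\<^bsub>L\<^esub> w)) = \<chi> (\<psi> z) * \<chi> (\<psi> w)"
        if zw: "z \<in> carrier L" "z [^]\<^bsub>L\<^esub> (q ^ d) = z" "w \<in> carrier L" "w [^]\<^bsub>L\<^esub> (q ^ d) = w" for z w
      proof -
        obtain z' w' where "z' \<in> carrier R" "w' \<in> carrier R" "z = \<phi> z'" "w = \<phi> w'"
          using inL[OF zw(1,2)] inL[OF zw(3,4)] by blast
        then show ?thesis using \<psi> mult by (simp flip: h.hom_mult)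
      qed
      show "cmod (\<chi> (\<psi> z)) \<le> 1" if z: "z \<in> carrier L" "z [^]\<^bsub>L\<^esub> (q ^ d) = z" for z
        using inL[OF z] \<psi> norm by auto
      show "\<exists>z\<in>carrier L. z [^]\<^bsub>L\<^esub> (q ^ d) = z \<and> z \<noteq> \<zero>\<^bsub>L\<^esub> \<and> \<chi> (\<psi> z) \<noteq> 1"
      proof (rule bexI[of _ "\<phi> y"])
        have "\<phi> y \<noteq> \<zero>\<^bsub>L\<^esub>" using inj_onD[OF inj, of y \<zero>] y by auto
        then show "\<phi> y [^]\<^bsub>L\<^esub> (q ^ d) = \<phi> y \<and> \<phi> y \<noteq> \<zero>\<^bsub>L\<^esub> \<and> \<chi> (\<psi> (\<phi> y)) \<noteq> 1"
          using y pw[of y] \<psi>[of y] by auto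
      qed (use y in auto)
    qed (rule d)
    have "(\<Sum>b\<in>\<phi> ` K. \<chi> (\<psi> (\<phi> x \<oplus>\<^bsub>L\<^esub> b))) = (\<Sum>b\<in>K. \<chi> (\<psi> (\<phi> x \<oplus>\<^bsub>L\<^esub> \<phi> b)))"
      by (subst sum.reindex[OF inj_on_subset[OF inj subsetI[OF K_carrier]]]) (simp_all add: o_def)
    also have "\<dots> = (\<Sum>b\<in>K. \<chi> (x \<oplus> b))"
      using \<psi> x K_carrier by (intro sum.cong refl) (simp flip: h.hom_add)
    finally have "cmod (\<Sum>b\<in>K. \<chi> (x \<oplus> b)) \<le> (real d - 1) * sqrt (real q)"
      using S.katz_bound by simp
    then show ?thesis using triv False unfolding delta_def d_def[symmetric] by simp
  qed
qed

text \<open>Differences of elements of degree \<open>d\<close> lie in \<open>W\<close>, the part of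
  \<open>V\<close> inside \<open>Fix d\<close>. The difference \<open>v\<close> of \<open>z\<close>
  and one such element lies in \<open>V\<close> but not in \<open>Fix d\<close>, so the line through
  \<open>v\<close> and \<open>W\<close> form a direct sum inside \<open>V\<close>, which leaves
  \<open>W\<close> at most one \<open>q\<close>-th of the elements of \<open>V\<close>.\<close>

lemma card_affine_inter_Fix:
  assumes V: "subalgebra K V R" "card V = q ^ t" and t: "t \<ge> 1" and u: "u \<in> carrier R"
    and z: "z \<in> u <+\<^bsub>R\<^esub> V" "dg z = n" and d: "d > 0" "d < n"
  shows "card {x \<in> u <+\<^bsub>R\<^esub> V. dg x = d} \<le> q ^ (t - 1)"
proof -
  interpret V: subalgebra K V R by fact
  let ?A = "u <+\<^bsub>R\<^esub> V"
  have VR: "V \<subseteq> carrier R" using subalgebra_in_carrier[OF V(1)] .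
  have A: "?A = (\<lambda>v. u \<oplus> v) ` V" unfolding a_l_coset_def l_coset_def by auto
  have AR: "?A \<subseteq> carrier R" unfolding A using VR u by auto
  have Vadd: "x \<oplus> y \<in> V" if "x \<in> V" "y \<in> V" for x y using V.m_closed that by simp
  have Vinv: "\<ominus> x \<in> V" if "x \<in> V" for x using V.m_inv_closed that by (simp add: a_inv_def)
  have diff: "x \<ominus> y \<in> V" if xy: "x \<in> ?A" "y \<in> ?A" for x y
  proof -
    obtain v w where vw: "v \<in> V" "w \<in> V" "x = u \<oplus> v" "y = u \<oplus> w" using xy unfolding A by auto
    have "v \<in> carrier R" "w \<in> carrier R" using vw VR by auto
    then have "x \<ominus> y = v \<oplus> \<ominus> w"
      unfolding vw(3,4) a_minus_def[symmetric] using add_minus_add_cancel[OF u] by simp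
    then show ?thesis using Vadd Vinv vw by simp
  qed
  have FixF: "subfield (Fix d) R" by (rule fixed_subfield)
  note FS = subringE[OF subfieldE(1)[OF FixF]]
  let ?S = "{x \<in> ?A. dg x = d}"
  have SF: "?S \<subseteq> Fix d" using AR deg_dvd_iff by auto
  show ?thesis
  proof (cases "?S = {}")
    case False
    then obtain w0 where w0: "w0 \<in> ?S" by blast
    define W where "W = V \<inter> Fix d"
    have finV: "finite V" using finite_subset[OF VR finite_carrier] .
    have "inj_on (\<lambda>x. x \<ominus> w0) ?S"
    proof (rule inj_onI)
      fix x y assume "x \<in> ?S" "y \<in> ?S" "x \<ominus> w0 = y \<ominus> w0"
      then show "x = y" using AR w0 by (auto simp: a_minus_def subset_iff)
    qed
    moreover have "(\<lambda>x. x \<ominus> w0) ` ?S \<subseteq> W"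
    proof
      fix v assume "v \<in> (\<lambda>x. x \<ominus> w0) ` ?S"
      then obtain x where x: "x \<in> ?S" "v = x \<ominus> w0" by blast
      have "x \<in> Fix d" "w0 \<in> Fix d" using SF x w0 by auto
      then have "x \<ominus> w0 \<in> Fix d" using FS(5,7) unfolding a_minus_def by blast
      then show "v \<in> W" using diff x w0 unfolding W_def by auto
    qed
    ultimately have SW: "card ?S \<le> card W" using finV unfolding W_def by (intro card_inj_on_le) auto
    define v where "v = z \<ominus> w0"
    have v: "v \<in> V" unfolding v_def using diff z(1) w0 by auto
    \<comment> \<open>Otherwise \<open>z\<close> itself would lie in \<open>Fix d\<close>, and its
      degree \<open>n\<close> would divide the smaller \<open>d\<close>.\<close>
    have vF: "v \<notin> Fix d"
    proof
      assume "v \<in> Fix d"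
      then have "v \<oplus> w0 \<in> Fix d" using FS(7) SF w0 by blast
      moreover have "v \<oplus> w0 = z" unfolding v_def using z AR w0 by (auto simp: a_minus_def a_assoc l_neg subset_iff)
      ultimately have "n dvd d" using deg_dvd_iff[of z d] z(2) by auto
      then show False using d by (simp add: nat_dvd_not_less)
    qed
    have vR: "v \<in> carrier R" using v VR by auto
    \<comment> \<open>The scalars lie in \<open>Fix d\<close> too, so a relation with
      \<open>c\<close> different from \<open>c'\<close> could be solved for \<open>v\<close> within
      \<open>Fix d\<close>.\<close>
    have "inj_on (\<lambda>(c, w). c \<otimes> v \<oplus> w) (K \<times> W)"
    proof (rule inj_onI, clarify)
      fix c w c' w' assume h: "c \<in> K" "w \<in> W" "c' \<in> K" "w' \<in> W" "c \<otimes> v \<oplus> w = c' \<otimes> v \<oplus> w'"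
      have cc: "c \<in> carrier R" "c' \<in> carrier R" "w \<in> carrier R" "w' \<in> carrier R"
        using h K_carrier unfolding W_def by auto
      have "c = c'"
      proof (rule ccontr)
        assume ne: "c \<noteq> c'"
        have "(c \<ominus> c') \<otimes> v = w' \<ominus> w"
        proof -
          have "(c \<ominus> c') \<otimes> v = (c \<otimes> v \<oplus> w) \<ominus> w \<ominus> c' \<otimes> v"
            using cc vR by algebra
          also have "\<dots> = w' \<ominus> w" unfolding h(5) using cc vR by algebra
          finally show ?thesis .
        qed
        moreover have "w' \<ominus> w \<in> Fix d" using h FS(5,7) unfolding W_def a_minus_def by blast
        ultimately have 1: "(c \<ominus> c') \<otimes> v \<in> Fix d" by simp
        have "c \<in> Fix d" "c' \<in> Fix d" using h frob_K K_carrier by auto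
        then have "c \<ominus> c' \<in> Fix d" using FS(5,7) unfolding a_minus_def by blast
        moreover have "c \<ominus> c' \<noteq> \<zero>" using ne cc by simp
        ultimately have inv: "inv (c \<ominus> c') \<in> Fix d" "c \<ominus> c' \<in> Units R"
          using subfield_m_inv(1)[OF FixF, of "c \<ominus> c'"] field_Units by auto
        have "v = inv (c \<ominus> c') \<otimes> ((c \<ominus> c') \<otimes> v)"
          using inv(2) vR cc by (simp add: m_assoc[symmetric])
        also have "\<dots> \<in> Fix d" using FS(6)[OF inv(1) 1] .
        finally show False using vF by simp
      qed
      then show "c = c' \<and> w = w'" using h(5) cc vR by simp
    qed
    moreover have "(\<lambda>(c, w). c \<otimes> v \<oplus> w) ` (K \<times> W) \<subseteq> V"
      using V.smult_closed v Vadd unfolding W_def by auto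
    ultimately have "card (K \<times> W) \<le> card V" using finV by (intro card_inj_on_le) auto
    then have "q * card W \<le> q ^ t" using V(2) card_K by (simp add: card_cartesian_product)
    also have "q ^ t = q * q ^ (t - 1)" using t by (cases t) auto
    finally have "card W \<le> q ^ (t - 1)" using q_ge2 by simp
    then show ?thesis using SW by linarith
  next
    case True
    then show ?thesis by (simp only: card.empty)
  qed
qed

text \<open>If \<open>sqrt q\<close> is at most \<open>n\<close>, every weight is at most
  \<open>q\<close>, hence at most \<open>n * sqrt q\<close>, with strict inequality at
  \<open>n\<close>. Otherwise each of the at most \<open>n - 1\<close> proper divisors contributes
  at most \<open>q ^ (t - 1) * q\<close>; together they stay below \<open>q ^ t * sqrt q\<close>,
  exactly the room that the bound \<open>(n - 1) * sqrt q\<close> for the weight at \<open>n\<close>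
  leaves.\<close>

lemma weighted_divisor_sum_less:
  fixes f :: "nat \<Rightarrow> nat" and \<delta> :: "nat \<Rightarrow> real"
  assumes fsum: "(\<Sum>d | d dvd n. f d) = q ^ t" and t: "t \<ge> 1"
    and fn: "f n > 0" and fd: "\<And>d. d dvd n \<Longrightarrow> d < n \<Longrightarrow> f d \<le> q ^ (t - 1)"
    and \<delta>: "\<And>d. \<delta> d \<le> real q" and \<delta>n: "\<delta> n \<le> (real n - 1) * sqrt (real q)"
  shows "(\<Sum>d | d dvd n. real (f d) * \<delta> d) < real n * real q powr (real t + 1 / 2)"
proof -
  let ?Dv = "{d. d dvd n}"
  have fin: "finite ?Dv" using npos by simp
  have qpos: "real q > 0" using q_ge2 by simp
  have pw: "real q powr (real t + 1 / 2) = real q ^ t * sqrt (real q)"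
    using qpos by (simp add: powr_add powr_realpow powr_half_sqrt)
  have sq: "sqrt (real q) * sqrt (real q) = real q" "sqrt (real q) > 0" using qpos by auto
  have fsum': "(\<Sum>d\<in>?Dv. real (f d)) = real q ^ t"
    using arg_cong[OF fsum, of real] by simp
  have \<delta>n': "real (f n) * \<delta> n \<le> real (f n) * ((real n - 1) * sqrt (real q))"
    using \<delta>n by (intro mult_left_mono) auto
  show ?thesis
  proof (cases "sqrt (real q) \<le> real n")
    case True
    have "real q \<le> real n * sqrt (real q)" using mult_right_mono[OF True, of "sqrt (real q)"] sq by simp
    then have le: "\<delta> d \<le> real n * sqrt (real q)" for d using \<delta>[of d] by linarith
    have lt: "\<delta> n < real n * sqrt (real q)" using \<delta>n sq(2) unfolding left_diff_distrib by linarith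
    have "(\<Sum>d\<in>?Dv. real (f d) * \<delta> d) < (\<Sum>d\<in>?Dv. real (f d) * (real n * sqrt (real q)))"
    proof (rule sum_strict_mono_ex1[OF fin])
      show "\<forall>d\<in>?Dv. real (f d) * \<delta> d \<le> real (f d) * (real n * sqrt (real q))"
        using le by (auto intro: mult_left_mono)
      show "\<exists>d\<in>?Dv. real (f d) * \<delta> d < real (f d) * (real n * sqrt (real q))"
        using lt fn by (intro bexI[of _ n]) auto
    qed
    also have "\<dots> = real n * real q powr (real t + 1 / 2)"
      unfolding sum_distrib_right[symmetric] fsum' pw by simp
    finally show ?thesis .
  next
    case False
    have rest: "(\<Sum>d\<in>?Dv - {n}. real (f d) * \<delta> d) \<le> (real n - 1) * real q ^ t"
    proof -
      have "(\<Sum>d\<in>?Dv - {n}. real (f d) * \<delta> d) \<le> (\<Sum>d\<in>?Dv - {n}. real q ^ t)"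
      proof (rule sum_mono)
        fix d assume d: "d \<in> ?Dv - {n}"
        then have "d < n" using npos dvd_imp_le by fastforce
        then have "real (f d) \<le> real q ^ (t - 1)" using fd[of d] d by (simp flip: of_nat_power)
        then have "real (f d) * \<delta> d \<le> real q ^ (t - 1) * real q"
          using \<delta>[of d] by (intro order.trans[OF mult_left_mono mult_right_mono]) auto
        also have "\<dots> = real q ^ t" using t by (cases t) auto
        finally show "real (f d) * \<delta> d \<le> real q ^ t" .
      qed
      also have "\<dots> = real (card (?Dv - {n})) * real q ^ t" by simp
      also have "\<dots> \<le> (real n - 1) * real q ^ t"
      proof (rule mult_right_mono)
        have "?Dv - {n} \<subseteq> {1..<n}"
        proof
          fix d assume "d \<in> ?Dv - {n}"
          then have "d dvd n" "d \<noteq> n" by auto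
          then have "d \<le> n" "d \<noteq> 0" using npos by (auto intro: dvd_imp_le)
          then show "d \<in> {1..<n}" using \<open>d \<noteq> n\<close> by simp
        qed
        then have "card (?Dv - {n}) \<le> card {1..<n}" by (intro card_mono) auto
        then have "card (?Dv - {n}) \<le> n - 1" by simp
        then show "real (card (?Dv - {n})) \<le> real n - 1" using npos by linarith
      qed simp
      finally show ?thesis .
    qed
    have "real (f n) \<le> real q ^ t"
      unfolding fsum'[symmetric] using fin by (intro member_le_sum) auto
    then have "real (f n) * \<delta> n \<le> real q ^ t * ((real n - 1) * sqrt (real q))"
      using npos by (intro order.trans[OF \<delta>n'] mult_right_mono) auto
    moreover have "(real n - 1) * real q ^ t < real q ^ t * sqrt (real q)"
      using False qpos by (simp add: mult.commute)
    moreover have "(\<Sum>d\<in>?Dv. real (f d) * \<delta> d) = real (f n) * \<delta> n + (\<Sum>d\<in>?Dv - {n}. real (f d) * \<delta> d)"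
      using fin by (intro sum.remove) auto
    ultimately have "(\<Sum>d\<in>?Dv. real (f d) * \<delta> d) < real q ^ t * ((real n - 1) * sqrt (real q)) + real q ^ t * sqrt (real q)"
      using rest by linarith
    then show ?thesis unfolding pw by (simp add: algebra_simps)
  qed
qed

end

theorem theorem3p1:
  fixes R :: "('a, 'b) ring_scheme" (structure)
    and K A :: "'a set"
    and q n t :: nat
    and \<chi> :: "'a \<Rightarrow> complex"
  assumes "primepow q"
    and "n > 1"
    and "field R" and "order R = q ^ n"
    and "subfield K R" and "card K = q"
    and "t \<ge> 1" and "affine_space_of_dim R K t A"
    and "multiplicative_character R \<chi>" and "\<not> trivial_on R \<chi> (carrier R)"
  shows "cmod (\<Sum>b\<in>K. \<Sum>a\<in>A. \<chi> (a \<oplus> b))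
           \<le> (\<Sum>d | d dvd n. real (num_of_degree R K A d) * delta R q \<chi> d)
       \<and> (num_of_degree R K A n > 0 \<longrightarrow>
           cmod (\<Sum>b\<in>K. \<Sum>a\<in>A. \<chi> (a \<oplus> b)) < real n * real q powr (real t + 1 / 2))"
proof -
  obtain p k where pk: "Factorial_Ring.prime p" "k > 0" "q = p ^ k"
    using assms(1) unfolding primepow_def by auto
  interpret field R by fact
  interpret finite_extension_field R K p k q n
    by (intro finite_extension_field.intro finite_base.intro finite_base_axioms.intro
        finite_extension_field_axioms.intro assms pk) (use assms(2) in simp)
  obtain u V where uV: "u \<in> carrier R" "subalgebra K V R" "dimension t K V" "A = u <+\<^bsub>R\<^esub> V"
    using assms(8) unfolding affine_space_of_dim_def by blast
  have VR: "V \<subseteq> carrier R" using subalgebra_in_carrier[OF uV(2)] .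
  have cV: "card V = q ^ t" "finite V" using card_dimension[OF K finite_K uV(3)] card_K by auto
  have A: "A = (\<lambda>v. u \<oplus> v) ` V" unfolding uV(4) a_l_coset_def l_coset_def by auto
  have AR: "A \<subseteq> carrier R" unfolding A using VR uV by auto
  have finA: "finite A" unfolding A using cV by simp
  have cA: "card A = q ^ t"
    unfolding A using VR uV by (subst card_image) (auto simp: inj_on_def subset_iff cV)
  have finD: "finite {d. d dvd n}" using npos by simp
  have degA: "degree_over R K ` A \<subseteq> {d. d dvd n}" using deg_dvd AR by auto
  have first: "cmod (\<Sum>b\<in>K. \<Sum>a\<in>A. \<chi> (a \<oplus> b))
    \<le> (\<Sum>d | d dvd n. real (num_of_degree R K A d) * delta R q \<chi> d)"
  proof -
    have "cmod (\<Sum>b\<in>K. \<Sum>a\<in>A. \<chi> (a \<oplus> b)) = cmod (\<Sum>a\<in>A. \<Sum>b\<in>K. \<chi> (a \<oplus> b))"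
      by (subst sum.swap) simp
    also have "\<dots> \<le> (\<Sum>a\<in>A. delta R q \<chi> (dg a))"
      using character_sum_bound[OF assms(9)] AR by (intro sum_norm_le) auto
    also have "\<dots> = (\<Sum>d | d dvd n. \<Sum>a\<in>{a \<in> A. dg a = d}. delta R q \<chi> (dg a))"
      by (rule sum.group[symmetric, OF finA finD degA])
    also have "\<dots> = (\<Sum>d | d dvd n. real (num_of_degree R K A d) * delta R q \<chi> d)"
      unfolding num_of_degree_def by (intro sum.cong refl) simp
    finally show ?thesis .
  qed
  moreover have "(\<Sum>d | d dvd n. real (num_of_degree R K A d) * delta R q \<chi> d)
      < real n * real q powr (real t + 1 / 2)" if pos: "num_of_degree R K A n > 0"
  proof (rule weighted_divisor_sum_less[where f = "num_of_degree R K A", OF _ assms(7) pos])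
    show "(\<Sum>d | d dvd n. num_of_degree R K A d) = q ^ t"
    proof -
      have "(\<Sum>d | d dvd n. \<Sum>a\<in>{a \<in> A. dg a = d}. 1 :: nat) = (\<Sum>a\<in>A. 1)"
        by (rule sum.group[OF finA finD degA])
      then show ?thesis unfolding num_of_degree_def cA[symmetric] by simp
    qed
    obtain z where z: "z \<in> A" "dg z = n"
      using pos unfolding num_of_degree_def by (metis (mono_tags, lifting) Collect_empty_eq card.empty less_irrefl)
    have zR: "z \<in> carrier R" using z AR by auto
    show "num_of_degree R K A d \<le> q ^ (t - 1)" if d: "d dvd n" "d < n" for d
    proof -
      have "d > 0" using d npos dvd_pos_nat by blast
      then show ?thesis
        unfolding num_of_degree_def uV(4)
        using card_affine_inter_Fix[OF uV(2) cV(1) assms(7) uV(1) _ z(2)] z(1) d uV(4) by blast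
    qed
    show "delta R q \<chi> d \<le> real q" for d unfolding delta_def by simp
    \<comment> \<open>The element \<open>z\<close> of degree \<open>n\<close> identifies the
      subfield of order \<open>q ^ n\<close> with the whole field, so the nontriviality of \<chi>
      selects the second branch of \<open>delta\<close> at \<open>n\<close>.\<close>
    have "card (Fix n) = q ^ n" using card_Fix_deg[OF zR] z(2) by simp
    then have "subfield_of_order R (q ^ n) = carrier R"
      using subfield_of_order_eq[OF npos] frob_n by auto
    then show "delta R q \<chi> n \<le> (real n - 1) * sqrt (real q)"
      using assms(10) unfolding delta_def by simp
  qed
  ultimately show ?thesis by fastforce
qed

end
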